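(* Let $X\subset\mathbb{R}^n$ be open, let $u,v:X\to\mathbb{R}$ be quasi-convex, and suppose $w\equiv u+v$ has an upper contact jet $(p_0,A_0)$ at $x_0\in X$. Then $x_0$ is an upper contact point for both $u$ and $v$, and moreover: (a) Both $u$ and $v$ are differentiable at $x_0$, and every upper contact jet of $u$ (resp. $v$) at $x_0$ has first component $D_{x_0}u$ (resp. $D_{x_0}v$). (b) For any sequence $x_j\to x_0$ such that $u$ and $v$ are differentiable at each $x_j$, we have $D_{x_j}u\to D_{x_0}u$ and $D_{x_j}v\to D_{x_0}v$. (c) For every set $E$ of full measure near $x_0$ there exists a sequence $x_j\to x_0$ with $x_j\in E$, both $u$ and $v$ twice differentiable at each $x_j$, such that $D^2_{x_j}u\to A$ and $D^2_{x_j}v\to B$ for some $A,B\in\mathrm{Sym}^2(\mathbb{R}^n)$ with $A+B\le A_0$.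
   Context: $\mathrm{Sym}^2(\mathbb{R}^n)$ is the space of real symmetric $n\times n$ matrices, $A\le B$ meaning $B-A$ positive semidefinite. A pair $(p,A)\in\mathbb{R}^n\times\mathrm{Sym}^2(\mathbb{R}^n)$ is an upper contact jet for a function $w$ at $x$ if $w(y)\le w(x)+\langle p,y-x\rangle+\tfrac12\langle A(y-x),y-x\rangle$ for all $y$ near $x$; $x$ is then an upper contact point of $w$. A function is quasi-convex if $w(y)+\frac\lambda2|y|^2$ is convex for some $\lambda\ge 0$. *)

theory Defs
  imports "HOL-Analysis.Analysis"
begin

definition sym_mat :: "real^'n^'n \<Rightarrow> bool" where
  "sym_mat A \<longleftrightarrow> transpose A = A"

definition psd_le :: "real^'n^'n \<Rightarrow> real^'n^'n \<Rightarrow> bool" where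
  "psd_le A B \<longleftrightarrow> (\<forall>x. 0 \<le> x \<bullet> ((B - A) *v x))"

text \<open>Quasi-convexity on the open set X: w + (lambda/2)|y|^2 is convex (on every convex
  subset of X, i.e. along every segment contained in X) for some lambda \<ge> 0.\<close>
definition quasi_convex_on :: "(real^'n) set \<Rightarrow> (real^'n \<Rightarrow> real) \<Rightarrow> bool" where
  "quasi_convex_on X w \<longleftrightarrow>
     (\<exists>c\<ge>0. \<forall>C. convex C \<and> C \<subseteq> X \<longrightarrow> convex_on C (\<lambda>y. w y + c / 2 * (norm y)\<^sup>2))"

definition upper_contact_jet ::
  "(real^'n) set \<Rightarrow> (real^'n \<Rightarrow> real) \<Rightarrow> real^'n \<Rightarrow> real^'n \<Rightarrow> real^'n^'n \<Rightarrow> bool" where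
  "upper_contact_jet X w x p A \<longleftrightarrow> x \<in> X \<and> sym_mat A \<and>
     (\<exists>r>0. \<forall>y\<in>X. dist y x < r \<longrightarrow>
        w y \<le> w x + p \<bullet> (y - x) + 1/2 * ((A *v (y - x)) \<bullet> (y - x)))"

definition upper_contact_point :: "(real^'n) set \<Rightarrow> (real^'n \<Rightarrow> real) \<Rightarrow> real^'n \<Rightarrow> bool" where
  "upper_contact_point X w x \<longleftrightarrow> (\<exists>p A. upper_contact_jet X w x p A)"

text \<open>w is twice differentiable at x with gradient p and Hessian A (second order
  Taylor expansion, in the sense of Alexandrov / Peano).\<close>
definition has_second_jet :: "(real^'n \<Rightarrow> real) \<Rightarrow> real^'n \<Rightarrow> real^'n \<Rightarrow> real^'n^'n \<Rightarrow> bool" where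
  "has_second_jet w x p A \<longleftrightarrow> sym_mat A \<and>
     ((\<lambda>y. (w y - w x - p \<bullet> (y - x) - 1/2 * ((A *v (y - x)) \<bullet> (y - x))) / (norm (y - x))\<^sup>2)
        \<longlongrightarrow> 0) (at x)"

end

theory Submission
  imports Defs
begin

text \<open>
  Near \<open>x0\<close> write \<open>u\<close> and \<open>v\<close> as convex functions minus a multiple of \<open>|y|\<^sup>2 / 2\<close>. An upper
  contact jet of the sum, combined with a subgradient of either summand, gives a quadratic upper
  bound for the other one; hence first-order differentiability, and subgradients at distance
  \<open>r\<close> from the contact point differ from the gradient there by \<open>O(r)\<close>.

  For the second-order part, perturb \<open>A0\<close> by a small multiple of the identity and tilt by small
  linear functions: the maximisers form a set of contact points that is not null, because the tilt
  is a Lipschitz function of the maximiser. It remains to see that a convex function \<open>f\<close> is twice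
  differentiable at almost every point of contact from above. In one dimension, a Vitali argument
  for the monotone derivative shows that the second difference quotients along a fixed direction
  have a limit almost everywhere, and Fubini transfers this to all dimensions. At a contact point
  that is in addition a non-porosity point of the sets on which these quotients are
  nearly constant, the quotients at all nearby points are close to the limit at
  the point itself. So the blow-ups \<open>(f (x + t h) - f x - t (p \<bullet> h)) / t\<^sup>2\<close>, which are
  equi-Lipschitz, converge, and their limit satisfies the parallelogram law: it is a quadratic form.
\<close>

text \<open>The estimate behind the second-order part: let \<open>fhat\<close> be the function minus
  its tangent at the contact point x. Contact makes \<open>fhat\<close> Lipschitz with constant O(r)
  on the ball of radius r about x, so moving the centre of a second difference by
  \<open>\<eta> * r\<close> changes it by only O(\<open>\<eta>\<close> r^2), a small fraction of
  r^2. Non-porosity supplies, within \<open>\<eta> * r\<close> of every z in that ball, a point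
  whose quotients are known at all small steps; this turns almost-everywhere information into
  information at every nearby point. The exceptional sets are indexed by countable data (a direction
  from a countable dense set, rational bounds, a scale, a porosity ratio), so their union is null;
  the other directions follow by equi-Lipschitz continuity of the blow-ups. For the limit in (c) the
  Hessians must stay bounded. Convexity bounds each from below and contact bounds their sum from
  above; hence each is bounded on both sides.\<close>

subsection \<open>Convex functions and subgradients\<close>

text \<open>A step of length h loses at most C h^2, so n equal steps lose C s^2 / n in total, which
  tends to 0. This replaces the integration of a derivative where only subgradients are at
  hand.\<close>

lemma increments_ge_imp_ge:
  fixes \<psi> :: "real \<Rightarrow> real"
  assumes "0 \<le> s" and inc: "\<And>a b. 0 \<le> a \<Longrightarrow> a \<le> b \<Longrightarrow> b \<le> s \<Longrightarrow> - C * (b - a)\<^sup>2 \<le> \<psi> b - \<psi> a"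
  shows "\<psi> 0 \<le> \<psi> s"
proof -
  have bound: "- C * s\<^sup>2 * inverse (real (Suc n)) \<le> \<psi> s - \<psi> 0" for n
  proof -
    let ?t = "\<lambda>i. real i * s / real (Suc n)"
    have "(\<Sum>i<Suc n. - C * (s / real (Suc n))\<^sup>2) \<le> (\<Sum>i<Suc n. \<psi> (?t (Suc i)) - \<psi> (?t i))"
    proof (rule sum_mono)
      fix i assume "i \<in> {..<Suc n}"
      then have "real (Suc i) \<le> real (Suc n)" by simp
      then have "real (Suc i) * s / real (Suc n) \<le> s"
        using \<open>0 \<le> s\<close> by (simp add: divide_le_eq mult.commute mult_left_mono del: of_nat_Suc)
      moreover have "?t (Suc i) - ?t i = s / real (Suc n)"
        by (simp add: diff_divide_distrib[symmetric] left_diff_distrib[symmetric] del: of_nat_Suc)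
      moreover have "?t i \<le> ?t (Suc i)"
        using \<open>0 \<le> s\<close> by (intro divide_right_mono mult_right_mono) auto
      moreover have "0 \<le> ?t i" using \<open>0 \<le> s\<close> by simp
      ultimately show "- C * (s / real (Suc n))\<^sup>2 \<le> \<psi> (?t (Suc i)) - \<psi> (?t i)"
        using inc[of "?t i" "?t (Suc i)"] by simp
    qed
    also have "\<dots> = \<psi> (?t (Suc n)) - \<psi> (?t 0)" by (rule sum_lessThan_telescope)
    also have "\<dots> = \<psi> s - \<psi> 0" by simp
    finally show ?thesis by (simp add: power2_eq_square field_simps del: of_nat_Suc)
  qed
  have "(\<lambda>n. - C * s\<^sup>2 * inverse (real (Suc n))) \<longlonglongrightarrow> - C * s\<^sup>2 * 0"
    by (intro tendsto_mult_left LIMSEQ_inverse_real_of_nat)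
  then have "- C * s\<^sup>2 * 0 \<le> \<psi> s - \<psi> 0"
    by (rule LIMSEQ_le_const2) (use bound in blast)
  then show ?thesis by simp
qed

text \<open>Separate the epigraph from the vertical ray below \<open>(x, f x)\<close>; the slope is
  read off the normal. The hyperplane cannot be vertical because \<open>x\<close> is an interior
  point of \<open>S\<close>.\<close>

lemma convex_on_subgradient:
  fixes f :: "'a::euclidean_space \<Rightarrow> real"
  assumes cf: "convex_on S f" and "open S" "x \<in> S"
  obtains s where "\<And>y. y \<in> S \<Longrightarrow> f x + s \<bullet> (y - x) \<le> f y"
proof -
  let ?A = "{x} \<times> {..<f x}"
  have "convex ?A" by (intro convex_Times) auto
  moreover have "convex (epigraph S f)" using cf by (rule convex_epigraphI)
  moreover have "?A \<noteq> {}" by auto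
  moreover have "(x, f x) \<in> epigraph S f" using \<open>x \<in> S\<close> by (auto simp: mem_epigraph)
  then have "epigraph S f \<noteq> {}" by blast
  moreover have "?A \<inter> epigraph S f = {}" by (auto simp: epigraph_def)
  ultimately obtain c d b where nz: "(c, d) \<noteq> 0" and A: "\<forall>z\<in>?A. (c, d) \<bullet> z \<le> b"
    and E: "\<forall>z\<in>epigraph S f. b \<le> (c, d) \<bullet> z"
    using separating_hyperplane_sets by (metis surj_pair)
  have A': "c \<bullet> x + d * r \<le> b" if "r < f x" for r
    using A that by (auto simp: inner_prod_def)
  have E': "b \<le> c \<bullet> y + d * r" if "y \<in> S" "f y \<le> r" for y r
    using E that by (auto simp: epigraph_def)
  have d0: "0 \<le> d"
    using A'[of "f x - 1"] E'[OF \<open>x \<in> S\<close>, of "f x"] by (simp add: algebra_simps)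
  \<comment> \<open>The ray is open at its top, so the bound at \<open>f x\<close> is a limit. The
    divisor \<open>d + 1\<close> is positive even though \<open>d = 0\<close> is still possible
    here.\<close>
  have Ax: "c \<bullet> x + d * f x \<le> b"
  proof (rule field_le_epsilon)
    fix e :: real assume "0 < e"
    then have "c \<bullet> x + d * (f x - e / (d + 1)) \<le> b" using d0 by (intro A') auto
    moreover have "d * (e / (d + 1)) \<le> e"
      using d0 \<open>0 < e\<close> by (simp add: field_simps)
    ultimately show "c \<bullet> x + d * f x \<le> b + e" by (simp add: algebra_simps)
  qed
  \<comment> \<open>With \<open>d = 0\<close> the form \<open>c\<close> would attain its minimum
    over \<open>S\<close> at \<open>x\<close>; but a small move from \<open>x\<close> against
    \<open>c\<close> stays in \<open>S\<close> and lowers it.\<close>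
  have "d \<noteq> 0"
  proof
    assume d: "d = 0"
    then have c: "c \<noteq> 0" using nz by (simp add: prod_eq_iff)
    obtain e where e: "0 < e" "ball x e \<subseteq> S"
      using \<open>open S\<close> \<open>x \<in> S\<close> open_contains_ball by blast
    let ?y = "x - (e / 2 / norm c) *\<^sub>R c"
    have "?y \<in> S" using e c by (auto simp: dist_norm subset_iff)
    then have "c \<bullet> x \<le> c \<bullet> ?y" using E'[of ?y "f ?y"] Ax d by auto
    then have "e / 2 / norm c * (c \<bullet> c) \<le> 0" by (simp add: inner_diff_right)
    moreover have "0 < e / 2 / norm c * (c \<bullet> c)" using e c by (intro mult_pos_pos) auto
    ultimately show False by linarith
  qed
  with d0 have dp: "0 < d" by simp
  show thesis
  proof
    fix y assume "y \<in> S"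
    then have "c \<bullet> x + d * f x \<le> c \<bullet> y + d * f y" using E'[of y "f y"] Ax by auto
    then have "f x - f y \<le> (c \<bullet> y - c \<bullet> x) / d"
      by (subst pos_le_divide_eq[OF dp]) (simp add: algebra_simps)
    then show "f x + (- (1 / d) *\<^sub>R c) \<bullet> (y - x) \<le> f y"
      by (simp add: inner_diff_right diff_divide_distrib)
  qed
qed

text \<open>The extension is the supremum of the supporting affine functions at the points of the
  inner ball, finite everywhere because their slopes are bounded. It allows second differences at
  any point with any step, and translations along whole lines.\<close>

lemma convex_extension_from_cball:
  fixes f :: "'a::euclidean_space \<Rightarrow> real"
  assumes cf: "convex_on (ball a R) f" and "0 < r" "r < R"
  obtains F where "convex_on UNIV F" "\<And>x. x \<in> cball a r \<Longrightarrow> F x = f x"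
proof -
  have "\<forall>x\<in>ball a R. \<exists>s. \<forall>y\<in>ball a R. f x + s \<bullet> (y - x) \<le> f y"
    using convex_on_subgradient[OF cf open_ball] by metis
  then obtain s where s: "\<And>x y. x \<in> ball a R \<Longrightarrow> y \<in> ball a R \<Longrightarrow> f x + s x \<bullet> (y - x) \<le> f y"
    by metis
  \<comment> \<open>Intermediate radius: \<open>f\<close> is bounded on the closed ball of this
    size, and from the inner ball one can move by \<open>?e\<close>, the gap between
    \<open>r\<close> and \<open>?r'\<close>, inside it. A steep slope would exceed the bound at the
    end of such a move.\<close>
  let ?r' = "(r + R) / 2"
  have cont: "continuous_on (ball a R) f"
    using convex_on_continuous[OF open_ball cf] .
  have sub: "cball a ?r' \<subseteq> ball a R" using \<open>r < R\<close> by auto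
  have "compact (f ` cball a ?r')"
    by (intro compact_continuous_image continuous_on_subset[OF cont sub] compact_cball)
  then obtain B where B: "\<And>x. x \<in> cball a ?r' \<Longrightarrow> \<bar>f x\<bar> \<le> B"
    by (metis bounded_iff compact_imp_bounded imageI real_norm_def)
  let ?e = "(R - r) / 2"
  have e: "0 < ?e" using \<open>r < R\<close> by simp
  have sb: "norm (s x) \<le> 2 * B / ?e" if x: "x \<in> cball a r" for x
  proof (cases "s x = 0")
    case True
    have "0 \<le> B" using B[of a] \<open>0 < r\<close> \<open>r < R\<close> by force
    then show ?thesis using True e by simp
  next
    case False
    let ?y = "x + (?e / norm (s x)) *\<^sub>R s x"
    have "dist a ?y \<le> dist a x + dist x ?y" by (rule dist_triangle)
    also have "dist x ?y = ?e" using False e by (simp add: dist_norm)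
    finally have y: "?y \<in> cball a ?r'" using x by (simp add: field_simps)
    have xr: "x \<in> cball a ?r'" using x \<open>r < R\<close> by auto
    have "f x + s x \<bullet> (?y - x) \<le> f ?y" by (rule s) (use xr y sub in blast)+
    moreover have "s x \<bullet> (?y - x) = ?e * norm (s x)"
      using False by (simp add: power2_norm_eq_inner[symmetric] power2_eq_square)
    ultimately have "?e * norm (s x) \<le> 2 * B" using B[OF y] B[OF xr] by linarith
    then show ?thesis using e by (simp add: field_simps)
  qed
  define F where "F y = (SUP x\<in>cball a r. f x + s x \<bullet> (y - x))" for y
  have bdd: "bdd_above ((\<lambda>x. f x + s x \<bullet> (y - x)) ` cball a r)" for y
  proof (rule bdd_aboveI2)
    fix x assume x: "x \<in> cball a r"
    have "s x \<bullet> (y - x) \<le> norm (s x) * norm (y - x)" by (rule norm_cauchy_schwarz)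
    also have "\<dots> \<le> 2 * B / ?e * (norm (y - a) + r)"
    proof (rule mult_mono[OF sb[OF x]])
      show "norm (y - x) \<le> norm (y - a) + r"
        using norm_triangle_ineq[of "y - a" "a - x"] x by (simp add: dist_norm)
      show "0 \<le> 2 * B / ?e" using sb[OF x] norm_ge_zero order_trans by blast
    qed simp
    finally show "f x + s x \<bullet> (y - x) \<le> B + 2 * B / ?e * (norm (y - a) + r)"
      using B[of x] x \<open>r < R\<close> by force
  qed
  have ne: "cball a r \<noteq> {}" using \<open>0 < r\<close> by simp
  show thesis
  proof
    show "F y = f y" if y: "y \<in> cball a r" for y
    proof (rule antisym)
      show "F y \<le> f y" unfolding F_def
        by (rule cSUP_least[OF ne]) (use y s \<open>r < R\<close> in auto)
      have "f y + s y \<bullet> (y - y) \<le> F y" unfolding F_def by (rule cSUP_upper[OF y bdd])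
      then show "f y \<le> F y" by simp
    qed
    show "convex_on UNIV F"
    proof (rule convex_onI)
      fix t :: real and y z assume t: "0 < t" "t < 1"
      show "F ((1 - t) *\<^sub>R y + t *\<^sub>R z) \<le> (1 - t) * F y + t * F z"
        unfolding F_def[of "(1 - t) *\<^sub>R y + t *\<^sub>R z"]
      proof (rule cSUP_least[OF ne])
        fix x assume x: "x \<in> cball a r"
        have "f x + s x \<bullet> ((1 - t) *\<^sub>R y + t *\<^sub>R z - x)
            = (1 - t) * (f x + s x \<bullet> (y - x)) + t * (f x + s x \<bullet> (z - x))"
          by (simp add: inner_simps algebra_simps)
        also have "\<dots> \<le> (1 - t) * F y + t * F z"
          unfolding F_def using t
          by (intro add_mono mult_left_mono cSUP_upper[OF x bdd]) auto
        finally show "f x + s x \<bullet> ((1 - t) *\<^sub>R y + t *\<^sub>R z - x) \<le> (1 - t) * F y + t * F z" .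
      qed
    qed simp
  qed
qed

text \<open>Go from \<open>z\<close> a distance r in the direction of \<open>s - p\<close>. The
  subgradient at \<open>z\<close> forces an excess of r |s - p| over the tangent at
  \<open>x\<close>, while contact allows at most M (2 r)^2 within distance 2 r of
  \<open>x\<close>.\<close>

lemma subgradient_close_to_contact_gradient:
  fixes f :: "'a::euclidean_space \<Rightarrow> real"
  assumes low: "f x + p \<bullet> (z - x) \<le> f z"
    and up: "\<And>y. y \<in> cball x (2 * r) \<Longrightarrow> f y \<le> f x + p \<bullet> (y - x) + M * (norm (y - x))\<^sup>2"
    and s: "\<And>y. y \<in> cball x (2 * r) \<Longrightarrow> f z + s \<bullet> (y - z) \<le> f y"
    and "0 < r" "z \<in> cball x r" "0 \<le> M"
  shows "norm (s - p) \<le> 4 * M * r"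
proof (cases "s = p")
  case False
  let ?h = "(r / norm (s - p)) *\<^sub>R (s - p)"
  let ?y = "z + ?h"
  have nh: "norm ?h = r" using False \<open>0 < r\<close> by simp
  have "norm (?y - x) \<le> norm (z - x) + norm ?h"
    by (metis add_diff_eq add.commute norm_triangle_ineq add_diff_cancel_left' diff_add_eq)
  then have ny: "norm (?y - x) \<le> 2 * r" using nh \<open>z \<in> cball x r\<close>
    by (simp add: dist_norm norm_minus_commute)
  then have y: "?y \<in> cball x (2 * r)" by (simp add: dist_norm norm_minus_commute)
  have "(norm (?y - x))\<^sup>2 \<le> (2 * r)\<^sup>2" using ny by (intro power_mono) auto
  then have M: "M * (norm (?y - x))\<^sup>2 \<le> M * (2 * r)\<^sup>2" using \<open>0 \<le> M\<close> by (rule mult_left_mono)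
  have "f z + s \<bullet> (?y - z) \<le> f x + p \<bullet> (?y - x) + M * (2 * r)\<^sup>2"
    using s[OF y] up[OF y] M by linarith
  moreover have "s \<bullet> (?y - z) = s \<bullet> ?h" "p \<bullet> (?y - x) = p \<bullet> ?h + p \<bullet> (z - x)"
    by (simp_all add: inner_diff_right inner_add_right)
  ultimately have "(s - p) \<bullet> ?h \<le> M * (2 * r)\<^sup>2" using low
    unfolding inner_diff_left by linarith
  moreover have "(s - p) \<bullet> ?h = r * norm (s - p)"
    using False by (simp add: power2_norm_eq_inner[symmetric] power2_eq_square)
  ultimately have "r * norm (s - p) \<le> r * (4 * M * r)" by (simp add: power2_eq_square mult_ac)
  then show ?thesis using \<open>0 < r\<close> by simp
qed (use assms in simp)

subsection \<open>Vitali coverings and porous sets\<close>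

text \<open>The countable Vitali family covers \<open>S\<close> up to a null set; cutting it to a
  finite part at the price of \<open>e\<close> keeps the later sums of measures and increments
  finite.\<close>

lemma Vitali_finite_disjoint_balls:
  fixes a :: "'i \<Rightarrow> 'a::euclidean_space"
  assumes S: "S \<in> lmeasurable"
    and fine: "\<And>x d. x \<in> S \<Longrightarrow> 0 < d \<Longrightarrow> \<exists>i. i \<in> K \<and> x \<in> ball (a i) (r i) \<and> r i < d"
    and "0 < e"
  obtains F where "finite F" "F \<subseteq> K"
    "pairwise (\<lambda>i j. disjnt (ball (a i) (r i)) (ball (a j) (r j))) F"
    "measure lebesgue S - e < measure lebesgue (S \<inter> (\<Union>i\<in>F. ball (a i) (r i)))"
proof -
  obtain C where C: "countable C" "C \<subseteq> K"
     "pairwise (\<lambda>i j. disjnt (ball (a i) (r i)) (ball (a j) (r j))) C"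
     "negligible (S - (\<Union>i \<in> C. ball (a i) (r i)))"
    using Vitali_covering_theorem_balls[of S K a r] fine by blast
  let ?D = "(\<lambda>i. S \<inter> ball (a i) (r i)) ` C"
  have "?D \<subseteq> lmeasurable" using S by auto
  then have meas: "d \<in> lmeasurable" if "d \<in> ?D" for d using that by blast
  have "\<exists>D'. D' \<subseteq> ?D \<and> finite D' \<and> measure lebesgue (\<Union>?D) - e < measure lebesgue (\<Union>D')"
  proof (rule measure_countable_Union_approachable[of ?D e "measure lebesgue S"])
    show "measure lebesgue (\<Union>D') \<le> measure lebesgue S" if "D' \<subseteq> ?D" "finite D'" for D'
      using that meas S by (intro measure_mono_fmeasurable fmeasurableD fmeasurable.finite_Union) auto
  qed (use C \<open>0 < e\<close> meas in blast)+
  then obtain F where F: "finite F" "F \<subseteq> C"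
    and mF: "measure lebesgue (\<Union>?D) - e < measure lebesgue (\<Union>i\<in>F. S \<inter> ball (a i) (r i))"
    by (metis (no_types, lifting) finite_subset_image)
  have "measure lebesgue (\<Union>?D) = measure lebesgue S"
  proof (rule measure_negligible_symdiff[OF S])
    have "S - \<Union>?D \<union> (\<Union>?D - S) = S - (\<Union>i \<in> C. ball (a i) (r i))" by auto
    then show "negligible (S - \<Union>?D \<union> (\<Union>?D - S))" using C by simp
  qed
  moreover have "(\<Union>i\<in>F. S \<inter> ball (a i) (r i)) = S \<inter> (\<Union>i\<in>F. ball (a i) (r i))" by auto
  ultimately show thesis
    using that[of F] F mF C pairwise_subset[OF C(3) F(2)] by auto
qed

lemma borel_for_arbitrarily_small:
  fixes P :: "real \<Rightarrow> 'a::topological_space \<Rightarrow> bool"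
  assumes "\<And>s. 0 < s \<Longrightarrow> open {x. P s x}"
  shows "{x. \<forall>d>0. \<exists>s. 0 < s \<and> s < d \<and> P s x} \<in> sets borel"
proof -
  have "{x. \<forall>d>0. \<exists>s. 0 < s \<and> s < d \<and> P s x}
      = (\<Inter>n. \<Union>s\<in>{0<..<inverse (real (Suc n))}. {x. P s x})" (is "?L = ?R")
  proof (intro equalityI subsetI)
    fix x assume x: "x \<in> ?R"
    show "x \<in> ?L"
    proof safe
      fix d :: real assume "0 < d"
      then obtain n where n: "inverse (real (Suc n)) < d" using reals_Archimedean by blast
      have "x \<in> (\<Union>s\<in>{0<..<inverse (real (Suc n))}. {x. P s x})" using x by blast
      then obtain s where "0 < s" "s < inverse (real (Suc n))" "P s x" by auto
      with n show "\<exists>s. 0 < s \<and> s < d \<and> P s x" by (intro exI[of _ s]) auto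
    qed
  next
    fix x assume x: "x \<in> ?L"
    have "\<exists>s. 0 < s \<and> s < inverse (real (Suc n)) \<and> P s x" for n
      using x by simp
    then show "x \<in> ?R" by (simp del: of_nat_Suc) (metis greaterThanLessThan_iff)
  qed
  also have "\<dots> \<in> sets borel"
    by (intro sets.countable_INT) (auto intro!: open_UN borel_open assms)
  finally show ?thesis .
qed

lemma lmeasurable_outer_open:
  fixes S :: "'a::euclidean_space set"
  assumes S: "S \<in> lmeasurable" and "0 < e"
  obtains U where "open U" "S \<subseteq> U" "U \<in> lmeasurable" "measure lebesgue U < measure lebesgue S + e"
proof -
  obtain U where U: "open U" "S \<subseteq> U" "U - S \<in> lmeasurable" "emeasure lebesgue (U - S) < ennreal e"
    using sets_lebesgue_outer_open[of S e] S \<open>0 < e\<close> by (auto dest: fmeasurableD)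
  have eq: "U = S \<union> (U - S)" using U by auto
  have "U \<in> lmeasurable" by (subst eq) (use S U in \<open>intro fmeasurable.Un\<close>)
  moreover have "measure lebesgue U \<le> measure lebesgue S + measure lebesgue (U - S)"
    by (subst eq, rule measure_Un_le) (use S U in \<open>auto intro: fmeasurableD\<close>)
  moreover have "measure lebesgue (U - S) < e"
    using U(3,4) \<open>0 < e\<close> by (simp add: emeasure_eq_measure2 ennreal_less_iff)
  ultimately show thesis using that U by force
qed

text \<open>A disjoint Vitali family of the given balls almost covers the bounded part
  \<open>?T\<close> inside an open \<open>U\<close> that is barely larger. Each ball loses the fixed
  fraction \<open>?k\<close> of its volume to its hole, so \<open>?T\<close> has at most about 1 -
  \<open>?k\<close> times its own measure.\<close>

lemma negligible_porous:
  fixes S :: "'a::euclidean_space set"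
  assumes S: "S \<in> sets lebesgue" and "0 < \<eta>" "\<eta> \<le> 1"
    and por: "\<And>x d. x \<in> S \<Longrightarrow> 0 < d \<Longrightarrow>
      \<exists>r z. 0 < r \<and> r < d \<and> x \<in> ball z r \<and> ball z (\<eta> * r) \<inter> S = {}"
  shows "negligible S"
  unfolding negligible_on_intervals[of S]
proof (intro allI)
  fix l u :: 'a
  let ?T = "S \<inter> cbox l u"
  let ?k = "\<eta> ^ DIM('a)"
  let ?\<mu> = "measure lebesgue :: 'a set \<Rightarrow> real"
  have fin_ball: "emeasure lborel (ball z r) \<noteq> top" for z :: 'a and r
    using emeasure_lborel_ball_finite[of z r] by (simp add: less_top)
  have T: "?T \<in> lmeasurable" by (metis S fmeasurable_Int_fmeasurable Int_commute lmeasurable_cbox)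
  have k: "0 < ?k" "?k \<le> 1" using assms by (auto simp: power_le_one)
  have key: "?\<mu> ?T - e \<le> (1 - ?k) * (?\<mu> ?T + e)" if "0 < e" for e
  proof -
    obtain U where U: "open U" "?T \<subseteq> U" "U \<in> lmeasurable" "?\<mu> U < ?\<mu> ?T + e"
      using lmeasurable_outer_open[OF T \<open>0 < e\<close>] by blast
    let ?K = "{(z, r). 0 < r \<and> ball z r \<subseteq> U \<and> ball z (\<eta> * r) \<inter> S = {}}"
    have fine: "\<exists>i. i \<in> ?K \<and> x \<in> ball (fst i) (snd i) \<and> snd i < d" if xd: "x \<in> ?T" "0 < d" for x d
    proof -
      have "x \<in> U" using U(2) xd(1) by blast
      then obtain c where c: "0 < c" "ball x c \<subseteq> U" using openE[OF U(1)] by blast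
      \<comment> \<open>\<open>x\<close> need not be the centre of \<open>ball z r\<close>; radius
        below \<open>c / 2\<close> makes the diameter less than \<open>c\<close>, so the ball stays
        in \<open>ball x c\<close>.\<close>
      obtain r z where rz: "0 < r" "r < min d (c / 2)" "x \<in> ball z r" "ball z (\<eta> * r) \<inter> S = {}"
        using por[of x "min d (c / 2)"] xd c by auto
      have "ball z r \<subseteq> ball x c"
      proof
        fix y assume "y \<in> ball z r"
        then show "y \<in> ball x c" using rz dist_triangle[of x y z] by (auto simp: dist_commute)
      qed
      with c rz show ?thesis by (intro exI[of _ "(z, r)"]) auto
    qed
    obtain F where F: "finite F" "F \<subseteq> ?K"
      "pairwise (\<lambda>i j. disjnt (ball (fst i) (snd i)) (ball (fst j) (snd j))) F"
      "?\<mu> ?T - e < ?\<mu> (?T \<inter> (\<Union>i\<in>F. ball (fst i) (snd i)))"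
      by (rule Vitali_finite_disjoint_balls[where a=fst and r=snd, OF T fine \<open>0 < e\<close>])
    have "?\<mu> (?T \<inter> (\<Union>i\<in>F. ball (fst i) (snd i))) = ?\<mu> (\<Union>i\<in>F. ?T \<inter> ball (fst i) (snd i))"
      by (rule arg_cong[where f="?\<mu>"]) auto
    also have "\<dots> \<le> (\<Sum>i\<in>F. ?\<mu> (?T \<inter> ball (fst i) (snd i)))"
      by (rule measure_UNION_le[OF F(1)]) (use T in \<open>auto intro: fmeasurableD\<close>)
    also have "\<dots> \<le> (\<Sum>i\<in>F. (1 - ?k) * ?\<mu> (ball (fst i) (snd i)))"
    proof (rule sum_mono)
      fix i assume "i \<in> F"
      then obtain z r where i: "i = (z, r)" "0 < r" "ball z (\<eta> * r) \<inter> S = {}" using F by auto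
      have sub: "ball z (\<eta> * r) \<subseteq> ball z r" using i \<open>\<eta> \<le> 1\<close> by (intro subset_ball) simp
      have "?\<mu> (?T \<inter> ball z r) \<le> ?\<mu> (ball z r - ball z (\<eta> * r))"
        using i T by (intro measure_mono_fmeasurable) (auto intro: fmeasurableD fmeasurable_Diff)
      also have "\<dots> = ?\<mu> (ball z r) - ?\<mu> (ball z (\<eta> * r))"
        using sub by (intro measurable_measure_Diff) auto
      also have "?\<mu> (ball z (\<eta> * r)) = ?k * ?\<mu> (ball z r)"
        using i \<open>0 < \<eta>\<close> by (simp add: content_ball_conv_unit_ball[of r z]
            content_ball_conv_unit_ball[of "\<eta> * r" z] power_mult_distrib)
      finally show "?\<mu> (?T \<inter> ball (fst i) (snd i)) \<le> (1 - ?k) * ?\<mu> (ball (fst i) (snd i))"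
        using i by (simp add: algebra_simps)
    qed
    also have "\<dots> = (1 - ?k) * ?\<mu> (\<Union>i\<in>F. ball (fst i) (snd i))"
      using F(1,3)
      by (subst measure_finite_Union)
         (auto simp: sum_distrib_left disjoint_family_on_def pairwise_def disjnt_def fin_ball)
    also have "\<dots> \<le> (1 - ?k) * ?\<mu> U"
    proof (rule mult_left_mono)
      have "(\<Union>i\<in>F. ball (fst i) (snd i)) \<subseteq> U" using F(2) by fastforce
      then show "?\<mu> (\<Union>i\<in>F. ball (fst i) (snd i)) \<le> ?\<mu> U"
        by (rule measure_mono_fmeasurable[OF _ _ U(3)]) (use F(1) in auto)
    qed (use k in simp)
    also have "\<dots> \<le> (1 - ?k) * (?\<mu> ?T + e)"
      using U k by (intro mult_left_mono) auto
    finally show ?thesis using F(4) by linarith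
  qed
  have "?\<mu> ?T = 0"
  proof (rule ccontr)
    assume "?\<mu> ?T \<noteq> 0"
    then have "0 < ?\<mu> ?T" by (simp add: zero_less_measure_iff)
    \<comment> \<open>The estimate \<open>key\<close> rearranges to k m <= (2 - k) e with m the
      measure of \<open>?T\<close>, which fails at e = k m / 4.\<close>
    then have "0 < ?k * ?\<mu> ?T / 4" using k by simp
    from key[OF this] have "?\<mu> ?T * (?k / 2) + (?k * ?\<mu> ?T / 4) * ?k \<le> 0"
      by (simp add: algebra_simps)
    moreover have "0 < ?\<mu> ?T * (?k / 2)" "0 < (?k * ?\<mu> ?T / 4) * ?k"
      using k \<open>0 < ?\<mu> ?T\<close> by (auto intro!: mult_pos_pos)
    ultimately show False by linarith
  qed
  then show "negligible ?T" using T by (simp add: negligible_iff_measure0)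
qed

text \<open>Remove the interval with the largest left end: the others end before it starts, so the
  induction hypothesis applies with \<open>lo i\<close> as right end. Hence \<open>b\<close> is
  arbitrary in the induction.\<close>

lemma sum_increments_disjoint_le:
  fixes g lo hi :: "_ \<Rightarrow> real"
  assumes "mono g" "finite F" "a \<le> b"
    and "\<And>i. i \<in> F \<Longrightarrow> a \<le> lo i \<and> lo i < hi i \<and> hi i \<le> b"
    and "\<And>i j. i \<in> F \<Longrightarrow> j \<in> F \<Longrightarrow> i \<noteq> j \<Longrightarrow> hi i \<le> lo j \<or> hi j \<le> lo i"
  shows "(\<Sum>i\<in>F. g (hi i) - g (lo i)) \<le> g b - g a"
  using assms(2-)
proof (induction F arbitrary: b rule: finite_ranking_induct[where f=lo])
  case empty
  then show ?case using \<open>mono g\<close> by (auto dest: monoD)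
next
  case (insert i F)
  show ?case
  proof (cases "i \<in> F")
    case True
    then have "insert i F = F" by auto
    then show ?thesis using insert.IH[of b] insert.prems by auto
  next
    case False
    have "(\<Sum>j\<in>F. g (hi j) - g (lo j)) \<le> g (lo i) - g a"
    proof (rule insert.IH)
      fix j assume j: "j \<in> F"
      with False have "hi i \<le> lo j \<or> hi j \<le> lo i" using insert.prems(3)[of i j] by blast
      moreover have "lo j \<le> lo i" using insert j by blast
      ultimately show "a \<le> lo j \<and> lo j < hi j \<and> hi j \<le> lo i"
        using insert.prems(2)[of i] insert.prems(2)[of j] j by force
    qed (use insert.prems in auto)
    moreover have "g (hi i) \<le> g b" using \<open>mono g\<close> insert.prems by (auto dest: monoD)
    ultimately show ?thesis using insert.hyps False by simp
  qed
qed

lemma disjnt_balls_real: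
  fixes c d :: real
  assumes "disjnt (ball c r) (ball d s)" "0 < r" "0 < s"
  shows "c + r \<le> d - s \<or> d + s \<le> c - r"
proof (rule ccontr)
  assume "\<not> ?thesis"
  then have h: "d - s < c + r" "c - r < d + s" by auto
  then have "max (c - r) (d - s) < min (c + r) (d + s)" using assms by auto
  then obtain m where "max (c - r) (d - s) < m" "m < min (c + r) (d + s)" using dense by blast
  then have "m \<in> ball c r" "m \<in> ball d s" by (auto simp: dist_real_def abs_if)
  then show False using assms(1) by (auto simp: disjnt_def)
qed

subsection \<open>Second differences along lines\<close>

definition second_diff :: "('a::real_vector \<Rightarrow> real) \<Rightarrow> 'a \<Rightarrow> real \<Rightarrow> 'a \<Rightarrow> real" where
  "second_diff f v s x = f (x + s *\<^sub>R v) + f (x - s *\<^sub>R v) - 2 * f x"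

text \<open>For p < q this is oscillation of the quotient of \<open>second_diff f v s x\<close> by
  \<open>s\<^sup>2\<close> as s tends to 0. Strict inequalities without division are open in
  \<open>x\<close> for fixed s, which makes the set Borel.\<close>

definition gap_set :: "('a::real_vector \<Rightarrow> real) \<Rightarrow> 'a \<Rightarrow> real \<Rightarrow> real \<Rightarrow> 'a set" where
  "gap_set f v p q =
     {x. \<forall>d>0. \<exists>s. 0 < s \<and> s < d \<and> second_diff f v s x < p * s\<^sup>2} \<inter>
     {x. \<forall>d>0. \<exists>s. 0 < s \<and> s < d \<and> q * s\<^sup>2 < second_diff f v s x}"

lemma continuous_on_second_diff [continuous_intros]:
  fixes f :: "'a::real_normed_vector \<Rightarrow> real"
  assumes f: "continuous_on UNIV f"
  shows "continuous_on S (second_diff f v s)"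
  unfolding second_diff_def
  by (intro continuous_intros continuous_on_compose2[OF f]) auto

lemma borel_gap_set:
  fixes f :: "'a::euclidean_space \<Rightarrow> real"
  assumes f: "continuous_on UNIV f"
  shows "gap_set f v p q \<in> sets borel"
  unfolding gap_set_def
  by (intro sets.Int borel_for_arbitrarily_small)
     (auto intro!: open_Collect_less continuous_intros f)

text \<open>The two-covering proof of Lebesgue's theorem for the monotone selection \<open>g\<close>
  of subgradients. Intervals on which \<open>g\<close> grows at rate at most p cover
  \<open>?S\<close> efficiently; inside them, intervals with growth rate at least q still cover
  nearly all of it. As \<open>g\<close> is monotone, q |S| <= p |S| up to \<open>e\<close>.\<close>

lemma negligible_gap_set_real:
  fixes \<phi> :: "real \<Rightarrow> real"
  assumes cf: "convex_on UNIV \<phi>" and pq: "p < q"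
  shows "negligible (gap_set \<phi> 1 p q)"
  unfolding negligible_on_intervals[of "gap_set \<phi> 1 p q"]
proof (intro allI)
  fix l u :: real
  let ?S = "gap_set \<phi> 1 p q \<inter> cbox l u"
  let ?\<mu> = "measure lebesgue :: real set \<Rightarrow> real"
  have fin_ball: "emeasure lborel (ball z r) \<noteq> top" for z :: real and r
    using emeasure_lborel_ball_finite[of z r] by (simp add: less_top)
  have cont: "continuous_on UNIV \<phi>" using convex_on_continuous[OF open_UNIV cf] .
  have "gap_set \<phi> 1 p q \<in> sets lebesgue" using borel_gap_set[OF cont] by simp
  then have S: "?S \<in> lmeasurable" by (metis fmeasurable_Int_fmeasurable Int_commute lmeasurable_cbox)
  have "\<forall>t. \<exists>s. \<forall>y. \<phi> t + s \<bullet> (y - t) \<le> \<phi> y"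
    using convex_on_subgradient[OF cf open_UNIV] by (metis UNIV_I)
  then obtain g where "\<forall>t y. \<phi> t + g t \<bullet> (y - t) \<le> \<phi> y" by metis
  then have g: "\<phi> t + g t * (y - t) \<le> \<phi> y" for t y by simp
  have mono: "mono g"
  proof
    fix s t :: real assume "s \<le> t"
    have "0 \<le> (g t - g s) * (t - s)" using g[of s t] g[of t s] by (simp add: algebra_simps)
    then show "g s \<le> g t" using \<open>s \<le> t\<close> by (cases "s = t") (auto simp: zero_le_mult_iff)
  qed
  \<comment> \<open>The derivative of the second difference in its step r is formally g (t + r) - g
    (t - r). Were this at least 2 p r for all r up to s, integration would give at least p s^2.
    Evaluating \<open>g\<close> at the inner points \<open>t + a\<close>, \<open>t - a\<close> gives
    the lower estimate with error p (b - a)^2.\<close>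
  have small: "\<exists>r. 0 < r \<and> r \<le> s \<and> g (t + r) - g (t - r) < 2 * p * r"
    if "0 < s" "second_diff \<phi> 1 s t < p * s\<^sup>2" for s t
  proof (rule ccontr)
    assume "\<not> ?thesis"
    then have H: "2 * p * r \<le> g (t + r) - g (t - r)" if "0 \<le> r" "r \<le> s" for r
      using that by (cases "r = 0") (auto simp: not_less)
    let ?\<psi> = "\<lambda>r. \<phi> (t + r) + \<phi> (t - r) - p * r\<^sup>2"
    have "?\<psi> 0 \<le> ?\<psi> s"
    proof (rule increments_ge_imp_ge[where C=p])
      fix a b :: real assume ab: "0 \<le> a" "a \<le> b" "b \<le> s"
      have "2 * p * a * (b - a) \<le> (g (t + a) - g (t - a)) * (b - a)"
        using H[of a] ab by (intro mult_right_mono) auto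
      then show "- p * (b - a)\<^sup>2 \<le> ?\<psi> b - ?\<psi> a"
        using g[of "t + a" "t + b"] g[of "t - a" "t - b"]
        by (simp add: power2_eq_square algebra_simps)
    qed (use \<open>0 < s\<close> in simp)
    with that show False by (simp add: second_diff_def)
  qed
  \<comment> \<open>The mirror image of \<open>small\<close>: the upper estimate evaluates
    \<open>g\<close> at the outer points \<open>t + b\<close>, \<open>t - b\<close>.\<close>
  have large: "\<exists>r. 0 < r \<and> r \<le> s \<and> 2 * q * r < g (t + r) - g (t - r)"
    if "0 < s" "q * s\<^sup>2 < second_diff \<phi> 1 s t" for s t
  proof (rule ccontr)
    assume "\<not> ?thesis"
    then have H: "g (t + r) - g (t - r) \<le> 2 * q * r" if "0 \<le> r" "r \<le> s" for r
      using that by (cases "r = 0") (auto simp: not_less)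
    let ?\<psi> = "\<lambda>r. q * r\<^sup>2 - \<phi> (t + r) - \<phi> (t - r)"
    have "?\<psi> 0 \<le> ?\<psi> s"
    proof (rule increments_ge_imp_ge[where C=q])
      fix a b :: real assume ab: "0 \<le> a" "a \<le> b" "b \<le> s"
      have "(g (t + b) - g (t - b)) * (b - a) \<le> 2 * q * b * (b - a)"
        using H[of b] ab by (intro mult_right_mono) auto
      then show "- q * (b - a)\<^sup>2 \<le> ?\<psi> b - ?\<psi> a"
        using g[of "t + b" "t + a"] g[of "t - b" "t - a"]
        by (simp add: power2_eq_square algebra_simps)
    qed (use \<open>0 < s\<close> in simp)
    with that show False by (simp add: second_diff_def)
  qed
  have key: "q * (?\<mu> ?S - 2 * e) \<le> p * (?\<mu> ?S + e)" if "0 < e" and p: "0 < p" for e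
  proof -
    obtain U where U: "open U" "?S \<subseteq> U" "U \<in> lmeasurable" "?\<mu> U < ?\<mu> ?S + e"
      using lmeasurable_outer_open[OF S \<open>0 < e\<close>] by blast
    let ?B = "\<lambda>i::real \<times> real. ball (fst i) (snd i)"
    let ?inc = "\<lambda>i::real \<times> real. g (fst i + snd i) - g (fst i - snd i)"
    let ?K1 = "{i. 0 < snd i \<and> ?B i \<subseteq> U \<and> ?inc i \<le> 2 * p * snd i}"
    have fine1: "\<exists>i. i \<in> ?K1 \<and> x \<in> ?B i \<and> snd i < d" if xd: "x \<in> ?S" "0 < d" for x d
    proof -
      have "x \<in> U" using U(2) xd(1) by blast
      then obtain c where c: "0 < c" "ball x c \<subseteq> U" using openE[OF U(1)] by blast
      have "0 < min d c" using c xd by simp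
      then obtain s where s: "0 < s" "s < min d c" "second_diff \<phi> 1 s x < p * s\<^sup>2"
        using xd(1) unfolding gap_set_def by blast
      then obtain r where "0 < r" "r \<le> s" "g (x + r) - g (x - r) < 2 * p * r" using small by blast
      with s c show ?thesis by (intro exI[of _ "(x, r)"]) (auto simp: subset_iff)
    qed
    obtain F where F: "finite F" "F \<subseteq> ?K1" "pairwise (\<lambda>i j. disjnt (?B i) (?B j)) F"
      "?\<mu> ?S - e < ?\<mu> (?S \<inter> (\<Union>i\<in>F. ?B i))"
      by (rule Vitali_finite_disjoint_balls[where a=fst and r=snd, OF S fine1 \<open>0 < e\<close>])
    let ?S1 = "?S \<inter> (\<Union>i\<in>F. ?B i)"
    have S1: "?S1 \<in> lmeasurable"
      by (rule fmeasurable_Int_fmeasurable[OF S]) (use F(1) in auto)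
    \<comment> \<open>Closed balls are used so that both end points of an interval of the second
      family lie in the interval of the first family containing it.\<close>
    let ?K2 = "{j. 0 < snd j \<and> 2 * q * snd j \<le> ?inc j \<and> (\<exists>i\<in>F. cball (fst j) (snd j) \<subseteq> ?B i)}"
    have fine2: "\<exists>j. j \<in> ?K2 \<and> x \<in> ?B j \<and> snd j < d" if xd: "x \<in> ?S1" "0 < d" for x d
    proof -
      obtain i where i: "i \<in> F" "x \<in> ?B i" using xd by blast
      obtain c where c: "0 < c" "cball x c \<subseteq> ?B i" using i open_contains_cball[of "?B i"] by blast
      have "0 < min d c" using c xd by simp
      then obtain s where s: "0 < s" "s < min d c" "q * s\<^sup>2 < second_diff \<phi> 1 s x"
        using xd(1) unfolding gap_set_def by blast
      then obtain r where r: "0 < r" "r \<le> s" "2 * q * r < g (x + r) - g (x - r)" using large by blast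
      have "cball x r \<subseteq> cball x c" using r s by (intro subset_cball) simp
      with r s c i show ?thesis by (intro exI[of _ "(x, r)"]) auto
    qed
    obtain G where G: "finite G" "G \<subseteq> ?K2" "pairwise (\<lambda>i j. disjnt (?B i) (?B j)) G"
      "?\<mu> ?S1 - e < ?\<mu> (?S1 \<inter> (\<Union>i\<in>G. ?B i))"
      by (rule Vitali_finite_disjoint_balls[where a=fst and r=snd, OF S1 fine2 \<open>0 < e\<close>])
    have F2: "0 < snd i" "?inc i \<le> 2 * p * snd i" if "i \<in> F" for i using F(2) that by blast+
    have G2: "0 < snd j" "2 * q * snd j \<le> ?inc j" if "j \<in> G" for j using G(2) that by blast+
    have "\<forall>j\<in>G. \<exists>i. i \<in> F \<and> cball (fst j) (snd j) \<subseteq> ?B i" using G(2) by blast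
    then obtain h where h: "\<And>j. j \<in> G \<Longrightarrow> h j \<in> F \<and> cball (fst j) (snd j) \<subseteq> ?B (h j)" by metis
    have len: "?\<mu> (?B i) = 2 * snd i" if "0 < snd i" for i
      using that by (simp add: ball_eq_greaterThanLessThan)
    have disj: "?\<mu> (\<Union>i\<in>F. ?B i) = (\<Sum>i\<in>F. ?\<mu> (?B i))"
      using F(1,3)
      by (subst measure_finite_Union)
         (auto simp: disjoint_family_on_def pairwise_def disjnt_def fin_ball)
    have "?\<mu> ?S - 2 * e \<le> ?\<mu> (?S1 \<inter> (\<Union>i\<in>G. ?B i))" using F(4) G(4) by linarith
    also have "\<dots> \<le> ?\<mu> (\<Union>i\<in>G. ?B i)"
      by (intro measure_mono_fmeasurable fmeasurableD[OF fmeasurable_Int_fmeasurable[OF S1]])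
         (use G(1) in auto)
    also have "\<dots> \<le> (\<Sum>i\<in>G. ?\<mu> (?B i))" by (rule measure_UNION_le[OF G(1)]) auto
    also have "\<dots> = (\<Sum>i\<in>G. 2 * snd i)" by (rule sum.cong) (use G2 len in blast)+
    finally have "q * (?\<mu> ?S - 2 * e) \<le> q * (\<Sum>i\<in>G. 2 * snd i)"
      using p pq by (intro mult_left_mono) auto
    also have "\<dots> = (\<Sum>i\<in>G. 2 * q * snd i)" by (simp add: sum_distrib_left mult_ac)
    also have "\<dots> \<le> (\<Sum>j\<in>G. ?inc j)" by (rule sum_mono) (use G2 in blast)
    \<comment> \<open>Group the second family by containing interval; disjoint subintervals of
      \<open>i\<close> have together at most the increment of \<open>g\<close> over
      \<open>i\<close>.\<close>
    also have "\<dots> = (\<Sum>i\<in>h ` G. \<Sum>j\<in>{j\<in>G. h j = i}. ?inc j)" by (rule sum.image_gen[OF G(1)])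
    also have "\<dots> \<le> (\<Sum>i\<in>h ` G. ?inc i)"
    proof (rule sum_mono)
      fix i assume "i \<in> h ` G"
      then have i: "0 < snd i" using h F2 by blast
      show "(\<Sum>j\<in>{j\<in>G. h j = i}. ?inc j) \<le> ?inc i"
      proof (rule sum_increments_disjoint_le[OF mono])
        fix j assume "j \<in> {j\<in>G. h j = i}"
        then have j: "0 < snd j" "cball (fst j) (snd j) \<subseteq> ?B i" using G2 h by blast+
        then have "fst j - snd j \<in> ?B i" "fst j + snd j \<in> ?B i"
          by (auto simp: subset_iff dist_real_def)
        then show "fst i - snd i \<le> fst j - snd j \<and> fst j - snd j < fst j + snd j
            \<and> fst j + snd j \<le> fst i + snd i"
          using j by (auto simp: dist_real_def)
      next
        fix j k assume "j \<in> {j\<in>G. h j = i}" "k \<in> {j\<in>G. h j = i}" "j \<noteq> k"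
        then show "fst j + snd j \<le> fst k - snd k \<or> fst k + snd k \<le> fst j - snd j"
          using G(3) by (intro disjnt_balls_real) (auto simp: pairwise_def G2)
      qed (use G i in auto)
    qed
    also have "\<dots> \<le> (\<Sum>i\<in>F. ?inc i)"
    proof (rule sum_mono2[OF F(1)])
      show "0 \<le> ?inc i" if "i \<in> F - h ` G" for i
        using F2(1)[of i] that monoD[OF mono, of "fst i - snd i" "fst i + snd i"] by auto
    qed (use h in blast)
    also have "\<dots> \<le> (\<Sum>i\<in>F. p * (2 * snd i))" by (rule sum_mono) (use F2(2) in \<open>simp add: mult_ac\<close>)
    also have "\<dots> = p * (\<Sum>i\<in>F. ?\<mu> (?B i))"
      unfolding sum_distrib_left by (rule sum.cong) (use F2 len in auto)
    also have "\<dots> \<le> p * (?\<mu> ?S + e)"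
    proof -
      have "(\<Union>i\<in>F. ?B i) \<subseteq> U" using F(2) by blast
      then have "?\<mu> (\<Union>i\<in>F. ?B i) \<le> ?\<mu> U"
        by (rule measure_mono_fmeasurable[OF _ _ U(3)]) (use F(1) in auto)
      then show ?thesis using disj U p by (intro mult_left_mono) auto
    qed
    finally show ?thesis .
  qed
  have "?\<mu> ?S = 0"
  proof (rule ccontr)
    assume "?\<mu> ?S \<noteq> 0"
    then have pos: "0 < ?\<mu> ?S" by (simp add: zero_less_measure_iff)
    \<comment> \<open>A point of \<open>?S\<close> yields a symmetric increment of the monotone
      \<open>g\<close> that is below 2 p r; hence p > 0, as \<open>key\<close> requires.\<close>
    then obtain x where "x \<in> ?S" by (metis ex_in_conv measure_empty less_irrefl)
    then obtain s where s: "0 < s" "second_diff \<phi> 1 s x < p * s\<^sup>2"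
      unfolding gap_set_def using zero_less_one by blast
    then obtain r where r: "0 < r" "g (x + r) - g (x - r) < 2 * p * r" using small by blast
    have "g (x - r) \<le> g (x + r)" using r by (intro monoD[OF mono]) auto
    then have "0 < 2 * p * r" using r by linarith
    then have p: "0 < p" using r by (simp add: zero_less_mult_iff)
    have key': "(q - p) * ?\<mu> ?S \<le> (2 * q + p) * e" if "0 < e" for e
      using key[OF that p] by (simp add: algebra_simps)
    have half: "k * (m / k / 2) = m / 2" if "k \<noteq> 0" for k m :: real using that by simp
    \<comment> \<open>Chosen to make the right side of \<open>key'\<close> half of its left
      side.\<close>
    let ?e = "(q - p) * ?\<mu> ?S / (2 * q + p) / 2"
    have "0 < ?e" using p pq pos by simp
    then have "(q - p) * ?\<mu> ?S \<le> (2 * q + p) * ?e" by (rule key')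
    also have "\<dots> = (q - p) * ?\<mu> ?S / 2" by (rule half) (use p pq in simp)
    finally have "(q - p) * ?\<mu> ?S \<le> 0" by simp
    moreover have "0 < (q - p) * ?\<mu> ?S" using pq pos by simp
    ultimately show False by linarith
  qed
  then show "negligible ?S" using S by (simp add: negligible_iff_measure0)
qed

text \<open>The double integral of the indicator of \<open>N\<close> along \<open>x + t v\<close> over all \<open>x\<close> and
  \<open>0 \<le> t \<le> 1\<close> equals the measure of \<open>N\<close> by translation invariance and vanishes by hypothesis.\<close>
lemma null_set_if_null_on_parallel_lines:
  fixes N :: "'a::euclidean_space set"
  assumes N: "N \<in> sets borel" and line: "\<And>x. negligible {t. x + t *\<^sub>R v \<in> N}"
  shows "negligible N"
proof -
  let ?f = "\<lambda>(x, t). indicator N (x + t *\<^sub>R v) * indicator {0..1::real} t :: ennreal"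
  have meas: "?f \<in> borel_measurable (lborel \<Otimes>\<^sub>M lborel)"
  proof -
    have "(\<lambda>z. fst z + snd z *\<^sub>R v) \<in> borel_measurable (borel :: ('a \<times> real) measure)"
      by (intro borel_measurable_continuous_onI continuous_intros)
    then have "(\<lambda>z. fst z + snd z *\<^sub>R v) \<in> measurable (lborel \<Otimes>\<^sub>M lborel) (borel :: 'a measure)"
      by (simp add: lborel_prod)
    note [measurable] = this N
    show ?thesis unfolding case_prod_beta by measurable
  qed
  have trans: "(\<integral>\<^sup>+x. indicator N (x + c) \<partial>lborel) = emeasure lborel N" for c :: 'a
  proof -
    have "emeasure lborel N = emeasure (distr lborel borel ((+) c)) N" by (simp add: lborel_distr_plus)
    also have "\<dots> = (\<integral>\<^sup>+x. indicator N x \<partial>distr lborel borel ((+) c))" using N by simp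
    also have "\<dots> = (\<integral>\<^sup>+x. indicator N (c + x) \<partial>lborel)"
      using N by (subst nn_integral_distr) auto
    finally show ?thesis by (simp add: add.commute)
  qed
  have "(\<integral>\<^sup>+x. \<integral>\<^sup>+t. ?f (x, t) \<partial>lborel \<partial>lborel) = (\<integral>\<^sup>+t. \<integral>\<^sup>+x. ?f (x, t) \<partial>lborel \<partial>lborel)"
    using lborel_pair.Fubini[OF meas] by simp
  also have "\<dots> = (\<integral>\<^sup>+t. emeasure lborel N * indicator {0..1::real} t \<partial>lborel)"
    using N by (intro nn_integral_cong) (simp add: nn_integral_multc trans)
  also have "\<dots> = emeasure lborel N" by (simp add: nn_integral_cmult)
  finally have "emeasure lborel N = (\<integral>\<^sup>+x. \<integral>\<^sup>+t. ?f (x, t) \<partial>lborel \<partial>lborel)" by simp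
  also have "\<dots> = (\<integral>\<^sup>+x. 0 \<partial>(lborel :: 'a measure))"
  proof (rule nn_integral_cong)
    fix x :: 'a
    have "(\<lambda>t. x + t *\<^sub>R v) \<in> borel_measurable borel"
      by (intro borel_measurable_continuous_onI continuous_intros)
    note [measurable] = this N
    have set: "{t. x + t *\<^sub>R v \<in> N} \<in> sets lborel" by measurable
    then have "{t. x + t *\<^sub>R v \<in> N} \<in> null_sets lborel"
      using line[of x] by (auto simp: negligible_iff_null_sets null_sets_def)
    then have "AE t in lborel. x + t *\<^sub>R v \<notin> N" using AE_iff_null_sets[OF set] by simp
    then have "AE t in lborel. ?f (x, t) = 0" by eventually_elim simp
    then have "(\<integral>\<^sup>+t. ?f (x, t) \<partial>lborel) = (\<integral>\<^sup>+t. 0 \<partial>(lborel :: real measure))"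
      by (rule nn_integral_cong_AE)
    then show "(\<integral>\<^sup>+t. ?f (x, t) \<partial>lborel) = 0" by simp
  qed
  finally have "emeasure lborel N = 0" by simp
  then show ?thesis using N by (simp add: negligible_iff_null_sets null_sets_def)
qed

text \<open>On each line in direction \<open>v\<close> the set is the gap set of the restriction, a
  convex function of one variable.\<close>

lemma negligible_gap_set:
  fixes f :: "'a::euclidean_space \<Rightarrow> real"
  assumes cf: "convex_on UNIV f" and pq: "p < q"
  shows "negligible (gap_set f v p q)"
proof (rule null_set_if_null_on_parallel_lines)
  show "gap_set f v p q \<in> sets borel"
    by (rule borel_gap_set[OF convex_on_continuous[OF open_UNIV cf]])
  fix x
  let ?\<phi> = "\<lambda>t. f (x + t *\<^sub>R v)"
  have "convex_on UNIV ?\<phi>"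
  proof (rule convex_onI)
    fix t a b :: real assume t: "0 < t" "t < 1"
    have "x + ((1 - t) *\<^sub>R a + t *\<^sub>R b) *\<^sub>R v = (1 - t) *\<^sub>R (x + a *\<^sub>R v) + t *\<^sub>R (x + b *\<^sub>R v)"
      by (simp add: algebra_simps)
    then show "?\<phi> ((1 - t) *\<^sub>R a + t *\<^sub>R b) \<le> (1 - t) * ?\<phi> a + t * ?\<phi> b"
      using convex_onD[OF cf, of t "x + a *\<^sub>R v" "x + b *\<^sub>R v"] t by simp
  qed simp
  moreover have "second_diff f v s (x + t *\<^sub>R v) = second_diff ?\<phi> 1 s t" for s t
    by (simp add: second_diff_def algebra_simps)
  then have "{t. x + t *\<^sub>R v \<in> gap_set f v p q} = gap_set ?\<phi> 1 p q"
    by (simp add: gap_set_def Collect_conj_eq)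
  ultimately show "negligible {t. x + t *\<^sub>R v \<in> gap_set f v p q}"
    using negligible_gap_set_real[OF _ pq] by simp
qed

subsection \<open>Regular points of a convex function\<close>

text \<open>The ball around \<open>z\<close> only has to contain \<open>x\<close>. Negated, this
  gives the form used later: at all small scales r, \<open>A\<close> meets
  \<open>ball z (\<eta> * r)\<close> for every z within r of \<open>x\<close>.\<close>

definition porous_points :: "real \<Rightarrow> 'a::metric_space set \<Rightarrow> 'a set" where
  "porous_points \<eta> A =
     A \<inter> {x. \<forall>d>0. \<exists>r. 0 < r \<and> r < d \<and> (\<exists>z. x \<in> ball z r \<and> ball z (\<eta> * r) \<inter> A = {})}"

text \<open>A hole of \<open>A\<close> is also a hole of its subset of porous points, which is
  therefore porous at each of its own points.\<close>

lemma negligible_porous_points: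
  fixes A :: "'a::euclidean_space set"
  assumes "closed A" "0 < \<eta>" "\<eta> \<le> 1"
  shows "negligible (porous_points \<eta> A)"
proof (rule negligible_porous[OF _ \<open>0 < \<eta>\<close> \<open>\<eta> \<le> 1\<close>])
  have "open {x. \<exists>z. x \<in> ball z r \<and> ball z (\<eta> * r) \<inter> A = {}}" for r
  proof -
    have "{x. \<exists>z. x \<in> ball z r \<and> ball z (\<eta> * r) \<inter> A = {}}
        = (\<Union>z\<in>{z. ball z (\<eta> * r) \<inter> A = {}}. ball z r)" by auto
    then show ?thesis by (simp add: open_UN)
  qed
  then have "porous_points \<eta> A \<in> sets borel"
    unfolding porous_points_def using \<open>closed A\<close>
    by (intro sets.Int borel_for_arbitrarily_small) auto
  then show "porous_points \<eta> A \<in> sets lebesgue" by simp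
  fix x and d :: real assume "x \<in> porous_points \<eta> A" "0 < d"
  then obtain r z where "0 < r" "r < d" "x \<in> ball z r" "ball z (\<eta> * r) \<inter> A = {}"
    unfolding porous_points_def by blast
  then show "\<exists>r z. 0 < r \<and> r < d \<and> x \<in> ball z r \<and> ball z (\<eta> * r) \<inter> porous_points \<eta> A = {}"
    unfolding porous_points_def by blast
qed

text \<open>One range of steps serves all points of the set: a point found near z by non-porosity
  must satisfy the bounds at the very step s under consideration. The set is also closed for
  continuous \<open>f\<close>.\<close>

definition second_diff_band :: "('a::real_vector \<Rightarrow> real) \<Rightarrow> 'a \<Rightarrow> real \<Rightarrow> real \<Rightarrow> nat \<Rightarrow> 'a set" where
  "second_diff_band f v p q k =
     {y. \<forall>s. 0 < s \<and> s < inverse (real (Suc k)) \<longrightarrow>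
        p * s\<^sup>2 \<le> second_diff f v s y \<and> second_diff f v s y \<le> q * s\<^sup>2}"

lemma closed_second_diff_band:
  fixes f :: "'a::euclidean_space \<Rightarrow> real"
  assumes f: "continuous_on UNIV f"
  shows "closed (second_diff_band f v p q k)"
  unfolding second_diff_band_def
  by (intro closed_Collect_all closed_Collect_imp closed_Collect_conj closed_Collect_le
      continuous_intros f) auto

definition irregular_points :: "('a::euclidean_space \<Rightarrow> real) \<Rightarrow> 'a set \<Rightarrow> 'a set" where
  "irregular_points f D =
     (\<Union>v\<in>D. \<Union>p\<in>\<rat>. \<Union>q\<in>\<rat> \<inter> {p<..}. gap_set f v p q) \<union>
     (\<Union>v\<in>D. \<Union>p\<in>\<rat>. \<Union>q\<in>\<rat>. \<Union>k. \<Union>m.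
        porous_points (inverse (real (Suc m))) (second_diff_band f v p q k))"

lemma negligible_UN_countable:
  assumes "countable I" "\<And>i. i \<in> I \<Longrightarrow> negligible (A i)"
  shows "negligible (\<Union>i\<in>I. A i)"
  using assms by (intro negligible_countable_Union) auto

lemma negligible_irregular_points:
  fixes f :: "'a::euclidean_space \<Rightarrow> real"
  assumes cf: "convex_on UNIV f" and D: "countable D"
  shows "negligible (irregular_points f D)"
proof -
  note cont = convex_on_continuous[OF open_UNIV cf]
  have "negligible (gap_set f v p q)" if "q \<in> \<rat> \<inter> {p<..}" for v p q
    using negligible_gap_set[OF cf] that by simp
  moreover have "negligible (porous_points (inverse (real (Suc m))) (second_diff_band f v p q k))"
    for v p q k m
    by (rule negligible_porous_points[OF closed_second_diff_band[OF cont]])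
       (auto simp: inverse_le_1_iff simp del: of_nat_Suc)
  ultimately show ?thesis unfolding irregular_points_def
    by (intro negligible_Un)
       (assumption | rule negligible_UN_countable D countable_rat countable_Int1 countableI_type)+
qed

text \<open>\<open>Q\<close> is the lower limit of the quotients, written as the supremum of their
  eventual lower bounds. For rationals Q < a < b the quotients fall below \<open>a\<close> at
  arbitrarily small steps, so the absence of a gap keeps them below or at \<open>b\<close>
  eventually.\<close>

lemma limit_if_no_gap:
  assumes bd: "0 < d0" "\<And>s. 0 < s \<Longrightarrow> s < d0 \<Longrightarrow> 0 \<le> second_diff f v s x \<and> second_diff f v s x \<le> B * s\<^sup>2"
    and gap: "\<And>p q. p \<in> \<rat> \<Longrightarrow> q \<in> \<rat> \<Longrightarrow> p < q \<Longrightarrow> x \<notin> gap_set f v p q"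
  obtains Q where "\<forall>e>0. \<exists>d>0. \<forall>s. 0 < s \<and> s < d \<longrightarrow>
    (Q - e) * s\<^sup>2 \<le> second_diff f v s x \<and> second_diff f v s x \<le> (Q + e) * s\<^sup>2"
proof -
  let ?P = "{p. \<exists>d>0. \<forall>s. 0 < s \<and> s < d \<longrightarrow> p * s\<^sup>2 \<le> second_diff f v s x}"
  have ub: "p \<le> B" if pP: "p \<in> ?P" for p
  proof -
    obtain d where d: "0 < d" "\<And>s. 0 < s \<Longrightarrow> s < d \<Longrightarrow> p * s\<^sup>2 \<le> second_diff f v s x"
      using pP by blast
    obtain s where s: "0 < s" "s < min d d0" using dense[of 0 "min d d0"] d bd by auto
    then have "p * s\<^sup>2 \<le> second_diff f v s x" "second_diff f v s x \<le> B * s\<^sup>2"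
      using d(2)[of s] bd(2)[of s] by auto
    then have "p * s\<^sup>2 \<le> B * s\<^sup>2" by linarith
    then show ?thesis using s by simp
  qed
  have ne: "0 \<in> ?P" using bd by auto
  have bdd: "bdd_above ?P" using ub by (rule bdd_aboveI)
  let ?Q = "Sup ?P"
  show thesis
  proof (rule that, intro allI impI)
    fix e :: real assume "0 < e"
    then have "?Q - e < ?Q" by simp
    moreover have "?P \<noteq> {}" using ne by blast
    ultimately obtain p where p: "p \<in> ?P" "?Q - e < p" by (rule less_cSupE)
    then obtain d1 where d1: "0 < d1" "\<And>s. 0 < s \<Longrightarrow> s < d1 \<Longrightarrow> p * s\<^sup>2 \<le> second_diff f v s x"
      by blast
    obtain a where a: "a \<in> \<rat>" "?Q < a" "a < ?Q + e"
      using Rats_dense_in_real[of ?Q "?Q + e"] \<open>0 < e\<close> by auto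
    obtain b where b: "b \<in> \<rat>" "a < b" "b < ?Q + e" using Rats_dense_in_real[OF a(3)] by blast
    have "a \<notin> ?P" using cSup_upper[OF _ bdd, of a] a by auto
    then have "\<forall>d>0. \<exists>s. 0 < s \<and> s < d \<and> second_diff f v s x < a * s\<^sup>2" by (auto simp: not_le)
    with gap[OF a(1) b(1) b(2)]
    have "\<not> (\<forall>d>0. \<exists>s. 0 < s \<and> s < d \<and> b * s\<^sup>2 < second_diff f v s x)"
      unfolding gap_set_def by blast
    then obtain d2 where d2: "0 < d2" "\<And>s. 0 < s \<Longrightarrow> s < d2 \<Longrightarrow> second_diff f v s x \<le> b * s\<^sup>2"
      by (metis not_less)
    show "\<exists>d>0. \<forall>s. 0 < s \<and> s < d \<longrightarrow>
      (?Q - e) * s\<^sup>2 \<le> second_diff f v s x \<and> second_diff f v s x \<le> (?Q + e) * s\<^sup>2"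
    proof (intro exI[of _ "min d1 d2"] conjI allI impI)
      fix s assume s: "0 < s \<and> s < min d1 d2"
      have "(?Q - e) * s\<^sup>2 \<le> p * s\<^sup>2" using p(2) by (intro mult_right_mono) auto
      then show "(?Q - e) * s\<^sup>2 \<le> second_diff f v s x" using d1(2)[of s] s by linarith
      have "b * s\<^sup>2 \<le> (?Q + e) * s\<^sup>2" using b(3) by (intro mult_right_mono) auto
      then show "second_diff f v s x \<le> (?Q + e) * s\<^sup>2" using d2(2)[of s] s by linarith
    qed (use d1 d2 in auto)
  qed
qed

text \<open>A supporting plane below and a paraboloid above share the gradient \<open>p\<close> at
  \<open>x\<close>; the plane bounds globally, the paraboloid only within \<open>\<rho>\<close>.
  Thus \<open>fhat\<close> lies between 0 and M |y - x|^2 near \<open>x\<close>.\<close>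

locale convex_contact =
  fixes f :: "'a::euclidean_space \<Rightarrow> real" and x p :: 'a and M \<rho> :: real
  assumes cf: "convex_on UNIV f" and \<rho>: "0 < \<rho>" and M: "0 \<le> M"
    and low: "\<And>y. f x + p \<bullet> (y - x) \<le> f y"
    and up: "\<And>y. y \<in> ball x \<rho> \<Longrightarrow> f y \<le> f x + p \<bullet> (y - x) + M * (norm (y - x))\<^sup>2"
begin

definition fhat :: "'a \<Rightarrow> real" where "fhat y = f y - f x - p \<bullet> (y - x)"

lemma fhat_bounds: "0 \<le> fhat y" "y \<in> ball x \<rho> \<Longrightarrow> fhat y \<le> M * (norm (y - x))\<^sup>2"
  using low[of y] up[of y] by (auto simp: fhat_def)

text \<open>The slopes of \<open>fhat\<close> are \<open>s - p\<close> with \<open>s\<close> a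
  subgradient of \<open>f\<close>, and these are O(r) at distance r from \<open>x\<close>. The
  constant shrinking with r is what makes blow-ups compact.\<close>

lemma fhat_lipschitz:
  assumes "y \<in> cball x r" "z \<in> cball x r" "0 < r" "2 * r < \<rho>"
  shows "\<bar>fhat y - fhat z\<bar> \<le> 4 * M * r * norm (y - z)"
proof -
  have *: "fhat y - fhat z \<le> 4 * M * r * norm (y - z)" if "y \<in> cball x r" for y z
  proof -
    obtain s where s: "\<And>z. f y + s \<bullet> (z - y) \<le> f z"
      using convex_on_subgradient[OF cf open_UNIV, of y] by auto
    have ns: "norm (s - p) \<le> 4 * M * r"
    proof (rule subgradient_close_to_contact_gradient[of f x p y])
      show "f w \<le> f x + p \<bullet> (w - x) + M * (norm (w - x))\<^sup>2" if "w \<in> cball x (2 * r)" for w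
        using that \<open>2 * r < \<rho>\<close> by (intro up) auto
    qed (use low s M assms that in auto)
    have "fhat y - fhat z \<le> (s - p) \<bullet> (y - z)"
      using s[of z] by (simp add: fhat_def inner_simps)
    also have "\<dots> \<le> norm (s - p) * norm (y - z)" by (rule norm_cauchy_schwarz)
    also have "\<dots> \<le> 4 * M * r * norm (y - z)" using ns by (intro mult_right_mono) auto
    finally show ?thesis .
  qed
  from *[of y z] *[of z y] assms show ?thesis by (auto simp: abs_le_iff norm_minus_commute)
qed

lemma second_diff_fhat: "second_diff f v s z = second_diff fhat v s z"
  by (simp add: second_diff_def fhat_def inner_simps)

text \<open>\<open>x\<close> lies in a narrow band around \<open>Q\<close> and is not a porous point
  of it, so a band point y lies within \<open>\<eta> * r\<close> of z. The quotient is known at y,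
  and the Lipschitz bound carries it to z. That transfer costs a fraction of r^2, hence the error in
  r rather than in s.\<close>

lemma second_diff_near:
  assumes reg: "x \<notin> irregular_points f D" and v: "v \<in> D"
  obtains Q where "\<forall>e>0. \<exists>d>0. \<forall>r s z. 0 < s \<and> s \<le> r \<and> r < d \<and> z \<in> ball x r \<longrightarrow>
    \<bar>second_diff f v s z - s\<^sup>2 * Q\<bar> \<le> e * r\<^sup>2"
proof -
  let ?d0 = "\<rho> / (norm v + 1)"
  have d0: "0 < ?d0" using \<rho> by (intro divide_pos_pos) (auto intro: add_nonneg_pos)
  have bd: "0 \<le> second_diff f v s x \<and> second_diff f v s x \<le> 2 * M * (norm v)\<^sup>2 * s\<^sup>2"
    if s: "0 < s" "s < ?d0" for s
  proof -
    have "s * norm v \<le> s * (norm v + 1)" using s by simp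
    also have "\<dots> < \<rho>" using s by (simp add: pos_less_divide_eq add_nonneg_pos)
    finally have "x + s *\<^sub>R v \<in> ball x \<rho>" "x - s *\<^sub>R v \<in> ball x \<rho>"
      using s by (auto simp: dist_norm)
    from fhat_bounds(2)[OF this(1)] fhat_bounds(2)[OF this(2)]
    have "fhat (x + s *\<^sub>R v) \<le> M * (s * norm v)\<^sup>2" "fhat (x - s *\<^sub>R v) \<le> M * (s * norm v)\<^sup>2"
      using s by auto
    moreover have "fhat x = 0" by (simp add: fhat_def)
    ultimately show ?thesis
      using fhat_bounds(1)[of "x + s *\<^sub>R v"] fhat_bounds(1)[of "x - s *\<^sub>R v"]
      unfolding second_diff_fhat unfolding second_diff_def by (auto simp: power_mult_distrib mult_ac)
  qed
  have gap: "x \<notin> gap_set f v a b" if "a \<in> \<rat>" "b \<in> \<rat>" "a < b" for a b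
  proof
    assume "x \<in> gap_set f v a b"
    then have "x \<in> irregular_points f D"
      unfolding irregular_points_def using that
      by (intro UnI1 UN_I[OF v] UN_I[OF that(1)] UN_I[of b]) auto
    with reg show False by contradiction
  qed
  obtain Q where Q: "\<forall>e>0. \<exists>d>0. \<forall>s. 0 < s \<and> s < d \<longrightarrow>
    (Q - e) * s\<^sup>2 \<le> second_diff f v s x \<and> second_diff f v s x \<le> (Q + e) * s\<^sup>2"
    by (rule limit_if_no_gap[OF d0 bd gap])
  show thesis
  proof (rule that, intro allI impI)
    fix e :: real assume e: "0 < e"
    \<comment> \<open>Rational bounds within e / 2 of \<open>Q\<close>, one on each side; the slack
      \<open>c\<close> between them and \<open>Q\<close> absorbs the convergence at \<open>x\<close>
      itself.\<close>
    obtain a where a: "a \<in> \<rat>" "Q - e / 2 < a" "a < Q"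
      using Rats_dense_in_real[of "Q - e / 2" Q] e by auto
    obtain b where b: "b \<in> \<rat>" "Q < b" "b < Q + e / 2"
      using Rats_dense_in_real[of Q "Q + e / 2"] e by auto
    define c where "c = min (Q - a) (b - Q)"
    have c: "0 < c" "a \<le> Q - c" "Q + c \<le> b" using a b by (auto simp: c_def)
    from Q[rule_format, OF c(1)] obtain d1 where d1: "0 < d1"
      "\<And>s. 0 < s \<Longrightarrow> s < d1 \<Longrightarrow> (Q - c) * s\<^sup>2 \<le> second_diff f v s x"
      "\<And>s. 0 < s \<Longrightarrow> s < d1 \<Longrightarrow> second_diff f v s x \<le> (Q + c) * s\<^sup>2" by metis
    obtain k where k: "inverse (real (Suc k)) < d1" using reals_Archimedean[OF d1(1)] by blast
    have xA: "x \<in> second_diff_band f v a b k"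
      unfolding second_diff_band_def
    proof (intro CollectI allI impI)
      fix s assume s: "0 < s \<and> s < inverse (real (Suc k))"
      then have "(Q - c) * s\<^sup>2 \<le> second_diff f v s x" "second_diff f v s x \<le> (Q + c) * s\<^sup>2"
        using d1(2)[of s] d1(3)[of s] k by linarith+
      moreover have "a * s\<^sup>2 \<le> (Q - c) * s\<^sup>2" "(Q + c) * s\<^sup>2 \<le> b * s\<^sup>2"
        using c by (intro mult_right_mono; simp)+
      ultimately show "a * s\<^sup>2 \<le> second_diff f v s x \<and> second_diff f v s x \<le> b * s\<^sup>2"
        by linarith
    qed
    \<comment> \<open>Four values of \<open>fhat\<close> move (two at the ends, the centre counted
      twice), each by at most 4 M (|v| + 2) r times \<open>\<eta> * r\<close>.\<close>
    define C where "C = 16 * M * (norm v + 2)"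
    have C0: "0 \<le> C" unfolding C_def using M by (intro mult_nonneg_nonneg) auto
    then have "0 < e / 2 / (C + 1)" using e by (intro divide_pos_pos) auto
    then obtain m where m: "inverse (real (Suc m)) < e / 2 / (C + 1)" using reals_Archimedean by blast
    let ?\<eta> = "inverse (real (Suc m))"
    have \<eta>: "0 < ?\<eta>" "?\<eta> \<le> 1" by (simp_all add: inverse_le_1_iff)
    have "C * ?\<eta> \<le> (C + 1) * ?\<eta>" using \<eta> by (intro mult_right_mono) auto
    also have "\<dots> \<le> e / 2"
      using m C0 by (simp add: pos_less_divide_eq algebra_simps del: of_nat_Suc)
    finally have C\<eta>: "C * ?\<eta> \<le> e / 2" .
    have "x \<notin> porous_points ?\<eta> (second_diff_band f v a b k)"
    proof
      assume "x \<in> porous_points ?\<eta> (second_diff_band f v a b k)"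
      then have "x \<in> irregular_points f D"
        unfolding irregular_points_def
        by (intro UnI2 UN_I[OF v] UN_I[OF a(1)] UN_I[OF b(1)] UN_I[OF UNIV_I])
      with reg show False by contradiction
    qed
    then obtain d2 where d2: "0 < d2" "\<And>r z. 0 < r \<Longrightarrow> r < d2 \<Longrightarrow> x \<in> ball z r \<Longrightarrow>
        ball z (?\<eta> * r) \<inter> second_diff_band f v a b k \<noteq> {}"
      using xA unfolding porous_points_def by blast
    \<comment> \<open>y is within 2 r of \<open>x\<close>, and a shift by at most s along
      \<open>v\<close> adds at most r |v|; so every point involved is within \<open>?R * r\<close>
      of \<open>x\<close>.\<close>
    let ?R = "norm v + 2"
    have R: "0 < ?R" by (simp add: add_nonneg_pos)
    let ?d = "min (min d2 (inverse (real (Suc k)))) (\<rho> / (2 * ?R))"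
    show "\<exists>d>0. \<forall>r s z. 0 < s \<and> s \<le> r \<and> r < d \<and> z \<in> ball x r \<longrightarrow>
      \<bar>second_diff f v s z - s\<^sup>2 * Q\<bar> \<le> e * r\<^sup>2"
    proof (intro exI[of _ ?d] conjI allI impI)
      show "0 < ?d" using d2 \<rho> R by simp
      fix r s z assume "0 < s \<and> s \<le> r \<and> r < ?d \<and> z \<in> ball x r"
      then have h: "0 < s" "s \<le> r" "r < d2" "r < inverse (real (Suc k))" "r < \<rho> / (2 * ?R)"
        "z \<in> ball x r" by auto
      have r: "0 < r" using h by linarith
      obtain y where y: "y \<in> ball z (?\<eta> * r)" "y \<in> second_diff_band f v a b k"
        using d2(2)[of r z] h r by (auto simp: dist_commute)
      have "?\<eta> * r \<le> 1 * r" using \<eta> r by (intro mult_right_mono) auto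
      then have zy: "norm (z - y) \<le> ?\<eta> * r" "norm (z - y) \<le> r"
        using y(1) by (auto simp: dist_norm)
      have zx: "norm (z - x) \<le> r" using h by (simp add: dist_norm norm_minus_commute)
      have "norm (y - x) \<le> norm (z - x) + norm (z - y)"
        using norm_triangle_ineq[of "z - x" "y - z"] by (simp add: norm_minus_commute)
      then have yx: "norm (y - x) \<le> 2 * r" using zx zy by linarith
      have sv: "norm (s *\<^sub>R v) \<le> r * norm v" using h by (simp add: mult_right_mono)
      have in_ball: "w + c *\<^sub>R v \<in> cball x (?R * r)" if "norm (w - x) \<le> 2 * r" "\<bar>c\<bar> \<le> s" for w c
      proof -
        have "norm (w + c *\<^sub>R v - x) \<le> norm (w - x) + norm (c *\<^sub>R v)"
          using norm_triangle_ineq[of "w - x" "c *\<^sub>R v"] by (simp add: algebra_simps)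
        moreover have "norm (c *\<^sub>R v) \<le> norm (s *\<^sub>R v)" using that h by (simp add: mult_right_mono)
        ultimately show ?thesis using that sv by (simp add: dist_norm norm_minus_commute algebra_simps)
      qed
      have lip: "\<bar>fhat (z + c *\<^sub>R v) - fhat (y + c *\<^sub>R v)\<bar> \<le> 4 * M * (?R * r) * (?\<eta> * r)" if "\<bar>c\<bar> \<le> s" for c
      proof -
        have "2 * (?R * r) < \<rho>" using h(5) R by (simp add: pos_less_divide_eq mult_ac)
        then have "\<bar>fhat (z + c *\<^sub>R v) - fhat (y + c *\<^sub>R v)\<bar>
            \<le> 4 * M * (?R * r) * norm (z + c *\<^sub>R v - (y + c *\<^sub>R v))"
          using in_ball that yx zx r R by (intro fhat_lipschitz) auto
        also have "\<dots> \<le> 4 * M * (?R * r) * (?\<eta> * r)"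
          using zy M r R by (intro mult_left_mono) auto
        finally show ?thesis .
      qed
      have "\<bar>second_diff f v s z - second_diff f v s y\<bar> \<le> 4 * (4 * M * (?R * r) * (?\<eta> * r))"
        using lip[of s] lip[of "- s"] lip[of 0] h
        unfolding second_diff_fhat unfolding second_diff_def by simp
      also have "\<dots> = C * ?\<eta> * r\<^sup>2" by (simp add: C_def power2_eq_square)
      also have "\<dots> \<le> e / 2 * r\<^sup>2" using C\<eta> by (intro mult_right_mono) auto
      finally have 1: "\<bar>second_diff f v s z - second_diff f v s y\<bar> \<le> e / 2 * r\<^sup>2" .
      have "a * s\<^sup>2 \<le> second_diff f v s y" "second_diff f v s y \<le> b * s\<^sup>2"
        using y(2) h unfolding second_diff_band_def by auto
      moreover have "(Q - e / 2) * s\<^sup>2 \<le> a * s\<^sup>2" "b * s\<^sup>2 \<le> (Q + e / 2) * s\<^sup>2"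
        using a b by (intro mult_right_mono; simp)+
      ultimately have "\<bar>second_diff f v s y - s\<^sup>2 * Q\<bar> \<le> e / 2 * s\<^sup>2"
        unfolding left_diff_distrib distrib_right mult.commute[of "s\<^sup>2" Q] by linarith
      also have "\<dots> \<le> e / 2 * r\<^sup>2" using e h by (intro mult_left_mono power_mono) auto
      finally show "\<bar>second_diff f v s z - s\<^sup>2 * Q\<bar> \<le> e * r\<^sup>2" using 1 by linarith
    qed
  qed
qed

end

subsection \<open>Blow-ups at contact points\<close>

lemma eventually_at_right_small: "0 < d \<Longrightarrow> \<forall>\<^sub>F t in at_right (0::real). 0 < t \<and> t < d"
  unfolding eventually_at_right_field by (intro exI[of _ d]) auto

text \<open>For the deviation \<open>?\<psi>\<close> of \<open>\<phi> t / t\<^sup>2\<close> from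
  \<open>Q / 2\<close>, the doubling relation reads psi(t) = psi(t / 2) / 2 + error, a contraction.
  The quadratic a priori bound starts the iteration and excludes linear functions, which doubling
  does not see.\<close>

lemma doubling_expansion:
  fixes \<phi> :: "real \<Rightarrow> real"
  assumes bd: "0 < d0" "\<And>t. 0 < t \<Longrightarrow> t < d0 \<Longrightarrow> \<bar>\<phi> t\<bar> \<le> C * t\<^sup>2"
    and dbl: "\<And>e. 0 < e \<Longrightarrow> \<exists>d>0. \<forall>t. 0 < t \<and> t < d \<longrightarrow> \<bar>\<phi> (2 * t) - 2 * \<phi> t - t\<^sup>2 * Q\<bar> \<le> e * t\<^sup>2"
  shows "((\<lambda>t. \<phi> t / t\<^sup>2) \<longlongrightarrow> Q / 2) (at_right 0)"
proof (rule tendstoI)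
  fix e :: real assume e: "0 < e"
  let ?\<psi> = "\<lambda>t. \<phi> t / t\<^sup>2 - Q / 2"
  obtain d1 where d1: "0 < d1" "\<And>t. 0 < t \<Longrightarrow> t < d1 \<Longrightarrow> \<bar>\<phi> (2 * t) - 2 * \<phi> t - t\<^sup>2 * Q\<bar> \<le> e * t\<^sup>2"
    using dbl[OF e] by blast
  let ?d = "min d0 d1"
  let ?B = "C + \<bar>Q\<bar>"
  have bound: "\<bar>?\<psi> t\<bar> \<le> ?B / 2 ^ n + e / 2" if "0 < t" "t < ?d" for t n
    using that
  proof (induction n arbitrary: t)
    case 0
    have "\<bar>\<phi> t / t\<^sup>2\<bar> \<le> C" using bd(2)[of t] 0 by (simp add: divide_le_eq)
    then show ?case using e unfolding power_0 div_by_1 by linarith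
  next
    case (Suc n)
    let ?s = "t / 2"
    have s: "0 < ?s" "?s < ?d" using Suc.prems by auto
    have eq: "?\<psi> t = ?\<psi> ?s / 2 + (\<phi> (2 * ?s) - 2 * \<phi> ?s - ?s\<^sup>2 * Q) / (4 * ?s\<^sup>2)"
      using Suc.prems by (simp add: field_simps power2_eq_square)
    have "\<bar>(\<phi> (2 * ?s) - 2 * \<phi> ?s - ?s\<^sup>2 * Q) / (4 * ?s\<^sup>2)\<bar> \<le> e * ?s\<^sup>2 / (4 * ?s\<^sup>2)"
      unfolding abs_divide using d1(2)[of ?s] s by (intro frac_le) auto
    also have "\<dots> = e / 4" using s by simp
    finally have "\<bar>(\<phi> (2 * ?s) - 2 * \<phi> ?s - ?s\<^sup>2 * Q) / (4 * ?s\<^sup>2)\<bar> \<le> e / 4" .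
    moreover have "\<bar>a / 2 + b\<bar> \<le> \<bar>a\<bar> / 2 + e / 4" if "\<bar>b\<bar> \<le> e / 4" for a b :: real
      using that by linarith
    ultimately have "\<bar>?\<psi> t\<bar> \<le> \<bar>?\<psi> ?s\<bar> / 2 + e / 4" unfolding eq by blast
    also have "\<dots> \<le> (?B / 2 ^ n + e / 2) / 2 + e / 4" 
      by (intro add_right_mono divide_right_mono Suc.IH[OF s]) simp
    finally show ?case by (simp add: field_simps)
  qed
  have "\<bar>?\<psi> t\<bar> \<le> e / 2" if t: "0 < t" "t < ?d" for t
  proof -
    have "(\<lambda>n. ?B * (1 / 2) ^ n + e / 2) \<longlonglongrightarrow> ?B * 0 + e / 2"
      by (intro tendsto_intros LIMSEQ_power_zero) auto
    then have "\<bar>?\<psi> t\<bar> \<le> ?B * 0 + e / 2"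
      by (rule LIMSEQ_le_const) (use bound[OF t] in \<open>auto simp: power_one_over\<close>)
    then show ?thesis by simp
  qed
  then have "dist (\<phi> t / t\<^sup>2) (Q / 2) < e" if "0 < t" "t < ?d" for t
    using that e unfolding dist_real_def by fastforce
  then show "\<forall>\<^sub>F t in at_right 0. dist (\<phi> t / t\<^sup>2) (Q / 2) < e"
    unfolding eventually_at_right_field using bd(1) d1(1) by (intro exI[of _ ?d]) auto
qed

lemma Cauchy_at_right_0_converges:
  fixes g :: "real \<Rightarrow> real"
  assumes C: "\<And>e. 0 < e \<Longrightarrow> \<exists>d>0. \<forall>s t. 0 < s \<and> s < d \<and> 0 < t \<and> t < d \<longrightarrow> \<bar>g s - g t\<bar> \<le> e"
  shows "\<exists>l. (g \<longlongrightarrow> l) (at_right 0)"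
proof -
  let ?a = "\<lambda>n. g (inverse (real (Suc n)))"
  have "Cauchy ?a"
    unfolding Cauchy_def
  proof (intro allI impI)
    fix e :: real assume e: "0 < e"
    then obtain d where d: "0 < d" "\<And>s t. 0 < s \<Longrightarrow> s < d \<Longrightarrow> 0 < t \<Longrightarrow> t < d \<Longrightarrow> \<bar>g s - g t\<bar> \<le> e / 2"
      using C[of "e / 2"] by (metis half_gt_zero)
    obtain N where N: "inverse (real (Suc N)) < d" using reals_Archimedean[OF d(1)] by blast
    have "inverse (real (Suc n)) < d" if "N \<le> n" for n
      using N that by (smt (verit) inverse_le_iff_le of_nat_0_less_iff of_nat_le_iff Suc_le_mono zero_less_Suc)
    then have "\<bar>?a m - ?a n\<bar> \<le> e / 2" if "N \<le> m" "N \<le> n" for m n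
      using that by (intro d(2)) auto
    then have "dist (?a m) (?a n) < e" if "N \<le> m" "N \<le> n" for m n
      using that e unfolding dist_real_def by fastforce
    then show "\<exists>M. \<forall>m\<ge>M. \<forall>n\<ge>M. dist (?a m) (?a n) < e" by blast
  qed
  then obtain l where l: "?a \<longlonglongrightarrow> l" using Cauchy_convergent convergent_def by blast
  have "(g \<longlongrightarrow> l) (at_right 0)"
  proof (rule tendstoI)
    fix e :: real assume e: "0 < e"
    then obtain d where d: "0 < d" "\<And>s t. 0 < s \<Longrightarrow> s < d \<Longrightarrow> 0 < t \<Longrightarrow> t < d \<Longrightarrow> \<bar>g s - g t\<bar> \<le> e / 2"
      using C[of "e / 2"] by (metis half_gt_zero)
    have "\<forall>\<^sub>F n in sequentially. inverse (real (Suc n)) < d"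
      using LIMSEQ_inverse_real_of_nat d(1) by (rule order_tendstoD)
    moreover have "\<forall>\<^sub>F n in sequentially. dist (?a n) l < e / 2"
      using l e by (intro tendstoD) auto
    ultimately have "\<forall>\<^sub>F n in sequentially. inverse (real (Suc n)) < d \<and> dist (?a n) l < e / 2"
      by eventually_elim simp
    then obtain n where n: "inverse (real (Suc n)) < d" "dist (?a n) l < e / 2"
      using eventually_happens'[OF sequentially_bot] by blast
    have "dist (g t) l < e" if "0 < t" "t < d" for t
    proof -
      have "\<bar>g t - ?a n\<bar> \<le> e / 2" using that n(1) by (intro d(2)) auto
      then show ?thesis using n(2) unfolding dist_real_def by linarith
    qed
    then show "\<forall>\<^sub>F t in at_right 0. dist (g t) l < e"
      unfolding eventually_at_right_field using d(1) by (intro exI[of _ d]) auto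
  qed
  then show ?thesis ..
qed

context convex_contact
begin

definition rescaled :: "real \<Rightarrow> 'a \<Rightarrow> real" where "rescaled t h = fhat (x + t *\<^sub>R h) / t\<^sup>2"

text \<open>The constant is independent of t: \<open>fhat\<close> has Lipschitz constant O(R t) on
  the ball of radius R t, displacements carry another factor t, and division by t^2 cancels
  both.\<close>

lemma rescaled_lipschitz:
  assumes "norm h \<le> R" "norm k \<le> R" "0 < R" "0 < t" "2 * (R * t) < \<rho>"
  shows "\<bar>rescaled t h - rescaled t k\<bar> \<le> 4 * M * R * norm (h - k)"
proof -
  have "\<bar>fhat (x + t *\<^sub>R h) - fhat (x + t *\<^sub>R k)\<bar> \<le> 4 * M * (R * t) * norm (x + t *\<^sub>R h - (x + t *\<^sub>R k))"
    using assms by (intro fhat_lipschitz) (auto simp: dist_norm mult.commute[of t] mult_right_mono)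
  also have "x + t *\<^sub>R h - (x + t *\<^sub>R k) = t *\<^sub>R (h - k)" by (simp add: algebra_simps)
  finally have "\<bar>fhat (x + t *\<^sub>R h) - fhat (x + t *\<^sub>R k)\<bar> \<le> 4 * M * R * norm (h - k) * t\<^sup>2"
    using assms by (simp add: power2_eq_square mult_ac)
  then have "\<bar>fhat (x + t *\<^sub>R h) - fhat (x + t *\<^sub>R k)\<bar> / t\<^sup>2 \<le> 4 * M * R * norm (h - k)"
    using assms by (simp add: pos_divide_le_eq)
  then show ?thesis by (simp add: rescaled_def diff_divide_distrib[symmetric])
qed

lemma rescaled_bounds:
  "0 \<le> rescaled t h" "0 < t \<Longrightarrow> t * norm h < \<rho> \<Longrightarrow> rescaled t h \<le> M * (norm h)\<^sup>2"
proof -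
  show "0 \<le> rescaled t h" using fhat_bounds(1) by (simp add: rescaled_def)
  assume t: "0 < t" "t * norm h < \<rho>"
  then have "fhat (x + t *\<^sub>R h) \<le> M * (norm (x + t *\<^sub>R h - x))\<^sup>2"
    by (intro fhat_bounds) (auto simp: dist_norm)
  then show "rescaled t h \<le> M * (norm h)\<^sup>2"
    using t by (simp add: rescaled_def pos_divide_le_eq power_mult_distrib mult_ac)
qed

text \<open>In blow-up coordinates the base point w corresponds to the centre
  \<open>x + t *\<^sub>R w\<close>, which moves with t. The limit \<open>Q\<close> is the same for
  all w, and this is the source of the parallelogram law.\<close>

lemma rescaled_second_diff_tendsto:
  assumes Q: "\<forall>e>0. \<exists>d>0. \<forall>r s z. 0 < s \<and> s \<le> r \<and> r < d \<and> z \<in> ball x r \<longrightarrow>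
    \<bar>second_diff f v s z - s\<^sup>2 * Q\<bar> \<le> e * r\<^sup>2"
  shows "((\<lambda>t. rescaled t (w + v) + rescaled t (w - v) - 2 * rescaled t w) \<longlongrightarrow> Q) (at_right 0)"
proof (rule tendstoI)
  fix e :: real assume e: "0 < e"
  let ?R = "norm w + 1"
  have R: "0 < ?R" by (simp add: add_nonneg_pos)
  have e': "0 < e / 2 / ?R\<^sup>2" using e R by simp
  obtain d where d: "0 < d" "\<And>r s z. 0 < s \<Longrightarrow> s \<le> r \<Longrightarrow> r < d \<Longrightarrow> z \<in> ball x r \<Longrightarrow>
    \<bar>second_diff f v s z - s\<^sup>2 * Q\<bar> \<le> e / 2 / ?R\<^sup>2 * r\<^sup>2"
    using Q[rule_format, OF e'] by metis
  have "0 < d / ?R" using d R by simp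
  then have "\<forall>\<^sub>F t in at_right 0. 0 < t \<and> t < d / ?R" by (rule eventually_at_right_small)
  then show "\<forall>\<^sub>F t in at_right 0. dist (rescaled t (w + v) + rescaled t (w - v) - 2 * rescaled t w) Q < e"
  proof eventually_elim
    case (elim t)
    then have t: "0 < t" "?R * t < d" using R by (auto simp: pos_less_divide_eq mult.commute)
    have "\<bar>second_diff f v t (x + t *\<^sub>R w) - t\<^sup>2 * Q\<bar> \<le> e / 2 / ?R\<^sup>2 * (?R * t)\<^sup>2"
      using t by (intro d(2)) (auto simp: dist_norm algebra_simps)
    also have "\<dots> = e / 2 * t\<^sup>2" using R by (simp add: power_mult_distrib)
    finally have "\<bar>second_diff f v t (x + t *\<^sub>R w) - t\<^sup>2 * Q\<bar> / t\<^sup>2 \<le> e / 2"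
      using t by (simp add: pos_divide_le_eq)
    moreover have "second_diff f v t (x + t *\<^sub>R w) - t\<^sup>2 * Q
        = t\<^sup>2 * (rescaled t (w + v) + rescaled t (w - v) - 2 * rescaled t w - Q)"
      unfolding second_diff_fhat unfolding second_diff_def rescaled_def
      using t by (simp add: field_simps scaleR_add_right scaleR_diff_right)
    ultimately have "\<bar>rescaled t (w + v) + rescaled t (w - v) - 2 * rescaled t w - Q\<bar> \<le> e / 2"
      using t by (simp add: abs_mult)
    then show ?case using e by (simp add: dist_real_def)
  qed
qed

text \<open>The second difference with step t centred at \<open>x + t *\<^sub>R v\<close> has
  \<open>x\<close> as one end, where \<open>fhat\<close> vanishes. It is therefore the doubling
  expression of t -> fhat (x + t v).\<close>

lemma rescaled_tendsto:
  assumes Q: "\<forall>e>0. \<exists>d>0. \<forall>r s z. 0 < s \<and> s \<le> r \<and> r < d \<and> z \<in> ball x r \<longrightarrow>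
    \<bar>second_diff f v s z - s\<^sup>2 * Q\<bar> \<le> e * r\<^sup>2"
  shows "((\<lambda>t. rescaled t v) \<longlongrightarrow> Q / 2) (at_right 0)"
  unfolding rescaled_def
proof (rule doubling_expansion)
  let ?R = "norm v + 1"
  have R: "0 < ?R" by (simp add: add_nonneg_pos)
  show "0 < \<rho> / ?R" using \<rho> R by simp
  show "\<bar>fhat (x + t *\<^sub>R v)\<bar> \<le> M * (norm v)\<^sup>2 * t\<^sup>2" if t: "0 < t" "t < \<rho> / ?R" for t
  proof -
    have "t * ?R < \<rho>" using t R by (simp add: pos_less_divide_eq)
    then have "t * norm v < \<rho>" using t by (simp add: algebra_simps)
    then have "x + t *\<^sub>R v \<in> ball x \<rho>" using t by (simp add: dist_norm)
    from fhat_bounds(2)[OF this] fhat_bounds(1)[of "x + t *\<^sub>R v"] t show ?thesis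
      by (simp add: power_mult_distrib mult_ac)
  qed
  fix e :: real assume e: "0 < e"
  have e': "0 < e / ?R\<^sup>2" using e R by simp
  obtain d where d: "0 < d" "\<And>r s z. 0 < s \<Longrightarrow> s \<le> r \<Longrightarrow> r < d \<Longrightarrow> z \<in> ball x r \<Longrightarrow>
    \<bar>second_diff f v s z - s\<^sup>2 * Q\<bar> \<le> e / ?R\<^sup>2 * r\<^sup>2"
    using Q[rule_format, OF e'] by metis
  show "\<exists>d>0. \<forall>t. 0 < t \<and> t < d \<longrightarrow>
    \<bar>fhat (x + (2 * t) *\<^sub>R v) - 2 * fhat (x + t *\<^sub>R v) - t\<^sup>2 * Q\<bar> \<le> e * t\<^sup>2"
  proof (intro exI[of _ "d / ?R"] conjI allI impI)
    show "0 < d / ?R" using d R by simp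
    fix t assume "0 < t \<and> t < d / ?R"
    then have t: "0 < t" "?R * t < d" using R by (auto simp: pos_less_divide_eq mult.commute)
    have "\<bar>second_diff f v t (x + t *\<^sub>R v) - t\<^sup>2 * Q\<bar> \<le> e / ?R\<^sup>2 * (?R * t)\<^sup>2"
      using t by (intro d(2)) (auto simp: dist_norm algebra_simps)
    also have "\<dots> = e * t\<^sup>2" using R by (simp add: power_mult_distrib)
    also have "second_diff f v t (x + t *\<^sub>R v) = fhat (x + (2 * t) *\<^sub>R v) - 2 * fhat (x + t *\<^sub>R v)"
    proof -
      have *: "x + t *\<^sub>R v + t *\<^sub>R v = x + (2 * t) *\<^sub>R v"
        by (simp add: scaleR_add_left[symmetric] add.assoc)
      have "fhat x = 0" by (simp add: fhat_def)
      then show ?thesis unfolding second_diff_fhat unfolding second_diff_def * by simp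
    qed
    finally show "\<bar>fhat (x + (2 * t) *\<^sub>R v) - 2 * fhat (x + t *\<^sub>R v) - t\<^sup>2 * Q\<bar> \<le> e * t\<^sup>2" .
  qed
qed

text \<open>Directions in \<open>D\<close> converge by \<open>rescaled_tendsto\<close>, all others
  by approximation with the uniform Lipschitz bound. For v in \<open>D\<close> the same
  \<open>Q\<close> equals both 2 F v and the second difference of \<open>F\<close> at w; continuity
  of \<open>F\<close> extends this law from the dense set \<open>D\<close> to all v.\<close>

lemma blowup_exists:
  assumes reg: "x \<notin> irregular_points f D"
    and D: "\<And>S. open S \<Longrightarrow> S \<noteq> {} \<Longrightarrow> \<exists>v\<in>D. v \<in> S"
  obtains F where "\<And>h. ((\<lambda>t. rescaled t h) \<longlongrightarrow> F h) (at_right 0)"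
    "\<And>v w. F (w + v) + F (w - v) = 2 * F w + 2 * F v"
    "\<And>h. 0 \<le> F h \<and> F h \<le> M * (norm h)\<^sup>2"
    "\<And>R h k. norm h \<le> R \<Longrightarrow> norm k \<le> R \<Longrightarrow> 0 < R \<Longrightarrow> \<bar>F h - F k\<bar> \<le> 4 * M * R * norm (h - k)"
proof -
  have lipev: "\<forall>\<^sub>F t in at_right 0. \<bar>rescaled t h - rescaled t k\<bar> \<le> 4 * M * R * norm (h - k)"
    if hk: "norm h \<le> R" "norm k \<le> R" "0 < R" for h k R
  proof -
    have "0 < \<rho> / (2 * R)" using \<rho> hk by simp
    then have "\<forall>\<^sub>F t in at_right 0. 0 < t \<and> t < \<rho> / (2 * R)" by (rule eventually_at_right_small)
    then show ?thesis
    proof eventually_elim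
      case (elim t)
      then have "2 * (R * t) < \<rho>" using hk by (simp add: pos_less_divide_eq mult_ac)
      with elim hk show ?case by (intro rescaled_lipschitz) auto
    qed
  qed
  have "\<exists>l. ((\<lambda>t. rescaled t h) \<longlongrightarrow> l) (at_right 0)" for h
  proof (rule Cauchy_at_right_0_converges)
    fix e :: real assume e: "0 < e"
    let ?R = "norm h + 1"
    have R: "0 < ?R" by (simp add: add_nonneg_pos)
    have K: "0 < 4 * M * ?R + 1" using M R by (intro add_nonneg_pos mult_nonneg_nonneg) auto
    define \<eta> where "\<eta> = min 1 (e / 4 / (4 * M * ?R + 1))"
    have "0 < e / 4 / (4 * M * ?R + 1)" using e K by (intro divide_pos_pos) auto
    then have "0 < \<eta>" by (simp add: \<eta>_def)
    then obtain v where v: "v \<in> D" "v \<in> ball h \<eta>" using D[of "ball h \<eta>"] by auto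
    then have hv: "norm (h - v) < 1" "norm (h - v) < e / 4 / (4 * M * ?R + 1)"
      by (auto simp: dist_norm \<eta>_def)
    have nv: "norm v \<le> ?R" using norm_triangle_ineq2[of v h] hv by (simp add: norm_minus_commute)
    obtain Q where "\<forall>e>0. \<exists>d>0. \<forall>r s z. 0 < s \<and> s \<le> r \<and> r < d \<and> z \<in> ball x r \<longrightarrow>
      \<bar>second_diff f v s z - s\<^sup>2 * Q\<bar> \<le> e * r\<^sup>2" by (rule second_diff_near[OF reg v(1)])
    then have "((\<lambda>t. rescaled t v) \<longlongrightarrow> Q / 2) (at_right 0)" by (rule rescaled_tendsto)
    then have "\<forall>\<^sub>F t in at_right 0. dist (rescaled t v) (Q / 2) < e / 4"
      using e by (intro tendstoD) auto
    moreover have "\<forall>\<^sub>F t in at_right 0. \<bar>rescaled t h - rescaled t v\<bar> \<le> 4 * M * ?R * norm (h - v)"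
      using nv R by (intro lipev) auto
    ultimately have "\<forall>\<^sub>F t in at_right 0. \<bar>rescaled t h - Q / 2\<bar> \<le> e / 2"
    proof eventually_elim
      case (elim t)
      have "4 * M * ?R * norm (h - v) \<le> (4 * M * ?R + 1) * norm (h - v)"
        by (intro mult_right_mono) auto
      also have "\<dots> \<le> e / 4" 
        using hv(2) unfolding pos_less_divide_eq[OF K] mult.commute[of _ "norm (h - v)"]
        by (rule less_imp_le)
      finally show ?case using elim unfolding dist_real_def by linarith
    qed
    then obtain d where d: "0 < d" "\<And>t. 0 < t \<Longrightarrow> t < d \<Longrightarrow> \<bar>rescaled t h - Q / 2\<bar> \<le> e / 2"
      unfolding eventually_at_right_field by blast
    show "\<exists>d>0. \<forall>s t. 0 < s \<and> s < d \<and> 0 < t \<and> t < d \<longrightarrow> \<bar>rescaled s h - rescaled t h\<bar> \<le> e"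
    proof (intro exI[of _ d] conjI allI impI)
      fix s t assume "0 < s \<and> s < d \<and> 0 < t \<and> t < d"
      then show "\<bar>rescaled s h - rescaled t h\<bar> \<le> e" using d(2)[of s] d(2)[of t] by linarith
    qed (rule d(1))
  qed
  then obtain F where F: "\<And>h. ((\<lambda>t. rescaled t h) \<longlongrightarrow> F h) (at_right 0)" by metis
  have bot: "at_right (0::real) \<noteq> bot" by (simp add: trivial_limit_at_right_real)
  have lip: "\<bar>F h - F k\<bar> \<le> 4 * M * R * norm (h - k)"
    if "norm h \<le> R" "norm k \<le> R" "0 < R" for h k R
    by (rule tendsto_upperbound[OF _ lipev[OF that] bot]) (intro tendsto_intros F)
  have bounds: "0 \<le> F h \<and> F h \<le> M * (norm h)\<^sup>2" for h
  proof
    show "0 \<le> F h" by (rule tendsto_lowerbound[OF F _ bot]) (simp add: rescaled_bounds)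
    have "0 < \<rho> / (norm h + 1)" using \<rho> by (simp add: add_nonneg_pos)
    then have "\<forall>\<^sub>F t in at_right 0. 0 < t \<and> t < \<rho> / (norm h + 1)" by (rule eventually_at_right_small)
    then have "\<forall>\<^sub>F t in at_right 0. rescaled t h \<le> M * (norm h)\<^sup>2"
    proof eventually_elim
      case (elim t)
      then have "t * (norm h + 1) < \<rho>" by (simp add: pos_less_divide_eq add_nonneg_pos)
      with elim have "t * norm h < \<rho>" by (simp add: algebra_simps)
      with elim show ?case by (intro rescaled_bounds) auto
    qed
    then show "F h \<le> M * (norm h)\<^sup>2" by (rule tendsto_upperbound[OF F _ bot])
  qed
  have cont: "continuous_on UNIV F"
  proof (rule continuous_at_imp_continuous_on, rule ballI)
    fix h :: 'a
    have lim: "((\<lambda>k. 4 * M * (norm h + 1) * norm (h - k)) \<longlongrightarrow> 0) (at h)"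
      by (rule tendsto_eq_intros refl)+ simp
    have "\<forall>\<^sub>F k in at h. norm (F k - F h) \<le> 4 * M * (norm h + 1) * norm (h - k)"
    proof -
      have "\<forall>\<^sub>F k in at h. dist k h < 1" by (auto simp: eventually_at intro: exI[of _ 1])
      then show ?thesis
      proof eventually_elim
        case (elim k)
        then have "norm k \<le> norm h + 1" using norm_triangle_ineq2[of k h] by (simp add: dist_norm)
        then have "\<bar>F h - F k\<bar> \<le> 4 * M * (norm h + 1) * norm (h - k)"
          by (intro lip) (auto intro: add_nonneg_pos)
        then show ?case by (simp add: abs_minus_commute)
      qed
    qed
    then have "((\<lambda>k. F k - F h) \<longlongrightarrow> 0) (at h)" using lim by (rule Lim_null_comparison)
    then show "isCont F h" unfolding isCont_def by (rule LIM_zero_cancel)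
  qed
  have par_D: "F (w + v) + F (w - v) = 2 * F w + 2 * F v" if v: "v \<in> D" for v w
  proof -
    obtain Q where Q: "\<forall>e>0. \<exists>d>0. \<forall>r s z. 0 < s \<and> s \<le> r \<and> r < d \<and> z \<in> ball x r \<longrightarrow>
      \<bar>second_diff f v s z - s\<^sup>2 * Q\<bar> \<le> e * r\<^sup>2" by (rule second_diff_near[OF reg v])
    have "Q / 2 = F v" by (rule tendsto_unique[OF bot rescaled_tendsto[OF Q] F])
    moreover have "((\<lambda>t. rescaled t (w + v) + rescaled t (w - v) - 2 * rescaled t w)
        \<longlongrightarrow> F (w + v) + F (w - v) - 2 * F w) (at_right 0)" by (intro tendsto_intros F)
    then have "Q = F (w + v) + F (w - v) - 2 * F w"
      by (rule tendsto_unique[OF bot rescaled_second_diff_tendsto[OF Q]])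
    ultimately show ?thesis by simp
  qed
  have par: "F (w + v) + F (w - v) = 2 * F w + 2 * F v" for v w
  proof -
    let ?S = "{v. F (w + v) + F (w - v) = 2 * F w + 2 * F v}"
    have "closed ?S"
      by (intro closed_Collect_eq continuous_intros continuous_on_compose2[OF cont]) auto
    then have "open (- ?S)" by blast
    moreover have "\<not> (\<exists>v\<in>D. v \<in> - ?S)" using par_D by simp
    ultimately have "- ?S = {}" using D by meson
    then show ?thesis by blast
  qed
  show thesis by (rule that[OF F par bounds lip])
qed

end

section \<open>From the parallelogram law to a second-order expansion\<close>

text \<open>Subtracting \<open>c * \<phi> 1\<close> leaves an additive function that vanishes on the
  integers, hence has period 1 and is bounded on the whole line; multiples of a nonzero value would
  be unbounded.\<close>

lemma additive_bounded_imp_scale: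
  fixes \<phi> :: "real \<Rightarrow> real"
  assumes add: "\<And>a b. \<phi> (a + b) = \<phi> a + \<phi> b" and bd: "\<And>c. 0 \<le> c \<Longrightarrow> c \<le> 1 \<Longrightarrow> \<bar>\<phi> c\<bar> \<le> B"
  shows "\<phi> c = c * \<phi> 1"
proof -
  let ?\<psi> = "\<lambda>c. \<phi> c - c * \<phi> 1"
  have add': "?\<psi> (a + b) = ?\<psi> a + ?\<psi> b" for a b by (simp add: add algebra_simps)
  have zero: "?\<psi> 0 = 0" using add'[of 0 0] by simp
  have nat: "?\<psi> (real n * c) = real n * ?\<psi> c" for n c
  proof (induction n)
    case (Suc n)
    have "?\<psi> (real (Suc n) * c) = ?\<psi> (real n * c + c)" by (simp add: algebra_simps)
    then show ?case unfolding add' Suc by (simp add: algebra_simps)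
  qed (use zero in simp)
  have neg: "?\<psi> (- c) = - ?\<psi> c" for c using add'[of c "- c"] zero by simp
  have int: "?\<psi> (of_int k) = 0" for k :: int
  proof (cases k)
    case (nonneg n)
    then show ?thesis using nat[of n 1] by simp
  next
    case (neg n)
    have "?\<psi> (- real (Suc n)) = - ?\<psi> (real (Suc n))" by (rule \<open>\<And>c. ?\<psi> (- c) = - ?\<psi> c\<close>)
    also have "\<dots> = 0" using nat[of "Suc n" 1] by simp
    finally show ?thesis using neg by simp
  qed
  have bd': "\<bar>?\<psi> c\<bar> \<le> B + \<bar>\<phi> 1\<bar>" for c
  proof -
    have "?\<psi> c = ?\<psi> (of_int \<lfloor>c\<rfloor>) + ?\<psi> (frac c)"
      by (subst add'[symmetric]) (simp add: frac_def)
    then have "?\<psi> c = ?\<psi> (frac c)" using int by simp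
    moreover have "\<bar>\<phi> (frac c)\<bar> \<le> B" using frac_lt_1[of c] by (intro bd) auto
    moreover have "\<bar>frac c * \<phi> 1\<bar> \<le> 1 * \<bar>\<phi> 1\<bar>"
      unfolding abs_mult using frac_lt_1[of c] by (intro mult_right_mono) auto
    ultimately show ?thesis by linarith
  qed
  have "?\<psi> c = 0"
  proof (rule ccontr)
    assume "?\<psi> c \<noteq> 0"
    then obtain n where "B + \<bar>\<phi> 1\<bar> < real n * \<bar>?\<psi> c\<bar>"
      using reals_Archimedean3[of "\<bar>?\<psi> c\<bar>"] by auto
    also have "\<dots> = \<bar>?\<psi> (real n * c)\<bar>" unfolding nat by (simp add: abs_mult)
    also have "\<dots> \<le> B + \<bar>\<phi> 1\<bar>" by (rule bd')
    finally show False by simp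
  qed
  then show ?thesis by simp
qed

text \<open>Jordan--von Neumann: \<open>(F (u + w) - F u - F w) / 2\<close> is the associated bilinear form.\<close>
lemma parallelogram_imp_quadratic_form:
  fixes F :: "real^'n \<Rightarrow> real"
  assumes par: "\<And>v w. F (w + v) + F (w - v) = 2 * F w + 2 * F v"
    and bd: "\<And>h. 0 \<le> F h \<and> F h \<le> M * (norm h)\<^sup>2"
  obtains A where "sym_mat A" "\<And>h. F h = 1/2 * ((A *v h) \<bullet> h)"
proof -
  define B where "B u w = F (u + w) - F u - F w" for u w
  have sym: "B u w = B w u" for u w by (simp add: B_def add.commute)
  \<comment> \<open>The first plus the third instance minus the second leaves F (v - w), which the
    fourth eliminates. The identity is the additivity of \<open>B\<close> in disguise.\<close>
  have three: "F (u + v + w) = F (u + v) + F (v + w) + F (u + w) - F u - F v - F w" for u v w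
    using par[where w="u + w" and v=v] par[where w=u and v="v - w"] par[where w="u + v" and v=w]
      par[where w=v and v=w]
    by (simp add: algebra_simps)
  have add: "B (u + v) w = B u w + B v w" for u v w
    using three[of u v w] by (simp add: B_def)
  have scale: "B (c *\<^sub>R u) w = c * B u w" for c u w
  proof -
    have M: "0 \<le> M"
    proof -
      obtain i :: 'n where True by simp
      have "0 \<le> M * (norm (axis i (1::real)))\<^sup>2" using bd[of "axis i 1"] by linarith
      then show ?thesis by simp
    qed
    have "B (c *\<^sub>R u) w = c * B (1 *\<^sub>R u) w"
    proof (rule additive_bounded_imp_scale[where \<phi>="\<lambda>c. B (c *\<^sub>R u) w"])
      show "B ((a + b) *\<^sub>R u) w = B (a *\<^sub>R u) w + B (b *\<^sub>R u) w" for a b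
        by (simp add: add scaleR_add_left)
      fix c :: real assume c: "0 \<le> c" "c \<le> 1"
      have cu: "norm (c *\<^sub>R u) \<le> norm u" using c by (simp add: mult_left_le_one_le)
      then have "norm (c *\<^sub>R u + w) \<le> norm u + norm w"
        using norm_triangle_ineq[of "c *\<^sub>R u" w] by linarith
      then have "M * (norm (c *\<^sub>R u + w))\<^sup>2 \<le> M * (norm u + norm w)\<^sup>2"
        "M * (norm (c *\<^sub>R u))\<^sup>2 \<le> M * (norm u)\<^sup>2"
        using M cu by (auto intro!: mult_left_mono power_mono)
      then show "\<bar>B (c *\<^sub>R u) w\<bar> \<le> M * (norm u + norm w)\<^sup>2 + M * (norm u)\<^sup>2 + M * (norm w)\<^sup>2"
        using bd[of "c *\<^sub>R u + w"] bd[of "c *\<^sub>R u"] bd[of w] unfolding B_def by linarith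
    qed
    then show ?thesis by simp
  qed
  \<comment> \<open>The entries are those of \<open>B\<close>, not of B / 2: F (2 h) = 4 F h gives B
    h h = 2 F h, matching the factor 1/2 in second-order jets.\<close>
  define A :: "real^'n^'n" where "A = (\<chi> i j. B (axis i 1) (axis j 1))"
  have lin: "B (\<Sum>i\<in>I. c i *\<^sub>R b i) w = (\<Sum>i\<in>I. c i * B (b i) w)" if "finite I"
    for I :: "'n set" and c b w using that
  proof induction
    case empty
    then show ?case using scale[of 0 0 w] by simp
  qed (simp add: add scale)
  have expand: "(\<Sum>i\<in>UNIV. h $ i *\<^sub>R axis i 1) = h" for h :: "real^'n"
    using basis_expansion[of h] by (simp add: scalar_mult_eq_scaleR)
  show thesis
  proof
    show "sym_mat A" by (simp add: sym_mat_def A_def transpose_def vec_eq_iff sym)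
    fix h :: "real^'n"
    have "F 0 = 0" using bd[of 0] by simp
    then have "F (h + h) = 4 * F h" using par[of h h] by simp
    then have "F h = 1/2 * B h h" by (simp add: B_def)
    also have "B h h = (\<Sum>i\<in>UNIV. h $ i * B (axis i 1) h)"
      using lin[of UNIV "\<lambda>i. h $ i" "\<lambda>i. axis i 1" h] by (simp add: expand)
    also have "\<dots> = (\<Sum>i\<in>UNIV. h $ i * (\<Sum>j\<in>UNIV. h $ j * B (axis j 1) (axis i 1)))"
      using lin[of UNIV "\<lambda>j. h $ j" "\<lambda>j. axis j 1"] by (simp add: expand sym[of _ h])
    also have "\<dots> = (A *v h) \<bullet> h"
      by (simp add: A_def inner_vec_def matrix_vector_mult_def sum_distrib_left sum_distrib_right
          sym[of "axis _ 1" "axis _ 1"] mult_ac)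
    finally show "F h = 1/2 * ((A *v h) \<bullet> h)" .
  qed
qed

text \<open>Convergence of the blow-ups on a finite net of the unit sphere, together with their
  common Lipschitz bound, is uniform convergence on the sphere; with t = |y - x| this is the Peano
  expansion.\<close>

lemma second_jet_at_regular_contact:
  fixes f :: "real^'n \<Rightarrow> real"
  assumes cc: "convex_contact f x p M \<rho>" and reg: "x \<notin> irregular_points f D"
    and D: "\<And>S. open S \<Longrightarrow> S \<noteq> {} \<Longrightarrow> \<exists>v\<in>D. v \<in> S"
  shows "\<exists>A. has_second_jet f x p A"
proof -
  interpret convex_contact f x p M \<rho> by (rule cc)
  obtain F where F: "\<And>h. ((\<lambda>t. rescaled t h) \<longlongrightarrow> F h) (at_right 0)"
    and par: "\<And>v w. F (w + v) + F (w - v) = 2 * F w + 2 * F v"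
    and bd: "\<And>h. 0 \<le> F h \<and> F h \<le> M * (norm h)\<^sup>2"
    and lip: "\<And>R h k. norm h \<le> R \<Longrightarrow> norm k \<le> R \<Longrightarrow> 0 < R \<Longrightarrow> \<bar>F h - F k\<bar> \<le> 4 * M * R * norm (h - k)"
    using blowup_exists[OF reg D] by blast
  obtain A where A: "sym_mat A" "\<And>h. F h = 1/2 * ((A *v h) \<bullet> h)"
    using parallelogram_imp_quadratic_form[OF par bd] by blast
  have "((\<lambda>y. (f y - f x - p \<bullet> (y - x) - 1/2 * ((A *v (y - x)) \<bullet> (y - x))) / (norm (y - x))\<^sup>2)
        \<longlongrightarrow> 0) (at x)"
  proof (rule tendstoI)
    fix e :: real assume e: "0 < e"
    \<comment> \<open>Net points used have norm at most 2, so the Lipschitz constant is 8 M. Two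
      Lipschitz errors and one convergence error, each at most e / 4, stay below e.\<close>
    define \<eta> where "\<eta> = min 1 (e / 4 / (8 * M + 1))"
    have K: "0 < 8 * M + 1" using M by simp
    have \<eta>: "0 < \<eta>" "\<eta> \<le> 1" using e K by (auto simp: \<eta>_def)
    have "8 * M * \<eta> \<le> (8 * M + 1) * (e / 4 / (8 * M + 1))"
      using M \<eta> e by (intro mult_mono) (auto simp: \<eta>_def)
    also have "\<dots> = e / 4"
    proof -
      have "c * (a / c) = a" if "c \<noteq> 0" for a c :: real using that by simp
      from this[of "8 * M + 1" "e / 4"] K show ?thesis by linarith
    qed
    finally have M\<eta>: "8 * M * \<eta> \<le> e / 4" .
    obtain k where k: "finite k" "sphere 0 1 \<subseteq> (\<Union>h\<in>k. ball (h::real^'n) \<eta>)"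
      using compact_sphere[of "0::real^'n" 1] \<eta>(1) unfolding compact_eq_totally_bounded by meson
    have "\<forall>\<^sub>F t in at_right 0. \<forall>h\<in>k. dist (rescaled t h) (F h) < e / 4"
      using k(1) e by (intro eventually_ball_finite ballI tendstoD[OF F]) auto
    moreover have "\<forall>\<^sub>F t in at_right 0. 0 < t \<and> t < \<rho> / 4"
      using \<rho> by (intro eventually_at_right_small) simp
    ultimately have "\<forall>\<^sub>F t in at_right 0. 0 < t \<and> t < \<rho> / 4 \<and> (\<forall>h\<in>k. dist (rescaled t h) (F h) < e / 4)"
      by eventually_elim simp
    then obtain d where d: "0 < d" "\<And>t. 0 < t \<Longrightarrow> t < d \<Longrightarrow> t < \<rho> / 4 \<and> (\<forall>h\<in>k. dist (rescaled t h) (F h) < e / 4)"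
      unfolding eventually_at_right_field by blast
    have "dist ((f y - f x - p \<bullet> (y - x) - 1/2 * ((A *v (y - x)) \<bullet> (y - x))) / (norm (y - x))\<^sup>2) 0 < e"
      if y: "y \<noteq> x" "dist y x < d" for y
    proof -
      define t where "t = norm (y - x)"
      define h where "h = (1 / t) *\<^sub>R (y - x)"
      have t: "0 < t" "t < d" using y by (auto simp: t_def dist_norm)
      have h: "norm h = 1" "x + t *\<^sub>R h = y" "t *\<^sub>R h = y - x" using t by (auto simp: h_def t_def)
      obtain g where g: "g \<in> k" "h \<in> ball g \<eta>" using k(2) h(1) by (auto simp: subset_iff)
      then have hg: "norm (h - g) \<le> \<eta>" by (simp add: dist_norm norm_minus_commute)
      have ng: "norm g \<le> 2" using norm_triangle_ineq2[of g h] hg \<eta> h(1) by (simp add: norm_minus_commute)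
      have "\<bar>rescaled t h - rescaled t g\<bar> \<le> 4 * M * 2 * norm (h - g)"
        using h(1) ng t d(2)[of t] by (intro rescaled_lipschitz) auto
      moreover have "\<bar>F h - F g\<bar> \<le> 4 * M * 2 * norm (h - g)" using h(1) ng by (intro lip) auto
      moreover have "4 * M * 2 * norm (h - g) \<le> e / 4"
        using mult_left_mono[OF hg, of "8 * M"] M M\<eta> by simp
      moreover have "\<bar>rescaled t g - F g\<bar> < e / 4" using d(2)[OF t] g by (simp add: dist_real_def)
      ultimately have "\<bar>rescaled t h - F h\<bar> < e" by linarith
      moreover have "rescaled t h = (f y - f x - p \<bullet> (y - x)) / t\<^sup>2"
        by (simp add: rescaled_def h fhat_def)
      moreover have "F h = 1/2 * ((A *v (y - x)) \<bullet> (y - x)) / t\<^sup>2"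
        unfolding A(2) h_def
        by (simp add: matrix_vector_mult_scaleR power2_eq_square)
      ultimately show ?thesis by (simp add: dist_real_def t_def diff_divide_distrib)
    qed
    then show "\<forall>\<^sub>F y in at x. dist ((f y - f x - p \<bullet> (y - x)
        - 1/2 * ((A *v (y - x)) \<bullet> (y - x))) / (norm (y - x))\<^sup>2) 0 < e"
      unfolding eventually_at using d(1) by blast
  qed
  then show ?thesis using A(1) by (auto simp: has_second_jet_def)
qed

subsection \<open>Contact points outside null sets\<close>

text \<open>At h = - tau w the hypothesis reads 1 <= C tau after cancellation, false for small tau.
  Used wherever two first-order coefficients at a contact point must agree.\<close>

lemma linear_ge_quadratic_imp_zero:
  fixes w :: "'a::real_inner"
  assumes "0 < r" and ge: "\<And>h. norm h \<le> r \<Longrightarrow> - C * (norm h)\<^sup>2 \<le> w \<bullet> h"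
  shows "w = 0"
proof (rule ccontr)
  assume w: "w \<noteq> 0"
  define \<tau> where "\<tau> = min (r / norm w) (1 / 2 / (\<bar>C\<bar> + 1))"
  have \<tau>: "0 < \<tau>" "\<tau> \<le> r / norm w" "\<tau> \<le> 1 / 2 / (\<bar>C\<bar> + 1)"
    using w \<open>0 < r\<close> by (auto simp: \<tau>_def)
  have "norm (- \<tau> *\<^sub>R w) \<le> r" using \<tau> w by (simp add: pos_le_divide_eq)
  from ge[OF this] have "\<tau> * (norm w)\<^sup>2 \<le> \<tau> * (C * \<tau> * (norm w)\<^sup>2)"
    using \<tau>(1) by (simp add: dot_square_norm power_mult_distrib power2_eq_square mult_ac)
  then have "(norm w)\<^sup>2 \<le> C * \<tau> * (norm w)\<^sup>2" using \<tau>(1) by simp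
  then have "1 \<le> C * \<tau>" using w by simp
  also have "\<dots> \<le> (\<bar>C\<bar> + 1) * \<tau>" using \<tau>(1) by (intro mult_right_mono) auto
  also have "\<dots> \<le> 1 / 2" using \<tau>(3) by (simp add: pos_le_divide_eq algebra_simps)
  finally show False by simp
qed

text \<open>The maximisers \<open>X b\<close> of \<open>\<theta> y - b \<bullet> (y - x0)\<close> for small \<open>b\<close> are contact points, and
  \<open>b\<close> is a Lipschitz function of \<open>X b\<close>. As the image of a null set under a Lipschitz map is null,
  the set of maximisers is not null.\<close>
lemma contact_point_outside_null_set:
  fixes \<theta> :: "'a::euclidean_space \<Rightarrow> real"
  assumes cont: "continuous_on (cball x0 \<rho>) \<theta>" and \<rho>: "0 < \<rho>" and \<epsilon>: "0 < \<epsilon>" and C: "0 \<le> C"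
    and lower: "\<And>x. x \<in> ball x0 \<rho> \<Longrightarrow>
      \<exists>s. \<forall>y\<in>cball x0 \<rho>. \<theta> x + s \<bullet> (y - x) - C * (norm (y - x))\<^sup>2 \<le> \<theta> y"
    and strict: "\<And>y. y \<in> cball x0 \<rho> \<Longrightarrow> \<theta> y \<le> \<theta> x0 - \<epsilon> * (norm (y - x0))\<^sup>2"
    and Z: "negligible Z"
  obtains x b where "x \<in> ball x0 \<rho>" "x \<notin> Z" "\<And>y. y \<in> cball x0 \<rho> \<Longrightarrow> \<theta> y \<le> \<theta> x + b \<bullet> (y - x)"
proof -
  \<comment> \<open>Maximality of \<open>X b\<close> against \<open>strict\<close> gives eps |X b -
    x0| <= |b|. This \<open>\<delta>\<close> puts \<open>X b\<close> within
    \<open>\<rho> / 4\<close> of \<open>x0\<close>, leaving room \<open>\<rho> / 2\<close> for the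
    displacements below.\<close>
  define \<delta> where "\<delta> = \<epsilon> * \<rho> / 4"
  have \<delta>: "0 < \<delta>" using \<rho> \<epsilon> by (simp add: \<delta>_def)
  have "\<exists>x\<in>cball x0 \<rho>. \<forall>y\<in>cball x0 \<rho>. \<theta> y - b \<bullet> (y - x0) \<le> \<theta> x - b \<bullet> (x - x0)" for b
    using \<rho> by (intro continuous_attains_sup continuous_intros cont) auto
  then obtain X where X: "\<And>b. X b \<in> cball x0 \<rho>"
    "\<And>b y. y \<in> cball x0 \<rho> \<Longrightarrow> \<theta> y - b \<bullet> (y - x0) \<le> \<theta> (X b) - b \<bullet> (X b - x0)" by metis
  have near: "norm (X b - x0) < \<rho> / 4" if b: "b \<in> ball 0 \<delta>" for b
  proof (cases "X b = x0")
    case False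
    let ?n = "norm (X b - x0)"
    have n: "0 < ?n" using False by simp
    have "\<theta> x0 \<le> \<theta> (X b) - b \<bullet> (X b - x0)" using X(2)[of x0 b] \<rho> by simp
    also have "\<dots> \<le> \<theta> x0 - \<epsilon> * ?n\<^sup>2 - b \<bullet> (X b - x0)" using strict[OF X(1)[of b]] by simp
    finally have "\<theta> x0 \<le> \<theta> x0 - \<epsilon> * ?n\<^sup>2 - b \<bullet> (X b - x0)" .
    moreover have "- (b \<bullet> (X b - x0)) \<le> norm b * ?n"
      using Cauchy_Schwarz_ineq2[of b "X b - x0"] by linarith
    ultimately have "\<epsilon> * ?n\<^sup>2 \<le> norm b * ?n" by linarith
    then have "?n * (\<epsilon> * ?n) \<le> ?n * norm b" by (simp add: power2_eq_square mult_ac)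
    then have "\<epsilon> * ?n \<le> norm b" using n by simp
    also have "\<dots> < \<epsilon> * (\<rho> / 4)" using b by (simp add: \<delta>_def)
    finally show ?thesis using \<epsilon> by simp
  qed (use \<rho> in simp)
  have inball: "X b + h \<in> cball x0 \<rho>" if "b \<in> ball 0 \<delta>" "norm h \<le> \<rho> / 2" for b h
  proof -
    have "norm (X b + h - x0) \<le> norm (X b - x0) + norm h"
      using norm_triangle_ineq[of "X b - x0" h] by (simp add: algebra_simps)
    then show ?thesis using near[OF that(1)] that(2) \<rho> by (simp add: dist_norm norm_minus_commute)
  qed
  have Xball: "X b \<in> ball x0 \<rho>" if "b \<in> ball 0 \<delta>" for b
    using near[OF that] \<rho> by (simp add: dist_norm norm_minus_commute)
  have upb: "\<theta> y \<le> \<theta> (X b) + b \<bullet> (y - X b)" if "y \<in> cball x0 \<rho>" for y b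
    using X(2)[OF that, of b] by (simp add: inner_diff_right)
  \<comment> \<open>The slope from \<open>lower\<close> must be \<open>b\<close>: at the interior
    point \<open>X b\<close> it meets the contact from above with slope \<open>b\<close>, up to
    quadratic error.\<close>
  have lowb: "\<theta> (X b) + b \<bullet> (y - X b) - C * (norm (y - X b))\<^sup>2 \<le> \<theta> y"
    if b: "b \<in> ball 0 \<delta>" and y: "y \<in> cball x0 \<rho>" for b y
  proof -
    obtain s where s: "\<And>y. y \<in> cball x0 \<rho> \<Longrightarrow> \<theta> (X b) + s \<bullet> (y - X b) - C * (norm (y - X b))\<^sup>2 \<le> \<theta> y"
      using lower[OF Xball[OF b]] by blast
    have "b - s = 0"
    proof (rule linear_ge_quadratic_imp_zero)
      show "0 < \<rho> / 2" using \<rho> by simp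
      fix h :: 'a assume h: "norm h \<le> \<rho> / 2"
      show "- C * (norm h)\<^sup>2 \<le> (b - s) \<bullet> h"
        using s[OF inball[OF b h]] upb[OF inball[OF b h], of b] by (simp add: inner_diff_left)
    qed
    then show ?thesis using s[OF y] by simp
  qed
  have lip: "norm (b' - b) \<le> 2 * C * norm (X b' - X b)" if b: "b \<in> ball 0 \<delta>" and b': "b' \<in> ball 0 \<delta>" for b b'
  proof (cases "b' = b")
    case False
    let ?d = "norm (X b' - X b)"
    have d: "?d < \<rho> / 2"
      using norm_triangle_ineq4[of "X b' - x0" "X b - x0"] near[OF b] near[OF b'] by simp
    \<comment> \<open>At \<open>X b' + h\<close> compare the lower bound based at
      \<open>X b'\<close> with the upper bound based at \<open>X b\<close>. The radius r may exceed
      \<open>?d\<close>, so that \<open>?d = 0\<close> can be settled by letting r tend to 0; this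
      gives injectivity of \<open>X\<close>.\<close>
    have main: "norm (b' - b) \<le> 2 * C * r" if r: "?d \<le> r" "0 < r" "r \<le> \<rho> / 2" for r
    proof -
      define h where "h = (r / norm (b' - b)) *\<^sub>R (b' - b)"
      have nh: "norm h = r" using False r by (simp add: h_def)
      have bh: "(b' - b) \<bullet> h = r * norm (b' - b)"
        using False by (simp add: h_def power2_norm_eq_inner[symmetric] power2_eq_square)
      have z: "X b' + h \<in> cball x0 \<rho>" using inball[OF b', of h] nh r by simp
      have "\<theta> (X b') + b' \<bullet> h - C * r\<^sup>2 \<le> \<theta> (X b' + h)" using lowb[OF b' z] nh by simp
      moreover have "\<theta> (X b' + h) \<le> \<theta> (X b) + b \<bullet> (X b' + h - X b)" by (rule upb[OF z])
      moreover have "\<theta> (X b) + b \<bullet> (X b' - X b) - C * ?d\<^sup>2 \<le> \<theta> (X b')" by (rule lowb[OF b X(1)])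
      moreover have "C * ?d\<^sup>2 \<le> C * r\<^sup>2" using C r by (intro mult_left_mono power_mono) auto
      ultimately have "(b' - b) \<bullet> h \<le> 2 * C * r\<^sup>2" by (simp add: inner_diff_left inner_diff_right inner_add_right)
      then have "r * norm (b' - b) \<le> r * (2 * C * r)" unfolding bh by (simp add: power2_eq_square mult_ac)
      then show ?thesis using r by simp
    qed
    show ?thesis
    proof (cases "?d = 0")
      case False
      then show ?thesis using main[of ?d] d by simp
    next
      case True
      have "norm (b' - b) \<le> 0 + e" if e: "0 < e" for e
      proof -
        define r where "r = min (\<rho> / 2) (e / (2 * C + 1))"
        have r: "0 < r" "r \<le> \<rho> / 2" "r \<le> e / (2 * C + 1)"
          unfolding r_def using \<rho> e C by (simp_all only: min.cobounded1 min.cobounded2) simp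
        have "norm (b' - b) \<le> 2 * C * r" using main[of r] r True by simp
        also have "\<dots> \<le> (2 * C + 1) * r" using r(1) by (intro mult_right_mono) auto
        also have "\<dots> \<le> e" using r(3) C by (simp add: pos_le_divide_eq mult.commute)
        finally show ?thesis by simp
      qed
      then have "norm (b' - b) \<le> 0" by (rule field_le_epsilon)
      then show ?thesis using C by simp
    qed
  qed (simp add: C)
  have inj: "inj_on X (ball 0 \<delta>)"
  proof (rule inj_onI)
    fix b b' assume "b \<in> ball 0 \<delta>" "b' \<in> ball 0 \<delta>" "X b = X b'"
    then show "b = b'" using lip[of b b'] by simp
  qed
  let ?K = "X ` ball 0 \<delta>"
  have "\<not> ?K \<subseteq> Z"
  proof
    assume "?K \<subseteq> Z"
    then have "negligible ?K" using Z negligible_subset by blast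
    then have "negligible (inv_into (ball 0 \<delta>) X ` ?K)"
    proof (rule negligible_locally_Lipschitz_image[OF order_refl])
      fix k assume "k \<in> ?K"
      then show "\<exists>T B. open T \<and> k \<in> T \<and> (\<forall>y\<in>?K \<inter> T.
          norm (inv_into (ball 0 \<delta>) X y - inv_into (ball 0 \<delta>) X k) \<le> B * norm (y - k))"
        using lip inj by (intro exI[of _ UNIV] exI[of _ "2 * C"]) (auto simp: inv_into_f_f)
    qed
    then have "negligible (ball (0::'a) \<delta>)" using inv_into_image_cancel[OF inj order_refl] by simp
    then show False using open_not_negligible[of "ball (0::'a) \<delta>"] \<delta> by simp
  qed
  then obtain b where "b \<in> ball 0 \<delta>" "X b \<notin> Z" by blast
  then show thesis using that[of "X b" b] Xball upb by blast
qed

section \<open>Splitting a contact and its first-order consequences\<close>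

text \<open>Any choice of subgradients works: s + s' supports the sum from below while q touches it
  from above, which forces q = s + s'. Subtracting one supporting plane leaves the bound for the
  other summand with the same constant.\<close>

lemma convex_contact_split:
  fixes f g :: "'a::euclidean_space \<Rightarrow> real"
  assumes f: "convex_on UNIV f" and g: "convex_on UNIV g" and r: "0 < r" and K: "0 \<le> K"
    and up: "\<And>y. y \<in> ball x r \<Longrightarrow> f y + g y \<le> f x + g x + q \<bullet> (y - x) + K * (norm (y - x))\<^sup>2"
  obtains s s' where "convex_contact f x s K r" "convex_contact g x s' K r"
proof -
  obtain s where s: "\<And>y. f x + s \<bullet> (y - x) \<le> f y"
    using convex_on_subgradient[OF f open_UNIV, of x] by auto
  obtain s' where s': "\<And>y. g x + s' \<bullet> (y - x) \<le> g y"
    using convex_on_subgradient[OF g open_UNIV, of x] by auto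
  have "q - s - s' = 0"
  proof (rule linear_ge_quadratic_imp_zero)
    show "0 < r / 2" using r by simp
    fix h :: 'a assume "norm h \<le> r / 2"
    then have "x + h \<in> ball x r" using r by (simp add: dist_norm)
    from up[OF this] s[of "x + h"] s'[of "x + h"]
    show "- K * (norm h)\<^sup>2 \<le> (q - s - s') \<bullet> h" by (simp add: inner_diff_left)
  qed
  then have q: "q = s + s'" by (simp add: algebra_simps)
  have "convex_contact f x s K r"
  proof
    show "f y \<le> f x + s \<bullet> (y - x) + K * (norm (y - x))\<^sup>2" if "y \<in> ball x r" for y
      using up[OF that] s'[of y] by (simp add: q inner_add_left)
  qed (use f r K s in auto)
  moreover have "convex_contact g x s' K r"
  proof
    show "g y \<le> g x + s' \<bullet> (y - x) + K * (norm (y - x))\<^sup>2" if "y \<in> ball x r" for y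
      using up[OF that] s[of y] by (simp add: q inner_add_left)
  qed (use g r K s' in auto)
  ultimately show thesis by (rule that)
qed

text \<open>By convexity the difference quotients along the segment towards \<open>y\<close> never
  exceed \<open>f y - f z\<close>; neither does their limit.\<close>

lemma has_derivative_imp_subgradient:
  fixes f :: "'a::euclidean_space \<Rightarrow> real"
  assumes f: "convex_on UNIV f" and d: "(f has_derivative (\<lambda>h. s \<bullet> h)) (at z)"
  shows "f z + s \<bullet> (y - z) \<le> f y"
proof -
  let ?\<phi> = "\<lambda>t. f (z + t *\<^sub>R (y - z))"
  have "((\<lambda>t. z + t *\<^sub>R (y - z)) has_derivative (\<lambda>t. t *\<^sub>R (y - z))) (at 0)"
    by (auto intro!: derivative_eq_intros)
  moreover have "(f has_derivative (\<lambda>h. s \<bullet> h)) (at (z + 0 *\<^sub>R (y - z)))" using d by simp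
  ultimately have "((\<lambda>t. f (z + t *\<^sub>R (y - z))) has_derivative (\<lambda>t. s \<bullet> (t *\<^sub>R (y - z)))) (at 0)"
    by (rule has_derivative_compose)
  then have "(?\<phi> has_real_derivative s \<bullet> (y - z)) (at 0)"
    unfolding has_field_derivative_def by (rule has_derivative_eq_rhs) (simp add: fun_eq_iff)
  then have "(\<lambda>t. (?\<phi> t - ?\<phi> 0) / t) \<midarrow>0\<rightarrow> s \<bullet> (y - z)"
    unfolding has_field_derivative_iff by simp
  then have "((\<lambda>t. (?\<phi> t - ?\<phi> 0) / t) \<longlongrightarrow> s \<bullet> (y - z)) (at_right 0)"
    by (rule tendsto_mono[rotated]) (simp add: at_le)
  moreover have "\<forall>\<^sub>F t in at_right 0. (?\<phi> t - ?\<phi> 0) / t \<le> f y - f z"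
    unfolding eventually_at_right_field
  proof (intro exI[of _ 1] conjI allI impI)
    fix t :: real assume t: "0 < t" "t < 1"
    have "z + t *\<^sub>R (y - z) = (1 - t) *\<^sub>R z + t *\<^sub>R y" by (simp add: algebra_simps)
    then have "?\<phi> t \<le> (1 - t) * f z + t * f y" using convex_onD[OF f, of t z y] t by simp
    then have "?\<phi> t - ?\<phi> 0 \<le> (f y - f z) * t" by (simp add: algebra_simps)
    then show "(?\<phi> t - ?\<phi> 0) / t \<le> f y - f z" using t by (simp add: pos_divide_le_eq)
  qed simp
  ultimately have "s \<bullet> (y - z) \<le> f y - f z"
    by (rule tendsto_upperbound) (simp add: trivial_limit_at_right_real)
  then show ?thesis by simp
qed

context convex_contact
begin

lemma contact_has_derivative: "(f has_derivative (\<lambda>h. p \<bullet> h)) (at x)"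
  unfolding has_derivative_at2
proof
  show "bounded_linear (\<lambda>h. p \<bullet> h)" by (rule bounded_linear_inner_right)
  show "(\<lambda>y. (1 / norm (y - x)) *\<^sub>R (f y - (f x + p \<bullet> (y - x)))) \<midarrow>x\<rightarrow> 0"
  proof (rule Lim_null_comparison)
    show "(\<lambda>y. M * norm (y - x)) \<midarrow>x\<rightarrow> 0" by (rule tendsto_eq_intros refl)+ simp
    have "\<forall>\<^sub>F y in at x. y \<noteq> x \<and> y \<in> ball x \<rho>"
      unfolding eventually_at using \<rho> by (intro exI[of _ \<rho>]) (auto simp: dist_commute)
    then show "\<forall>\<^sub>F y in at x. norm ((1 / norm (y - x)) *\<^sub>R (f y - (f x + p \<bullet> (y - x)))) \<le> M * norm (y - x)"
    proof eventually_elim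
      case (elim y)
      then have "\<bar>fhat y\<bar> \<le> M * norm (y - x) * norm (y - x)"
        using fhat_bounds[of y] by (simp add: power2_eq_square)
      then have "\<bar>fhat y\<bar> / norm (y - x) \<le> M * norm (y - x)"
        using elim by (simp add: pos_divide_le_eq)
      then show ?case by (simp add: fhat_def diff_diff_eq)
    qed
  qed
qed

text \<open>Gradients of a convex function are subgradients, and those within r of \<open>x\<close>
  differ from \<open>p\<close> by at most 4 M r.\<close>

lemma gradients_tendsto_contact_gradient:
  assumes xs: "xs \<longlonglongrightarrow> x"
    and d: "\<forall>\<^sub>F j in sequentially. (f has_derivative (\<lambda>h. D j \<bullet> h)) (at (xs j))"
  shows "D \<longlonglongrightarrow> p"
proof (rule LIM_zero_cancel, rule tendstoI)
  fix e :: real assume e: "0 < e"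
  define r where "r = min (\<rho> / 4) (e / 2 / (4 * M + 1))"
  have r: "0 < r" "r \<le> \<rho> / 4" "r \<le> e / 2 / (4 * M + 1)"
    unfolding r_def using \<rho> M e by (simp_all only: min.cobounded1 min.cobounded2) simp
  have "4 * M * r \<le> (4 * M + 1) * r" using r(1) by (intro mult_right_mono) auto
  also have "\<dots> \<le> e / 2" using r(3) M by (simp add: pos_le_divide_eq algebra_simps)
  finally have Mr: "4 * M * r \<le> e / 2" .
  have "\<forall>\<^sub>F j in sequentially. dist (xs j) x < r" using xs r(1) by (rule tendstoD)
  with d show "\<forall>\<^sub>F j in sequentially. dist (D j - p) 0 < e"
  proof eventually_elim
    case (elim j)
    have "norm (D j - p) \<le> 4 * M * r"
    proof (rule subgradient_close_to_contact_gradient[of f x p "xs j"])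
      show "f (xs j) + D j \<bullet> (y - xs j) \<le> f y" for y
        by (rule has_derivative_imp_subgradient[OF cf elim(1)])
      show "f y \<le> f x + p \<bullet> (y - x) + M * (norm (y - x))\<^sup>2" if "y \<in> cball x (2 * r)" for y
        using that r \<rho> by (intro up) auto
    qed (use low r M elim in \<open>auto simp: dist_commute\<close>)
    then show ?case using Mr e by simp
  qed
qed

end

subsection \<open>Second-order jets\<close>

lemma norm_squared_expand:
  fixes x y :: "'a::real_inner"
  shows "(norm y)\<^sup>2 = (norm x)\<^sup>2 + 2 * (x \<bullet> (y - x)) + (norm (y - x))\<^sup>2"
  by (simp add: power2_norm_eq_inner inner_simps inner_commute)

lemma quadratic_form_bounded:
  fixes A :: "real^'n^'n"
  obtains a where "0 \<le> a" "\<And>h. \<bar>(A *v h) \<bullet> h\<bar> \<le> a * (norm h)\<^sup>2"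
proof
  have bl: "bounded_linear ((*v) A)" by (rule matrix_vector_mul_bounded_linear)
  show "0 \<le> onorm ((*v) A)" by (rule onorm_pos_le[OF bl])
  fix h
  have "\<bar>(A *v h) \<bullet> h\<bar> \<le> norm (A *v h) * norm h" by (rule Cauchy_Schwarz_ineq2)
  also have "\<dots> \<le> onorm ((*v) A) * norm h * norm h" by (intro mult_right_mono onorm[OF bl]) simp
  finally show "\<bar>(A *v h) \<bullet> h\<bar> \<le> onorm ((*v) A) * (norm h)\<^sup>2" by (simp add: power2_eq_square mult_ac)
qed

lemma sym_mat_inner: "sym_mat A \<Longrightarrow> (A *v h) \<bullet> k = (A *v k) \<bullet> h"
  by (metis dot_lmul_matrix inner_commute sym_mat_def vector_transpose_matrix)

lemma quadratic_form_expand: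
  assumes "sym_mat A"
  shows "(A *v (k + h)) \<bullet> (k + h) = (A *v k) \<bullet> k + 2 * ((A *v k) \<bullet> h) + (A *v h) \<bullet> h"
  using sym_mat_inner[OF assms, of h k]
  by (simp add: matrix_vector_right_distrib inner_add_left inner_add_right)

lemma scalar_mat_vector_mult: "(c *\<^sub>R mat 1 :: real^'n^'n) *v h = c *\<^sub>R h"
  by (metis matrix_vector_mul_lid scaleR_matrix_vector_assoc)

lemma sym_mat_scalar: "sym_mat (c *\<^sub>R mat 1 :: real^'n^'n)"
  by (simp add: sym_mat_def transpose_def vec_eq_iff mat_def)

lemma sym_mat_add: "sym_mat A \<Longrightarrow> sym_mat B \<Longrightarrow> sym_mat (A + B)"
  by (simp add: sym_mat_def transpose_def vec_eq_iff)

lemma sym_mat_diff: "sym_mat A \<Longrightarrow> sym_mat B \<Longrightarrow> sym_mat (A - B)"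
  by (simp add: sym_mat_def transpose_def vec_eq_iff)

lemma sym_mat_uminus: "sym_mat A \<Longrightarrow> sym_mat (- A)"
  by (simp add: sym_mat_def transpose_def vec_eq_iff)

lemma minus_matrix_vector_mult: "(- A :: real^'n^'n) *v h = - (A *v h)"
  by (simp add: matrix_vector_mult_def vec_eq_iff sum_negf)

lemma has_second_jet_add:
  assumes "has_second_jet f x p A" "has_second_jet g x q B"
  shows "has_second_jet (\<lambda>y. f y + g y) x (p + q) (A + B)"
proof -
  have "((\<lambda>y. (f y - f x - p \<bullet> (y - x) - 1/2 * ((A *v (y - x)) \<bullet> (y - x))) / (norm (y - x))\<^sup>2
      + (g y - g x - q \<bullet> (y - x) - 1/2 * ((B *v (y - x)) \<bullet> (y - x))) / (norm (y - x))\<^sup>2) \<longlongrightarrow> 0 + 0) (at x)"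
    using assms by (intro tendsto_add) (auto simp: has_second_jet_def)
  moreover have "(f y - f x - p \<bullet> (y - x) - 1/2 * ((A *v (y - x)) \<bullet> (y - x))) / (norm (y - x))\<^sup>2
      + (g y - g x - q \<bullet> (y - x) - 1/2 * ((B *v (y - x)) \<bullet> (y - x))) / (norm (y - x))\<^sup>2
      = (f y + g y - (f x + g x) - (p + q) \<bullet> (y - x) - 1/2 * (((A + B) *v (y - x)) \<bullet> (y - x))) / (norm (y - x))\<^sup>2"
    for y
    unfolding add_divide_distrib[symmetric] matrix_vector_mult_add_rdistrib inner_add_left
    by (simp add: algebra_simps)
  ultimately show ?thesis using assms by (simp add: has_second_jet_def sym_mat_add)
qed

lemma has_second_jet_uminus:
  assumes "has_second_jet f x p A"
  shows "has_second_jet (\<lambda>y. - f y) x (- p) (- A)"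
proof -
  have "((\<lambda>y. - ((f y - f x - p \<bullet> (y - x) - 1/2 * ((A *v (y - x)) \<bullet> (y - x))) / (norm (y - x))\<^sup>2)) \<longlongrightarrow> - 0) (at x)"
    using assms by (intro tendsto_minus) (auto simp: has_second_jet_def)
  moreover have "- ((f y - f x - p \<bullet> (y - x) - 1/2 * ((A *v (y - x)) \<bullet> (y - x))) / (norm (y - x))\<^sup>2)
      = (- f y - - f x - (- p) \<bullet> (y - x) - 1/2 * (((- A) *v (y - x)) \<bullet> (y - x))) / (norm (y - x))\<^sup>2" for y
    unfolding minus_divide_left minus_matrix_vector_mult inner_minus_left by (simp add: algebra_simps)
  ultimately show ?thesis using assms by (simp add: has_second_jet_def sym_mat_uminus)
qed

lemma has_second_jet_minus_quadratic:
  fixes f u :: "real^'n \<Rightarrow> real"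
  assumes f: "has_second_jet f x p A" and S: "open S" "x \<in> S"
    and eq: "\<And>y. y \<in> S \<Longrightarrow> u y = f y - c / 2 * (norm y)\<^sup>2"
  shows "has_second_jet u x (p - c *\<^sub>R x) (A - c *\<^sub>R mat 1)"
proof -
  have "\<forall>\<^sub>F y in at x. y \<in> S" using S eventually_at_topological by blast
  then have "\<forall>\<^sub>F y in at x. (f y - f x - p \<bullet> (y - x) - 1/2 * ((A *v (y - x)) \<bullet> (y - x))) / (norm (y - x))\<^sup>2
     = (u y - u x - (p - c *\<^sub>R x) \<bullet> (y - x) - 1/2 * (((A - c *\<^sub>R mat 1) *v (y - x)) \<bullet> (y - x))) / (norm (y - x))\<^sup>2"
  proof eventually_elim
    case (elim y)
    have "((A - c *\<^sub>R mat 1) *v (y - x)) \<bullet> (y - x) = (A *v (y - x)) \<bullet> (y - x) - c * (norm (y - x))\<^sup>2"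
      unfolding matrix_vector_mult_diff_rdistrib scalar_mat_vector_mult inner_diff_left
      by (simp add: power2_norm_eq_inner)
    moreover have "u y - u x = f y - f x - c * (x \<bullet> (y - x)) - c / 2 * (norm (y - x))\<^sup>2"
      unfolding eq[OF elim] eq[OF S(2)] norm_squared_expand[of y x] by (simp add: algebra_simps)
    moreover have "(p - c *\<^sub>R x) \<bullet> (y - x) = p \<bullet> (y - x) - c * (x \<bullet> (y - x))"
      by (simp add: inner_diff_left)
    ultimately show ?case by (simp add: algebra_simps)
  qed
  then have "((\<lambda>y. (u y - u x - (p - c *\<^sub>R x) \<bullet> (y - x)
     - 1/2 * (((A - c *\<^sub>R mat 1) *v (y - x)) \<bullet> (y - x))) / (norm (y - x))\<^sup>2) \<longlongrightarrow> 0) (at x)"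
    using f unfolding has_second_jet_def by (blast intro: Lim_transform_eventually)
  then show ?thesis using f by (simp add: has_second_jet_def sym_mat_diff sym_mat_scalar)
qed

text \<open>The linear parts must be compared first: they agree because the remaining terms are
  quadratic. Then a small multiple t h leaves only quadratic terms, and t^2 cancels.\<close>

lemma has_second_jet_le_contact:
  fixes f :: "real^'n \<Rightarrow> real"
  assumes f: "has_second_jet f x p A" and "0 < r"
    and up: "\<And>y. y \<in> ball x r \<Longrightarrow> f y \<le> f x + q \<bullet> (y - x) + 1/2 * ((B *v (y - x)) \<bullet> (y - x))"
  shows "(A *v h) \<bullet> h \<le> (B *v h) \<bullet> h"
proof -
  have key: "\<exists>d>0. \<forall>y. y \<noteq> x \<and> dist y x < d \<longrightarrow>
      - e * (norm (y - x))\<^sup>2 \<le> (q - p) \<bullet> (y - x) + 1/2 * ((B *v (y - x)) \<bullet> (y - x)) - 1/2 * ((A *v (y - x)) \<bullet> (y - x))"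
    if e: "0 < e" for e
  proof -
    have "\<forall>\<^sub>F y in at x. dist ((f y - f x - p \<bullet> (y - x) - 1/2 * ((A *v (y - x)) \<bullet> (y - x))) / (norm (y - x))\<^sup>2) 0 < e"
      using f e unfolding has_second_jet_def by (intro tendstoD) auto
    then obtain d where d: "0 < d" "\<And>y. y \<noteq> x \<Longrightarrow> dist y x < d \<Longrightarrow>
      dist ((f y - f x - p \<bullet> (y - x) - 1/2 * ((A *v (y - x)) \<bullet> (y - x))) / (norm (y - x))\<^sup>2) 0 < e"
      unfolding eventually_at by blast
    show ?thesis
    proof (intro exI[of _ "min d r"] conjI allI impI)
      fix y assume y: "y \<noteq> x \<and> dist y x < min d r"
      let ?N = "f y - f x - p \<bullet> (y - x) - 1/2 * ((A *v (y - x)) \<bullet> (y - x))"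
      have "\<bar>?N / (norm (y - x))\<^sup>2\<bar> < e" using d(2)[of y] y by (simp add: dist_real_def)
      then have "- e < ?N / (norm (y - x))\<^sup>2" by linarith
      then have "- e * (norm (y - x))\<^sup>2 < ?N" using y by (subst (asm) pos_less_divide_eq) auto
      moreover have "f y \<le> f x + q \<bullet> (y - x) + 1/2 * ((B *v (y - x)) \<bullet> (y - x))"
        using y by (intro up) (simp add: dist_commute)
      ultimately show "- e * (norm (y - x))\<^sup>2 \<le> (q - p) \<bullet> (y - x)
          + 1/2 * ((B *v (y - x)) \<bullet> (y - x)) - 1/2 * ((A *v (y - x)) \<bullet> (y - x))"
        unfolding inner_diff_left by linarith
    qed (use d \<open>0 < r\<close> in auto)
  qed
  obtain a where a: "0 \<le> a" "\<And>h. \<bar>(A *v h) \<bullet> h\<bar> \<le> a * (norm h)\<^sup>2" using quadratic_form_bounded[of A] by metis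
  obtain b where b: "0 \<le> b" "\<And>h. \<bar>(B *v h) \<bullet> h\<bar> \<le> b * (norm h)\<^sup>2" using quadratic_form_bounded[of B] by metis
  have "q - p = 0"
  proof -
    obtain d where d: "0 < d" "\<And>y. y \<noteq> x \<Longrightarrow> dist y x < d \<Longrightarrow> - 1 * (norm (y - x))\<^sup>2 \<le> (q - p) \<bullet> (y - x)
        + 1/2 * ((B *v (y - x)) \<bullet> (y - x)) - 1/2 * ((A *v (y - x)) \<bullet> (y - x))"
      using key[of 1] by (metis zero_less_one)
    show ?thesis
    proof (rule linear_ge_quadratic_imp_zero)
      show "0 < d / 2" using d(1) by simp
      fix k :: "real^'n" assume k: "norm k \<le> d / 2"
      show "- (1 + a / 2 + b / 2) * (norm k)\<^sup>2 \<le> (q - p) \<bullet> k"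
      proof (cases "k = 0")
        case False
        then have "- 1 * (norm k)\<^sup>2 \<le> (q - p) \<bullet> k + 1/2 * ((B *v k) \<bullet> k) - 1/2 * ((A *v k) \<bullet> k)"
          using d(2)[of "x + k"] k d(1) by (simp add: dist_norm)
        moreover have "- (1 + a / 2 + b / 2) * (norm k)\<^sup>2
            = - 1 * (norm k)\<^sup>2 - 1/2 * (a * (norm k)\<^sup>2) - 1/2 * (b * (norm k)\<^sup>2)"
          by (simp add: algebra_simps)
        ultimately show ?thesis using a(2)[of k] b(2)[of k] by linarith
      qed simp
    qed
  qed
  show ?thesis
  proof (cases "h = 0")
    case False
    show ?thesis
    proof (rule field_le_epsilon)
      fix e' :: real assume e': "0 < e'"
      define e where "e = e' / (2 * (norm h)\<^sup>2)"
      have "0 < e" using e' False by (simp add: e_def)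
      from key[OF this] obtain d where d: "0 < d" "\<And>y. y \<noteq> x \<Longrightarrow> dist y x < d \<Longrightarrow>
        - e * (norm (y - x))\<^sup>2 \<le> (q - p) \<bullet> (y - x) + 1/2 * ((B *v (y - x)) \<bullet> (y - x)) - 1/2 * ((A *v (y - x)) \<bullet> (y - x))"
        by metis
      define t where "t = d / 2 / norm h"
      have t: "0 < t" using d(1) False by (simp add: t_def)
      have "- e * (norm (t *\<^sub>R h))\<^sup>2 \<le> 1/2 * ((B *v (t *\<^sub>R h)) \<bullet> (t *\<^sub>R h)) - 1/2 * ((A *v (t *\<^sub>R h)) \<bullet> (t *\<^sub>R h))"
        using d(2)[of "x + t *\<^sub>R h"] d(1) t False \<open>q - p = 0\<close> by (simp add: dist_norm t_def)
      then have "t\<^sup>2 * ((A *v h) \<bullet> h) \<le> t\<^sup>2 * ((B *v h) \<bullet> h + 2 * e * (norm h)\<^sup>2)"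
        by (simp add: matrix_vector_mult_scaleR power_mult_distrib power2_eq_square algebra_simps)
      then have "(A *v h) \<bullet> h \<le> (B *v h) \<bullet> h + 2 * e * (norm h)\<^sup>2" using t by simp
      also have "2 * e * (norm h)\<^sup>2 = e'" using False by (simp add: e_def)
      finally show "(A *v h) \<bullet> h \<le> (B *v h) \<bullet> h + e'" .
    qed
  qed simp
qed

section \<open>Transfer between convex and quasi-convex functions\<close>

lemma has_derivative_quadratic: "((\<lambda>y::real^'n. k / 2 * (norm y)\<^sup>2) has_derivative (\<lambda>h. (k *\<^sub>R z) \<bullet> h)) (at z)"
  unfolding power2_norm_eq_inner by (auto intro!: derivative_eq_intros simp: inner_commute)

lemma quasi_convex_local_representation:
  fixes u :: "real^'n \<Rightarrow> real"
  assumes "quasi_convex_on X u" "ball x0 R \<subseteq> X" "0 < r" "r < R"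
  obtains c f where "0 \<le> c" "convex_on UNIV f" "\<And>y. y \<in> cball x0 r \<Longrightarrow> u y = f y - c / 2 * (norm y)\<^sup>2"
proof -
  obtain c where c: "0 \<le> c" "convex_on (ball x0 R) (\<lambda>y. u y + c / 2 * (norm y)\<^sup>2)"
    using assms(1,2) unfolding quasi_convex_on_def by (meson convex_ball)
  obtain f where "convex_on UNIV f" "\<And>y. y \<in> cball x0 r \<Longrightarrow> f y = u y + c / 2 * (norm y)\<^sup>2"
    using convex_extension_from_cball[OF c(2) assms(3,4)] by blast
  with c(1) show thesis by (intro that[of c f]) auto
qed

text \<open>\<open>c *\<^sub>R x0\<close> is the gradient at \<open>x0\<close> of the subtracted
  quadratic, so \<open>pu\<close> is the gradient of \<open>u\<close> there.\<close>

context
  fixes X :: "(real^'n) set" and u f :: "real^'n \<Rightarrow> real" and x0 p pu :: "real^'n" and M \<rho> c :: real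
  assumes cc: "convex_contact f x0 p M \<rho>" and sub: "ball x0 \<rho> \<subseteq> X"
    and eq: "\<And>y. y \<in> ball x0 \<rho> \<Longrightarrow> u y = f y - c / 2 * (norm y)\<^sup>2"
    and pu: "pu = p - c *\<^sub>R x0"
begin

interpretation convex_contact f x0 p M \<rho> by (rule cc)

lemma quasi_convex_contact_expand:
  assumes "y \<in> ball x0 \<rho>"
  shows "u y = u x0 + pu \<bullet> (y - x0) - c / 2 * (norm (y - x0))\<^sup>2 + fhat y"
proof -
  have x0: "x0 \<in> ball x0 \<rho>" using \<rho> by simp
  have "pu \<bullet> (y - x0) = p \<bullet> (y - x0) - c * (x0 \<bullet> (y - x0))" by (simp add: pu inner_diff_left)
  then show ?thesis
    unfolding eq[OF assms] eq[OF x0] fhat_def norm_squared_expand[of y x0] by (simp add: algebra_simps)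
qed

lemma quasi_convex_upper_contact_point: "upper_contact_point X u x0"
proof -
  \<comment> \<open>\<open>fhat\<close> contributes at most M |y - x0|^2 and the quadratic -c/2 |y -
    x0|^2; the factor 1/2 in jets turns this into \<open>2 * M - c\<close>.\<close>
  have "upper_contact_jet X u x0 pu ((2 * M - c) *\<^sub>R mat 1)"
    unfolding upper_contact_jet_def
  proof (intro conjI exI[of _ \<rho>] ballI impI)
    show "x0 \<in> X" using sub \<rho> by auto
    fix y assume "dist y x0 < \<rho>"
    then have y: "y \<in> ball x0 \<rho>" by (simp add: dist_commute)
    have "1/2 * ((((2 * M - c) *\<^sub>R mat 1) *v (y - x0)) \<bullet> (y - x0)) = M * (norm (y - x0))\<^sup>2 - c / 2 * (norm (y - x0))\<^sup>2"
      unfolding scalar_mat_vector_mult by (simp add: power2_norm_eq_inner algebra_simps)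
    then show "u y \<le> u x0 + pu \<bullet> (y - x0) + 1/2 * ((((2 * M - c) *\<^sub>R mat 1) *v (y - x0)) \<bullet> (y - x0))"
      using quasi_convex_contact_expand[OF y] fhat_bounds(2)[OF y] by linarith
  qed (auto simp: \<rho> sym_mat_scalar)
  then show ?thesis unfolding upper_contact_point_def by blast
qed

lemma quasi_convex_contact_has_derivative: "(u has_derivative (\<lambda>h. pu \<bullet> h)) (at x0)"
proof (rule has_derivative_transform_within_open[of _ _ _ _ "ball x0 \<rho>"])
  show "((\<lambda>y. f y - c / 2 * (norm y)\<^sup>2) has_derivative (\<lambda>h. pu \<bullet> h)) (at x0)"
    unfolding pu inner_diff_left by (intro has_derivative_diff contact_has_derivative has_derivative_quadratic)
qed (use eq \<rho> in auto)

text \<open>\<open>u\<close> stays above its tangent up to -c/2 |y - x0|^2, so an upper jet of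
  different slope would cross it.\<close>

lemma quasi_convex_contact_jet_unique:
  assumes "upper_contact_jet X u x0 q A"
  shows "q = pu"
proof -
  obtain r where r: "0 < r" "\<And>y. y \<in> X \<Longrightarrow> dist y x0 < r \<Longrightarrow>
      u y \<le> u x0 + q \<bullet> (y - x0) + 1/2 * ((A *v (y - x0)) \<bullet> (y - x0))"
    using assms unfolding upper_contact_jet_def by blast
  obtain a where a: "0 \<le> a" "\<And>h. \<bar>(A *v h) \<bullet> h\<bar> \<le> a * (norm h)\<^sup>2" using quadratic_form_bounded[of A] by metis
  have "q - pu = 0"
  proof (rule linear_ge_quadratic_imp_zero)
    show "0 < min r \<rho> / 2" using r(1) \<rho> by simp
    fix h :: "real^'n" assume "norm h \<le> min r \<rho> / 2"
    moreover have "0 < min r \<rho>" using r(1) \<rho> by simp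
    ultimately have "norm h < min r \<rho>" by linarith
    then have h: "x0 + h \<in> ball x0 \<rho>" "dist (x0 + h) x0 < r" by (auto simp: dist_norm)
    have "u (x0 + h) \<le> u x0 + q \<bullet> h + 1/2 * ((A *v h) \<bullet> h)"
      using r(2)[of "x0 + h"] h sub by auto
    moreover have "u x0 + pu \<bullet> h - c / 2 * (norm h)\<^sup>2 \<le> u (x0 + h)"
      using quasi_convex_contact_expand[OF h(1)] fhat_bounds(1)[of "x0 + h"] by simp
    moreover have "- (a / 2 + c / 2) * (norm h)\<^sup>2 = - (1/2 * (a * (norm h)\<^sup>2)) - c / 2 * (norm h)\<^sup>2"
      by (simp add: algebra_simps)
    ultimately show "- (a / 2 + c / 2) * (norm h)\<^sup>2 \<le> (q - pu) \<bullet> h"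
      using a(2)[of h] unfolding inner_diff_left by linarith
  qed
  then show ?thesis by simp
qed

lemma quasi_convex_contact_gradients_tendsto:
  assumes xs: "xs \<longlonglongrightarrow> x0" and d: "\<And>j. (u has_derivative (\<lambda>h. D j \<bullet> h)) (at (xs j))"
  shows "D \<longlonglongrightarrow> pu"
proof -
  have "\<forall>\<^sub>F j in sequentially. dist (xs j) x0 < \<rho>" using xs \<rho> by (rule tendstoD)
  then have "\<forall>\<^sub>F j in sequentially. (f has_derivative (\<lambda>h. (D j + c *\<^sub>R xs j) \<bullet> h)) (at (xs j))"
  proof eventually_elim
    case (elim j)
    have "((\<lambda>y. u y + c / 2 * (norm y)\<^sup>2) has_derivative (\<lambda>h. (D j + c *\<^sub>R xs j) \<bullet> h)) (at (xs j))"
      unfolding inner_add_left by (intro has_derivative_add d has_derivative_quadratic)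
    then show ?case
      by (rule has_derivative_transform_within_open[of _ _ _ _ "ball x0 \<rho>"])
         (use eq elim in \<open>auto simp: dist_commute\<close>)
  qed
  then have "(\<lambda>j. D j + c *\<^sub>R xs j) \<longlonglongrightarrow> p" by (rule gradients_tendsto_contact_gradient[OF xs])
  then have "(\<lambda>j. D j + c *\<^sub>R xs j - c *\<^sub>R xs j) \<longlonglongrightarrow> p - c *\<^sub>R x0"
    by (intro tendsto_diff tendsto_scaleR tendsto_const xs)
  then show ?thesis by (simp add: pu)
qed

end

text \<open>Subtracting the jet and an extra eps |y - x0|^2 from u + v makes \<open>x0\<close> a
  strict maximum, the situation of \<open>contact_point_outside_null_set\<close>. Adding the
  irregular points of \<open>f\<close> and \<open>g\<close> to the avoided set makes both summands
  twice differentiable at the point obtained; the extra term reappears as 2 eps in the Hessian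
  bound.\<close>

lemma second_jets_near_contact:
  fixes f g u v :: "real^'n \<Rightarrow> real"
  assumes f: "convex_on UNIV f" and g: "convex_on UNIV g" and c: "0 \<le> c1" "0 \<le> c2" and R: "0 < R"
    and u: "\<And>y. y \<in> ball x0 R \<Longrightarrow> u y = f y - c1 / 2 * (norm y)\<^sup>2"
    and v: "\<And>y. y \<in> ball x0 R \<Longrightarrow> v y = g y - c2 / 2 * (norm y)\<^sup>2"
    and A0: "sym_mat A0"
    and up: "\<And>y. y \<in> ball x0 R \<Longrightarrow>
      u y + v y \<le> u x0 + v x0 + p0 \<bullet> (y - x0) + 1/2 * ((A0 *v (y - x0)) \<bullet> (y - x0))"
    and Z: "negligible Z" and \<epsilon>: "0 < \<epsilon>"
  obtains x Du Dv Hu Hv where "x \<in> ball x0 \<epsilon>" "x \<in> ball x0 R" "x \<notin> Z"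
    "has_second_jet u x Du Hu" "has_second_jet v x Dv Hv"
    "\<And>h. - c1 * (norm h)\<^sup>2 \<le> (Hu *v h) \<bullet> h" "\<And>h. - c2 * (norm h)\<^sup>2 \<le> (Hv *v h) \<bullet> h"
    "\<And>h. (Hu *v h) \<bullet> h + (Hv *v h) \<bullet> h \<le> (A0 *v h) \<bullet> h + 2 * \<epsilon> * (norm h)\<^sup>2"
proof -
  obtain D :: "(real^'n) set" where D: "countable D" "\<And>S. open S \<Longrightarrow> S \<noteq> {} \<Longrightarrow> \<exists>d\<in>D. d \<in> S"
    using countable_dense_setE by blast
  let ?Z = "Z \<union> irregular_points f D \<union> irregular_points g D"
  have nZ: "negligible ?Z" by (intro negligible_Un Z negligible_irregular_points f g D(1))
  obtain a where a: "0 \<le> a" "\<And>h. \<bar>(A0 *v h) \<bullet> h\<bar> \<le> a * (norm h)\<^sup>2"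
    using quadratic_form_bounded[of A0] by metis
  define \<rho> where "\<rho> = min \<epsilon> R / 2"
  have \<rho>: "0 < \<rho>" "\<rho> < \<epsilon>" "\<rho> < R" using \<epsilon> R by (auto simp: \<rho>_def)
  have cball: "cball x0 \<rho> \<subseteq> ball x0 R" using \<rho> by auto
  define W where "W y = f y + g y - (c1 + c2) / 2 * (norm y)\<^sup>2" for y
  define \<theta> where "\<theta> y = W y - p0 \<bullet> (y - x0) - 1/2 * ((A0 *v (y - x0)) \<bullet> (y - x0)) - \<epsilon> * (norm (y - x0))\<^sup>2" for y
  have W: "W y = u y + v y" if "y \<in> ball x0 R" for y
    using u[OF that] v[OF that] by (simp add: W_def algebra_simps add_divide_distrib)
  \<comment> \<open>One constant for two purposes: it bounds the concave part of
    \<open>\<theta>\<close> in \<open>lower\<close>, and the quadratic growth in the contact of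
    \<open>f + g\<close> at \<open>x\<close>.\<close>
  define K where "K = (c1 + c2) / 2 + a / 2 + \<epsilon>"
  have K: "0 \<le> K" using c a \<epsilon> by (simp add: K_def)
  \<comment> \<open>The gradient at \<open>x\<close> of everything subtracted from \<open>W\<close>
    in \<open>\<theta>\<close>; it re-centres the expansion from \<open>x0\<close> to
    \<open>x\<close>.\<close>
  define q where "q x = p0 + A0 *v (x - x0) + (2 * \<epsilon>) *\<^sub>R (x - x0)" for x
  have \<theta>: "\<theta> y = \<theta> x + (W y - W x) - q x \<bullet> (y - x) - 1/2 * ((A0 *v (y - x)) \<bullet> (y - x)) - \<epsilon> * (norm (y - x))\<^sup>2" for x y
  proof -
    have "y - x0 = (x - x0) + (y - x)" by simp
    then have "(A0 *v (y - x0)) \<bullet> (y - x0) = (A0 *v (x - x0)) \<bullet> (x - x0)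
        + 2 * ((A0 *v (x - x0)) \<bullet> (y - x)) + (A0 *v (y - x)) \<bullet> (y - x)"
      using quadratic_form_expand[OF A0] by metis
    moreover have "(norm (y - x0))\<^sup>2 = (norm (x - x0))\<^sup>2 + 2 * ((x - x0) \<bullet> (y - x)) + (norm (y - x))\<^sup>2"
      using norm_squared_expand[of "y - x0" "x - x0"] by simp
    then have "\<epsilon> * (norm (y - x0))\<^sup>2
        = \<epsilon> * (norm (x - x0))\<^sup>2 + 2 * \<epsilon> * ((x - x0) \<bullet> (y - x)) + \<epsilon> * (norm (y - x))\<^sup>2"
      by (simp only: distrib_left mult_ac)
    moreover have "q x \<bullet> (y - x) = p0 \<bullet> (y - x) + (A0 *v (x - x0)) \<bullet> (y - x) + 2 * \<epsilon> * ((x - x0) \<bullet> (y - x))"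
      by (simp add: q_def inner_add_left)
    moreover have "p0 \<bullet> (y - x0) = p0 \<bullet> (x - x0) + p0 \<bullet> (y - x)" by (simp add: inner_diff_right)
    ultimately show ?thesis unfolding \<theta>_def by linarith
  qed
  have Wexp: "W y - W x = f y - f x + (g y - g x) - (c1 + c2) * (x \<bullet> (y - x)) - (c1 + c2) / 2 * (norm (y - x))\<^sup>2" for x y
    unfolding W_def norm_squared_expand[of y x] by (simp add: algebra_simps add_divide_distrib)
  have lower: "\<exists>s. \<forall>y\<in>cball x0 \<rho>. \<theta> x + s \<bullet> (y - x) - K * (norm (y - x))\<^sup>2 \<le> \<theta> y" for x
  proof -
    obtain s where s: "\<And>y. f x + s \<bullet> (y - x) \<le> f y"
      using convex_on_subgradient[OF f open_UNIV, of x] by auto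
    obtain s' where s': "\<And>y. g x + s' \<bullet> (y - x) \<le> g y"
      using convex_on_subgradient[OF g open_UNIV, of x] by auto
    have "\<theta> x + (s + s' - (c1 + c2) *\<^sub>R x - q x) \<bullet> (y - x) - K * (norm (y - x))\<^sup>2 \<le> \<theta> y" for y
    proof -
      have "K * (norm (y - x))\<^sup>2 = (c1 + c2) / 2 * (norm (y - x))\<^sup>2 + 1/2 * (a * (norm (y - x))\<^sup>2) + \<epsilon> * (norm (y - x))\<^sup>2"
        by (simp add: K_def algebra_simps)
      moreover have "(s + s' - (c1 + c2) *\<^sub>R x - q x) \<bullet> (y - x)
          = s \<bullet> (y - x) + s' \<bullet> (y - x) - (c1 + c2) * (x \<bullet> (y - x)) - q x \<bullet> (y - x)"
        by (simp only: inner_diff_left inner_add_left inner_scaleR_left)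
      ultimately show ?thesis
        using s[of y] s'[of y] a(2)[of "y - x"] \<theta>[of y x] Wexp[of y x] by linarith
    qed
    then show ?thesis by blast
  qed
  have strict: "\<theta> y \<le> \<theta> x0 - \<epsilon> * (norm (y - x0))\<^sup>2" if "y \<in> cball x0 \<rho>" for y
  proof -
    have y: "y \<in> ball x0 R" using that cball by blast
    have "x0 \<in> ball x0 R" using R by simp
    with up[OF y] W[OF y] W[of x0] show ?thesis unfolding \<theta>_def by simp
  qed
  have cont: "continuous_on (cball x0 \<rho>) \<theta>"
  proof -
    have "continuous_on UNIV \<theta>"
      unfolding \<theta>_def[abs_def] W_def
      by (intro continuous_intros convex_on_continuous f g open_UNIV
          continuous_on_compose2[OF linear_continuous_on[OF matrix_vector_mul_bounded_linear]]) auto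
    then show ?thesis by (rule continuous_on_subset) simp
  qed
  obtain x b where x: "x \<in> ball x0 \<rho>" "x \<notin> ?Z"
    and b: "\<And>y. y \<in> cball x0 \<rho> \<Longrightarrow> \<theta> y \<le> \<theta> x + b \<bullet> (y - x)"
    using contact_point_outside_null_set[OF cont \<rho>(1) \<epsilon> K lower strict nZ] by metis
  have xR: "x \<in> ball x0 R" using x(1) \<rho> by auto
  define r where "r = \<rho> - dist x0 x"
  have r: "0 < r" using x(1) by (simp add: r_def)
  have ball: "y \<in> cball x0 \<rho>" if "y \<in> ball x r" for y
    using that dist_triangle[of x0 y x] by (simp add: r_def)
  have Wup: "W y \<le> W x + (b + q x) \<bullet> (y - x) + 1/2 * ((A0 *v (y - x)) \<bullet> (y - x)) + \<epsilon> * (norm (y - x))\<^sup>2"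
    if "y \<in> ball x r" for y
    using b[OF ball[OF that]] \<theta>[of y x] unfolding inner_add_left by linarith
  have "f y + g y \<le> f x + g x + (b + q x + (c1 + c2) *\<^sub>R x) \<bullet> (y - x) + K * (norm (y - x))\<^sup>2"
    if "y \<in> ball x r" for y
  proof -
    have "K * (norm (y - x))\<^sup>2 = (c1 + c2) / 2 * (norm (y - x))\<^sup>2 + 1/2 * (a * (norm (y - x))\<^sup>2) + \<epsilon> * (norm (y - x))\<^sup>2"
      by (simp add: K_def algebra_simps)
    moreover have "(b + q x + (c1 + c2) *\<^sub>R x) \<bullet> (y - x) = (b + q x) \<bullet> (y - x) + (c1 + c2) * (x \<bullet> (y - x))"
      by (simp only: inner_add_left inner_scaleR_left)
    ultimately show ?thesis using Wup[OF that] Wexp[of y x] a(2)[of "y - x"] by linarith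
  qed
  then obtain s s' where s: "convex_contact f x s K r" "convex_contact g x s' K r"
    using convex_contact_split[OF f g r K] by metis
  obtain F where F: "has_second_jet f x s F"
    using second_jet_at_regular_contact[OF s(1) _ D(2)] x(2) by blast
  obtain G where G: "has_second_jet g x s' G"
    using second_jet_at_regular_contact[OF s(2) _ D(2)] x(2) by blast
  \<comment> \<open>A supporting plane below a function is an upper contact with zero matrix for its
    negative.\<close>
  have nonneg: "0 \<le> (H *v h) \<bullet> h" if jet: "has_second_jet \<phi> x \<sigma> H" and ct: "convex_contact \<phi> x \<sigma> K r" for \<phi> \<sigma> H h
  proof -
    have "((- H) *v h) \<bullet> h \<le> ((0 :: real^'n^'n) *v h) \<bullet> h"
    proof (rule has_second_jet_le_contact[OF has_second_jet_uminus[OF jet] r])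
      show "- \<phi> y \<le> - \<phi> x + (- \<sigma>) \<bullet> (y - x) + 1/2 * ((0 *v (y - x)) \<bullet> (y - x))" for y
        using convex_contact.low[OF ct, of y] by simp
    qed
    then show ?thesis by (simp add: minus_matrix_vector_mult)
  qed
  define Hu where "Hu = F - c1 *\<^sub>R mat 1"
  define Hv where "Hv = G - c2 *\<^sub>R mat 1"
  have ju: "has_second_jet u x (s - c1 *\<^sub>R x) Hu"
    unfolding Hu_def by (rule has_second_jet_minus_quadratic[OF F open_ball xR u])
  have jv: "has_second_jet v x (s' - c2 *\<^sub>R x) Hv"
    unfolding Hv_def by (rule has_second_jet_minus_quadratic[OF G open_ball xR v])
  show thesis
  proof (rule that[of x "s - c1 *\<^sub>R x" Hu "s' - c2 *\<^sub>R x" Hv])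
    show "x \<in> ball x0 \<epsilon>" using x(1) \<rho> by auto
    show "x \<notin> Z" using x(2) by blast
    show "- c1 * (norm h)\<^sup>2 \<le> (Hu *v h) \<bullet> h" for h
      using nonneg[OF F s(1), of h]
      by (simp add: Hu_def matrix_vector_mult_diff_rdistrib scalar_mat_vector_mult inner_diff_left power2_norm_eq_inner)
    show "- c2 * (norm h)\<^sup>2 \<le> (Hv *v h) \<bullet> h" for h
      using nonneg[OF G s(2), of h]
      by (simp add: Hv_def matrix_vector_mult_diff_rdistrib scalar_mat_vector_mult inner_diff_left power2_norm_eq_inner)
    fix h
    have "((Hu + Hv) *v h) \<bullet> h \<le> ((A0 + (2 * \<epsilon>) *\<^sub>R mat 1) *v h) \<bullet> h"
    proof (rule has_second_jet_le_contact[OF has_second_jet_add[OF ju jv] r])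
      fix y assume y: "y \<in> ball x r"
      have "1/2 * (((A0 + (2 * \<epsilon>) *\<^sub>R mat 1) *v (y - x)) \<bullet> (y - x))
          = 1/2 * ((A0 *v (y - x)) \<bullet> (y - x)) + \<epsilon> * (norm (y - x))\<^sup>2"
        unfolding matrix_vector_mult_add_rdistrib scalar_mat_vector_mult inner_add_left
        by (simp add: power2_norm_eq_inner)
      moreover have "y \<in> ball x0 R" using ball[OF y] cball by blast
      ultimately show "u y + v y \<le> u x + v x + (b + q x) \<bullet> (y - x)
          + 1/2 * (((A0 + (2 * \<epsilon>) *\<^sub>R mat 1) *v (y - x)) \<bullet> (y - x))"
        using Wup[OF y] W[of y] W[OF xR] by linarith
    qed
    then show "(Hu *v h) \<bullet> h + (Hv *v h) \<bullet> h \<le> (A0 *v h) \<bullet> h + 2 * \<epsilon> * (norm h)\<^sup>2"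
      unfolding matrix_vector_mult_add_rdistrib scalar_mat_vector_mult inner_add_left
      by (simp add: power2_norm_eq_inner)
  qed (use xR ju jv in auto)
qed

section \<open>Compactness of the Hessians and conclusion\<close>

text \<open>Polarisation: the form at the sum of two basis vectors is at most 4 k and the diagonal
  terms at most k each, so twice an entry is at most 6 k.\<close>

lemma sym_mat_norm_bound:
  fixes H :: "real^'n^'n"
  assumes H: "sym_mat H" and bd: "\<And>h. \<bar>(H *v h) \<bullet> h\<bar> \<le> k * (norm h)\<^sup>2"
  shows "norm H \<le> real CARD('n) * (real CARD('n) * (3 * k))"
proof -
  have k: "0 \<le> k"
  proof -
    obtain i :: 'n where True by simp
    show ?thesis using bd[of "axis i 1"] by simp
  qed
  have entry: "\<bar>H $ i $ j\<bar> \<le> 3 * k" for i j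
  proof -
    have "H $ i $ j = (H *v axis j 1) \<bullet> axis i 1"
      by (simp add: matrix_vector_mult_basis column_def inner_axis)
    moreover have "(H *v (axis j 1 + axis i 1)) \<bullet> (axis j 1 + axis i 1)
        = (H *v axis j 1) \<bullet> axis j 1 + 2 * ((H *v axis j 1) \<bullet> axis i 1) + (H *v axis i 1) \<bullet> axis i 1"
      by (rule quadratic_form_expand[OF H])
    moreover have "\<bar>(H *v (axis j 1 + axis i 1)) \<bullet> (axis j 1 + axis i 1)\<bar> \<le> k * 2\<^sup>2"
    proof -
      have "norm (axis j 1 + axis i 1 :: real^'n) \<le> 2"
        using norm_triangle_ineq[of "axis j 1 :: real^'n" "axis i 1"] by simp
      then have "k * (norm (axis j 1 + axis i 1 :: real^'n))\<^sup>2 \<le> k * 2\<^sup>2"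
        using k by (intro mult_left_mono power_mono) auto
      with bd[of "axis j 1 + axis i 1"] show ?thesis by linarith
    qed
    moreover have "\<bar>(H *v axis i 1) \<bullet> axis i 1\<bar> \<le> k" "\<bar>(H *v axis j 1) \<bullet> axis j 1\<bar> \<le> k"
      using bd[of "axis i 1"] bd[of "axis j 1"] by simp_all
    ultimately show ?thesis unfolding power2_eq_square by linarith
  qed
  have "norm H \<le> (\<Sum>i\<in>UNIV. norm (H $ i))" unfolding norm_vec_def[of H] by (rule L2_set_le_sum) simp
  also have "\<dots> \<le> (\<Sum>i\<in>(UNIV::'n set). real CARD('n) * (3 * k))"
  proof (rule sum_mono)
    fix i
    have "norm (H $ i) \<le> (\<Sum>j\<in>UNIV. \<bar>H $ i $ j\<bar>)" by (rule norm_le_l1_cart)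
    also have "\<dots> \<le> (\<Sum>j\<in>(UNIV::'n set). 3 * k)" by (intro sum_mono entry)
    finally show "norm (H $ i) \<le> real CARD('n) * (3 * k)" by simp
  qed
  finally show ?thesis by simp
qed

lemma tendsto_quadratic_form:
  fixes H :: "'i \<Rightarrow> real^'n^'n"
  assumes "(H \<longlongrightarrow> A) F"
  shows "((\<lambda>j. (H j *v h) \<bullet> h) \<longlongrightarrow> (A *v h) \<bullet> h) F"
  unfolding matrix_vector_mult_def inner_vec_def by (simp, intro tendsto_intros assms)

lemma sym_mat_limit:
  fixes H :: "nat \<Rightarrow> real^'n^'n"
  assumes H: "H \<longlonglongrightarrow> A" and sym: "\<And>j. sym_mat (H j)"
  shows "sym_mat A"
proof -
  have "A $ i $ k = A $ k $ i" for i k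
  proof (rule LIMSEQ_unique)
    show "(\<lambda>j. H j $ i $ k) \<longlonglongrightarrow> A $ i $ k" by (intro tendsto_intros H)
    have "H j $ i $ k = H j $ k $ i" for j
      using sym[of j] unfolding sym_mat_def transpose_def by (metis vec_lambda_beta)
    moreover have "(\<lambda>j. H j $ k $ i) \<longlonglongrightarrow> A $ k $ i" by (intro tendsto_intros H)
    ultimately show "(\<lambda>j. H j $ i $ k) \<longlonglongrightarrow> A $ k $ i" by simp
  qed
  then show ?thesis by (simp add: sym_mat_def transpose_def vec_eq_iff)
qed

theorem theorem6p1:
  fixes X :: "(real^'n) set" and u v :: "real^'n \<Rightarrow> real"
    and x0 p0 :: "real^'n" and A0 :: "real^'n^'n"
  assumes "open X"
    and "quasi_convex_on X u" and "quasi_convex_on X v"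
    and "x0 \<in> X"
    and "upper_contact_jet X (\<lambda>x. u x + v x) x0 p0 A0"
  shows "upper_contact_point X u x0 \<and> upper_contact_point X v x0 \<and>
    (\<exists>pu pv.
      \<comment> \<open>(a)\<close>
      (u has_derivative (\<lambda>h. pu \<bullet> h)) (at x0) \<and> (v has_derivative (\<lambda>h. pv \<bullet> h)) (at x0) \<and>
      (\<forall>p A. upper_contact_jet X u x0 p A \<longrightarrow> p = pu) \<and>
      (\<forall>p A. upper_contact_jet X v x0 p A \<longrightarrow> p = pv) \<and>
      \<comment> \<open>(b)\<close>
      (\<forall>xs :: nat \<Rightarrow> real^'n. \<forall>Du Dv :: nat \<Rightarrow> real^'n.
         xs \<longlonglongrightarrow> x0 \<and>
         (\<forall>j. xs j \<in> X \<and> (u has_derivative (\<lambda>h. Du j \<bullet> h)) (at (xs j))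
                       \<and> (v has_derivative (\<lambda>h. Dv j \<bullet> h)) (at (xs j)))
         \<longrightarrow> Du \<longlonglongrightarrow> pu \<and> Dv \<longlonglongrightarrow> pv) \<and>
      \<comment> \<open>(c)\<close>
      (\<forall>E :: (real^'n) set. (\<exists>r>0. ball x0 r - E \<in> null_sets lebesgue) \<longrightarrow>
         (\<exists>xs :: nat \<Rightarrow> real^'n. \<exists>Du Dv :: nat \<Rightarrow> real^'n. \<exists>Hu Hv :: nat \<Rightarrow> real^'n^'n.
          \<exists>A B :: real^'n^'n.
            xs \<longlonglongrightarrow> x0 \<and>
            (\<forall>j. xs j \<in> E \<and> xs j \<in> X \<and>
                 has_second_jet u (xs j) (Du j) (Hu j) \<and> has_second_jet v (xs j) (Dv j) (Hv j)) \<and>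
            Hu \<longlonglongrightarrow> A \<and> Hv \<longlonglongrightarrow> B \<and>
            sym_mat A \<and> sym_mat B \<and> psd_le (A + B) A0)))"
proof -
  obtain R0 where R0: "0 < R0" "ball x0 R0 \<subseteq> X" using openE[OF \<open>open X\<close> \<open>x0 \<in> X\<close>] by blast
  obtain r0 where r0: "0 < r0" "\<And>y. y \<in> X \<Longrightarrow> dist y x0 < r0 \<Longrightarrow>
      u y + v y \<le> u x0 + v x0 + p0 \<bullet> (y - x0) + 1/2 * ((A0 *v (y - x0)) \<bullet> (y - x0))"
    and A0: "sym_mat A0"
    using assms(5) unfolding upper_contact_jet_def by blast
  define R where "R = min R0 r0 / 2"
  have R: "0 < R" "R < R0" "R < r0" using R0 r0 by (auto simp: R_def)
  obtain c1 f where f: "0 \<le> c1" "convex_on UNIV f" "\<And>y. y \<in> cball x0 R \<Longrightarrow> u y = f y - c1 / 2 * (norm y)\<^sup>2"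
    using quasi_convex_local_representation[OF assms(2) R0(2) R(1,2)] by blast
  obtain c2 g where g: "0 \<le> c2" "convex_on UNIV g" "\<And>y. y \<in> cball x0 R \<Longrightarrow> v y = g y - c2 / 2 * (norm y)\<^sup>2"
    using quasi_convex_local_representation[OF assms(3) R0(2) R(1,2)] by blast
  have ballX: "ball x0 R \<subseteq> X" using R0(2) R by auto
  have fu: "u y = f y - c1 / 2 * (norm y)\<^sup>2" and gv: "v y = g y - c2 / 2 * (norm y)\<^sup>2"
    and up: "u y + v y \<le> u x0 + v x0 + p0 \<bullet> (y - x0) + 1/2 * ((A0 *v (y - x0)) \<bullet> (y - x0))"
    if y: "y \<in> ball x0 R" for y
  proof -
    show "u y = f y - c1 / 2 * (norm y)\<^sup>2" "v y = g y - c2 / 2 * (norm y)\<^sup>2"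
      using f(3)[of y] g(3)[of y] y by auto
    have "y \<in> X" using y ballX by blast
    then show "u y + v y \<le> u x0 + v x0 + p0 \<bullet> (y - x0) + 1/2 * ((A0 *v (y - x0)) \<bullet> (y - x0))"
      using y R by (intro r0(2)) (auto simp: dist_commute)
  qed
  obtain a where a: "0 \<le> a" "\<And>h. \<bar>(A0 *v h) \<bullet> h\<bar> \<le> a * (norm h)\<^sup>2"
    using quadratic_form_bounded[of A0] by metis
  define K where "K = (c1 + c2) / 2 + a / 2"
  have K: "0 \<le> K" using f(1) g(1) a(1) by (simp add: K_def)
  have "f y + g y \<le> f x0 + g x0 + (p0 + (c1 + c2) *\<^sub>R x0) \<bullet> (y - x0) + K * (norm (y - x0))\<^sup>2"
    if y: "y \<in> ball x0 R" for y
  proof -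
    have x0: "x0 \<in> ball x0 R" using R by simp
    have "K * (norm (y - x0))\<^sup>2 = (c1 + c2) / 2 * (norm (y - x0))\<^sup>2 + 1/2 * (a * (norm (y - x0))\<^sup>2)"
      by (simp add: K_def algebra_simps)
    moreover have "(p0 + (c1 + c2) *\<^sub>R x0) \<bullet> (y - x0) = p0 \<bullet> (y - x0) + (c1 + c2) * (x0 \<bullet> (y - x0))"
      by (simp only: inner_add_left inner_scaleR_left)
    moreover have "f y + g y = u y + v y + (c1 + c2) / 2 * (norm y)\<^sup>2"
      "f x0 + g x0 = u x0 + v x0 + (c1 + c2) / 2 * (norm x0)\<^sup>2"
      using fu[OF y] gv[OF y] fu[OF x0] gv[OF x0] by (simp_all add: algebra_simps add_divide_distrib)
    moreover have "(c1 + c2) / 2 * (norm y)\<^sup>2 = (c1 + c2) / 2 * (norm x0)\<^sup>2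
        + (c1 + c2) * (x0 \<bullet> (y - x0)) + (c1 + c2) / 2 * (norm (y - x0))\<^sup>2"
      unfolding norm_squared_expand[of y x0] by (simp add: distrib_left)
    ultimately show ?thesis using up[OF y] a(2)[of "y - x0"] by linarith
  qed
  then obtain s s' where s: "convex_contact f x0 s K R" and s': "convex_contact g x0 s' K R"
    using convex_contact_split[OF f(2) g(2) R(1) K] by metis
  define pu where "pu = s - c1 *\<^sub>R x0"
  define pv where "pv = s' - c2 *\<^sub>R x0"
  note cu = s ballX fu pu_def and cv = s' ballX gv pv_def
  have partc: "\<exists>xs :: nat \<Rightarrow> real^'n. \<exists>Du Dv :: nat \<Rightarrow> real^'n. \<exists>Hu Hv :: nat \<Rightarrow> real^'n^'n.
          \<exists>A B :: real^'n^'n.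
            xs \<longlonglongrightarrow> x0 \<and>
            (\<forall>j. xs j \<in> E \<and> xs j \<in> X \<and>
                 has_second_jet u (xs j) (Du j) (Hu j) \<and> has_second_jet v (xs j) (Dv j) (Hv j)) \<and>
            Hu \<longlonglongrightarrow> A \<and> Hv \<longlonglongrightarrow> B \<and>
            sym_mat A \<and> sym_mat B \<and> psd_le (A + B) A0"
    if fullE: "\<exists>r>0. ball x0 r - E \<in> null_sets lebesgue" for E
  proof -
    obtain r where r: "0 < r" "negligible (ball x0 r - E)"
      using fullE unfolding negligible_iff_null_sets by blast
    \<comment> \<open>The cap at \<open>r\<close> keeps the points in \<open>ball x0 r\<close>,
      where avoiding the null set \<open>ball x0 r - E\<close> means lying in
      \<open>E\<close>.\<close>
    define \<epsilon> where "\<epsilon> j = min r (inverse (real (Suc j)))" for j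
    have \<epsilon>: "0 < \<epsilon> j" "\<epsilon> j \<le> r" "\<epsilon> j \<le> inverse (real (Suc j))" for j using r by (auto simp: \<epsilon>_def)
    have "\<exists>x Du Dv Hu Hv. x \<in> ball x0 (\<epsilon> j) \<and> x \<in> ball x0 R \<and> x \<notin> ball x0 r - E \<and>
        has_second_jet u x Du Hu \<and> has_second_jet v x Dv Hv \<and>
        (\<forall>h. - c1 * (norm h)\<^sup>2 \<le> (Hu *v h) \<bullet> h) \<and> (\<forall>h. - c2 * (norm h)\<^sup>2 \<le> (Hv *v h) \<bullet> h) \<and>
        (\<forall>h. (Hu *v h) \<bullet> h + (Hv *v h) \<bullet> h \<le> (A0 *v h) \<bullet> h + 2 * \<epsilon> j * (norm h)\<^sup>2)" for j
      by (rule second_jets_near_contact[OF f(2) g(2) f(1) g(1) R(1) fu gv A0 up r(2) \<epsilon>(1)[of j]]) blast+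
    then obtain xs Du Dv Hu Hv where
      xs: "\<And>j. xs j \<in> ball x0 (\<epsilon> j)" "\<And>j. xs j \<in> ball x0 R" "\<And>j. xs j \<notin> ball x0 r - E"
      and ju: "\<And>j. has_second_jet u (xs j) (Du j) (Hu j)"
      and jv: "\<And>j. has_second_jet v (xs j) (Dv j) (Hv j)"
      and lu: "\<And>j h. - c1 * (norm h)\<^sup>2 \<le> (Hu j *v h) \<bullet> h"
      and lv: "\<And>j h. - c2 * (norm h)\<^sup>2 \<le> (Hv j *v h) \<bullet> h"
      and le: "\<And>j h. (Hu j *v h) \<bullet> h + (Hv j *v h) \<bullet> h \<le> (A0 *v h) \<bullet> h + 2 * \<epsilon> j * (norm h)\<^sup>2"
      by metis
    have symu: "sym_mat (Hu j)" and symv: "sym_mat (Hv j)" for j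
      using ju[of j] jv[of j] by (auto simp: has_second_jet_def)
    \<comment> \<open>From above, \<open>Hu\<close> is at most A0 + 2 eps - \<open>Hv\<close>, hence
      a + 2 r + c2 as a form; from below it is at least - c1. The same holds for \<open>Hv\<close>
      with c1 and c2 exchanged.\<close>
    define k where "k = a + 2 * r + c1 + c2"
    have ab: "\<bar>(Hu j *v h) \<bullet> h\<bar> \<le> k * (norm h)\<^sup>2" "\<bar>(Hv j *v h) \<bullet> h\<bar> \<le> k * (norm h)\<^sup>2" for j h
    proof -
      have "k * (norm h)\<^sup>2 = a * (norm h)\<^sup>2 + 2 * r * (norm h)\<^sup>2 + c1 * (norm h)\<^sup>2 + c2 * (norm h)\<^sup>2"
        by (simp add: k_def algebra_simps)
      moreover have "2 * \<epsilon> j * (norm h)\<^sup>2 \<le> 2 * r * (norm h)\<^sup>2"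
        using \<epsilon>(2)[of j] by (intro mult_right_mono) auto
      moreover have "0 \<le> a * (norm h)\<^sup>2" "0 \<le> 2 * r * (norm h)\<^sup>2" "0 \<le> c1 * (norm h)\<^sup>2" "0 \<le> c2 * (norm h)\<^sup>2"
        using a(1) r(1) f(1) g(1) by auto
      ultimately show "\<bar>(Hu j *v h) \<bullet> h\<bar> \<le> k * (norm h)\<^sup>2" "\<bar>(Hv j *v h) \<bullet> h\<bar> \<le> k * (norm h)\<^sup>2"
        using lu[of h j] lv[of h j] le[where h=h and j=j] a(2)[of h] by linarith+
    qed
    let ?N = "real CARD('n) * (real CARD('n) * (3 * k))"
    \<comment> \<open>Taken as pairs, so that a single subsequence serves both Hessians.\<close>
    have "bounded (range (\<lambda>j. (Hu j, Hv j)))"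
      unfolding bounded_iff
    proof (intro exI[of _ "?N + ?N"] ballI)
      fix z assume "z \<in> range (\<lambda>j. (Hu j, Hv j))"
      then obtain j where z: "z = (Hu j, Hv j)" by blast
      have "norm z \<le> norm (Hu j) + norm (Hv j)"
        unfolding z norm_Pair by (rule sqrt_sum_squares_le_sum) auto
      also have "\<dots> \<le> ?N + ?N"
        by (intro add_mono sym_mat_norm_bound symu symv ab)
      finally show "norm z \<le> ?N + ?N" .
    qed
    then obtain L \<sigma> where \<sigma>: "strict_mono \<sigma>" "((\<lambda>j. (Hu j, Hv j)) \<circ> \<sigma>) \<longlonglongrightarrow> L"
      using bounded_imp_convergent_subsequence by blast
    define A where "A = fst L"
    define B where "B = snd L"
    have A: "(\<lambda>j. Hu (\<sigma> j)) \<longlonglongrightarrow> A" and B: "(\<lambda>j. Hv (\<sigma> j)) \<longlonglongrightarrow> B"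
      using tendsto_fst[OF \<sigma>(2)] tendsto_snd[OF \<sigma>(2)] by (simp_all add: A_def B_def o_def)
    have \<epsilon>lim: "\<epsilon> \<longlonglongrightarrow> 0"
      by (rule tendsto_sandwich[OF _ _ tendsto_const LIMSEQ_inverse_real_of_nat])
         (use \<epsilon> in \<open>auto intro!: always_eventually less_imp_le\<close>)
    have "xs \<longlonglongrightarrow> x0"
    proof (rule metric_tendsto_imp_tendsto[OF \<epsilon>lim])
      show "\<forall>\<^sub>F j in sequentially. dist (xs j) x0 \<le> dist (\<epsilon> j) 0"
        using xs(1) \<epsilon>(1) by (intro always_eventually allI) (auto simp: dist_commute less_imp_le)
    qed
    then have "(\<lambda>j. xs (\<sigma> j)) \<longlonglongrightarrow> x0" using LIMSEQ_subseq_LIMSEQ[OF _ \<sigma>(1)] by (simp add: o_def)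
    moreover have "xs j \<in> E" "xs j \<in> X" for j
    proof -
      have "xs j \<in> ball x0 r" using xs(1)[of j] \<epsilon>(2)[of j] by auto
      then show "xs j \<in> E" using xs(3)[of j] by blast
      show "xs j \<in> X" using xs(2)[of j] ballX by blast
    qed
    moreover have "sym_mat A" "sym_mat B" by (rule sym_mat_limit[OF A symu] sym_mat_limit[OF B symv])+
    moreover have "psd_le (A + B) A0"
      unfolding psd_le_def
    proof
      fix h
      have "(A *v h) \<bullet> h + (B *v h) \<bullet> h \<le> (A0 *v h) \<bullet> h + 2 * 0 * (norm h)\<^sup>2"
      proof (rule LIMSEQ_le)
        show "(\<lambda>j. (Hu (\<sigma> j) *v h) \<bullet> h + (Hv (\<sigma> j) *v h) \<bullet> h) \<longlonglongrightarrow> (A *v h) \<bullet> h + (B *v h) \<bullet> h"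
          by (intro tendsto_add tendsto_quadratic_form A B)
        have "(\<lambda>j. \<epsilon> (\<sigma> j)) \<longlonglongrightarrow> 0" using LIMSEQ_subseq_LIMSEQ[OF \<epsilon>lim \<sigma>(1)] by (simp add: o_def)
        then show "(\<lambda>j. (A0 *v h) \<bullet> h + 2 * \<epsilon> (\<sigma> j) * (norm h)\<^sup>2) \<longlonglongrightarrow> (A0 *v h) \<bullet> h + 2 * 0 * (norm h)\<^sup>2"
          by (intro tendsto_intros)
      qed (use le in blast)
      then show "0 \<le> h \<bullet> ((A0 - (A + B)) *v h)"
        unfolding matrix_vector_mult_diff_rdistrib matrix_vector_mult_add_rdistrib
        by (simp add: inner_diff_right inner_add_right inner_commute)
    qed
    ultimately show ?thesis using ju jv A B
      by (intro exI[of _ "\<lambda>j. xs (\<sigma> j)"] exI[of _ "\<lambda>j. Du (\<sigma> j)"] exI[of _ "\<lambda>j. Dv (\<sigma> j)"]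
          exI[of _ "\<lambda>j. Hu (\<sigma> j)"] exI[of _ "\<lambda>j. Hv (\<sigma> j)"] exI[of _ A] exI[of _ B]) simp
  qed
  have partb: "Du \<longlonglongrightarrow> pu \<and> Dv \<longlonglongrightarrow> pv"
    if h: "xs \<longlonglongrightarrow> x0 \<and> (\<forall>j. xs j \<in> X \<and> (u has_derivative (\<lambda>h. Du j \<bullet> h)) (at (xs j))
                       \<and> (v has_derivative (\<lambda>h. Dv j \<bullet> h)) (at (xs j)))" for xs Du Dv
    using h by (intro conjI quasi_convex_contact_gradients_tendsto[OF cu]
        quasi_convex_contact_gradients_tendsto[OF cv]) auto
  have parta: "upper_contact_point X u x0" "upper_contact_point X v x0"
    "(u has_derivative (\<lambda>h. pu \<bullet> h)) (at x0)" "(v has_derivative (\<lambda>h. pv \<bullet> h)) (at x0)"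
    by (rule quasi_convex_upper_contact_point[OF cu] quasi_convex_upper_contact_point[OF cv]
        quasi_convex_contact_has_derivative[OF cu] quasi_convex_contact_has_derivative[OF cv]; assumption)+
  have unique: "upper_contact_jet X u x0 p A \<Longrightarrow> p = pu" "upper_contact_jet X v x0 p A \<Longrightarrow> p = pv" for p A
    by (rule quasi_convex_contact_jet_unique[OF cu] quasi_convex_contact_jet_unique[OF cv]; assumption)+
  show ?thesis
    by (rule conjI[OF parta(1) conjI[OF parta(2)]], rule exI[of _ pu], rule exI[of _ pv],
        intro conjI[OF parta(3) conjI[OF parta(4) conjI]] conjI allI impI)
       (erule unique | rule conjunct1[OF partb] conjunct2[OF partb] partc, assumption)+
qed

end
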